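(* Let $\rho>0$ and let $X=(X_1,\ldots,X_n)$ and $Y=(Y_1,\ldots,Y_n)$ be in $\mathcal C_\rho\subset B(\mathcal H)^n$ such that $X\overset{H}{\sim}Y$. Then the hyperbolic metric $\delta_\rho$ satisfies $$\delta_\rho(X,Y)=\ln\max\left\{\sup_{r\in[0,1)}\left\|C_{\rho,rX}C_{\rho,rY}^{-1}\right\|,\ \sup_{r\in[0,1)}\left\|C_{\rho,rY}C_{\rho,rX}^{-1}\right\|\right\},$$ where, for $Z=(Z_1,\ldots,Z_n)$ equal to $rX$ or $rY$, $C_{\rho,Z}:=\Delta_{\rho,Z}(I-R_Z)^{-1}$, $\Delta_{\rho,Z}:=[\rho I+(1-\rho)(R_Z^*+R_Z)+(\rho-2)R_Z^*R_Z]^{1/2}$, and $R_Z:=Z_1^*\otimes R_1+\cdots+Z_n^*\otimes R_n$ is the reconstruction operator.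
   Context: Let $n\ge1$, $\mathcal H$ a complex Hilbert space, $\mathcal K$ an infinite-dimensional Hilbert space. $\mathbb F_n^+$ is the unital free semigroup on generators $g_1,\ldots,g_n$ with identity $g_0$. $T_\alpha:=T_{i_1}\cdots T_{i_k}$ if $\alpha=g_{i_1}\cdots g_{i_k}$, $T_{g_0}:=I$. $T\in B(\mathcal H)^n$ is in the class $\mathcal C_\rho$ if there exist a Hilbert space $\mathcal G\supseteq\mathcal H$ and isometries $V_1,\ldots,V_n\in B(\mathcal G)$ with mutually orthogonal ranges such that $T_\alpha=\rho P_{\mathcal H}V_\alpha|_{\mathcal H}$ for all $\alpha\ne g_0$. $R_i\varphi:=\varphi\otimes e_i$ are the right creation operators on the full Fock space $F^2(H_n)=\mathbb C1\oplus\bigoplus_{k\ge1}H_n^{\otimes k}$ ($e_1,\ldots,e_n$ an orthonormal basis of the $n$-dimensional Hilbert space $H_n$); $R_Z$ acts on $\mathcal H\otimes F^2(H_n)$. Harnack domination: for $A,B\in\mathcal C_\rho$ and $c>0$, $A\overset{H}{\underset c\prec}B$ means $\Re p(A)+(\rho-1)\Re p(0)\le c^2[\Re p(B)+(\rho-1)\Re p(0)]$ for every noncommutative polynomial $p\in\mathbb C[X_1,\ldots,X_n]\otimes M_m$, $m\in\mathbb N$, such that $\Re p(X):=\frac12(p(X)^*+p(X))\ge0$ for all $X\in B(\mathcal K)^n$ with $\|\sum_iX_iX_i^*\|<1$; here $p(A)=\sum_\alpha A_\alpha\otimes M_\alpha$ for $p=\sum_\alpha X_\alpha\otimes M_\alpha$.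 $A\overset{H}{\underset c\sim}B$ means $A\overset{H}{\underset c\prec}B$ and $B\overset{H}{\underset c\prec}A$; $A\overset{H}{\sim}B$ means this holds for some $c\ge1$. The equivalence classes of $\overset{H}{\sim}$ are the Harnack parts of $\mathcal C_\rho$. On a Harnack part, the hyperbolic metric is $\delta_\rho(A,B):=\ln\inf\{c>1:A\overset{H}{\underset c\sim}B\}$. *)

theory Defs
  imports "HOL-Analysis.Analysis" "Jordan_Normal_Form.Matrix"
begin

section \<open>Complex Hilbert spaces\<close>

text \<open>The norm and the real inner product are those of \<^class>\<open>real_inner\<close>;
  \<open>cinner\<close> is linear in its first and conjugate-linear in its second argument.\<close>

class chilbert_space = real_inner + complete_space +
  fixes scaleC :: "complex \<Rightarrow> 'a \<Rightarrow> 'a" (infixr \<open>*\<^sub>C\<close> 75)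
    and cinner :: "'a \<Rightarrow> 'a \<Rightarrow> complex"
  assumes scaleC_add_right: "a *\<^sub>C (x + y) = a *\<^sub>C x + a *\<^sub>C y"
    and scaleC_add_left: "(a + b) *\<^sub>C x = a *\<^sub>C x + b *\<^sub>C x"
    and scaleC_scaleC: "a *\<^sub>C (b *\<^sub>C x) = (a * b) *\<^sub>C x"
    and scaleR_scaleC: "r *\<^sub>R x = complex_of_real r *\<^sub>C x"
    and cinner_add_left: "cinner (x + y) z = cinner x z + cinner y z"
    and cinner_scaleC_left: "cinner (a *\<^sub>C x) y = a * cinner x y"
    and cinner_commute: "cinner x y = cnj (cinner y x)"
    and inner_cinner: "inner x y = Re (cinner x y)"
begin

subclass banach ..

end

lemma scaleC_one: "1 *\<^sub>C (x::'a::chilbert_space) = x"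
  using scaleR_scaleC[of 1 x] by simp

lemma vector_space_scaleC:
  "vector_space (scaleC :: complex \<Rightarrow> 'a \<Rightarrow> 'a::chilbert_space)"
  by unfold_locales (simp_all add: scaleC_add_right scaleC_add_left scaleC_scaleC scaleC_one)

lemma cinner_scaleC_right: "cinner x (a *\<^sub>C y) = cnj a * cinner x (y::'a::chilbert_space)"
  by (metis cinner_commute cinner_scaleC_left complex_cnj_cnj complex_cnj_mult)

lemma cinner_add_right: "cinner x (y + z) = cinner x y + cinner x (z::'a::chilbert_space)"
  by (metis cinner_add_left cinner_commute complex_cnj_add)

lemma cinner_self: "cinner x x = complex_of_real ((norm (x::'a::chilbert_space))\<^sup>2)"
proof -
  have "Im (cinner x x) = 0"
    using arg_cong[OF cinner_commute[of x x], of Im] by simp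
  moreover have "Re (cinner x x) = (norm x)\<^sup>2"
    by (simp add: inner_cinner[symmetric] dot_square_norm)
  ultimately show ?thesis by (simp add: complex_eq_iff)
qed

lemma norm_scaleC: "norm (a *\<^sub>C x) = cmod a * norm (x::'a::chilbert_space)"
proof -
  have "complex_of_real ((norm (a *\<^sub>C x))\<^sup>2) = a * cnj a * complex_of_real ((norm x)\<^sup>2)"
    unfolding cinner_self[symmetric] cinner_scaleC_left cinner_scaleC_right by (simp only: ac_simps)
  also have "\<dots> = complex_of_real ((cmod a * norm x)\<^sup>2)"
    by (simp add: complex_norm_square[symmetric] power_mult_distrib flip: of_real_power)
  finally have "(norm (a *\<^sub>C x))\<^sup>2 = (cmod a * norm x)\<^sup>2"
    using of_real_eq_iff by blast
  then show ?thesis by (simp add: power2_eq_iff_nonneg)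
qed

lemma cmod_cinner_le: "cmod (cinner x y) \<le> norm x * norm (y::'a::chilbert_space)"
proof (cases "cinner x y = 0")
  case False
  define a where "a = cnj (cinner x y) / cmod (cinner x y)"
  have "cinner (a *\<^sub>C x) y = cmod (cinner x y)"
    using False by (simp add: a_def cinner_scaleC_left mult.commute[of "cnj _"]
        complex_norm_square[symmetric] power2_eq_square)
  then have "cmod (cinner x y) = inner (a *\<^sub>C x) y"
    by (simp add: inner_cinner)
  also have "\<dots> \<le> norm (a *\<^sub>C x) * norm y" by (rule norm_cauchy_schwarz)
  also have "\<dots> = norm x * norm y"
    using False by (simp add: norm_scaleC a_def norm_divide)
  finally show ?thesis .
qed simp

definition infinite_dimensional :: "'a::chilbert_space itself \<Rightarrow> bool" where
  "infinite_dimensional _ \<longleftrightarrow>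
     (\<nexists>B::'a set. finite B \<and> module.span scaleC B = UNIV)"

instantiation complex :: chilbert_space
begin

definition "scaleC_complex = ((*) :: complex \<Rightarrow> complex \<Rightarrow> complex)"
definition "cinner_complex = (\<lambda>x y::complex. x * cnj y)"

instance
  by standard
    (auto simp: scaleC_complex_def cinner_complex_def algebra_simps scaleR_conv_of_real
      inner_complex_def)

end


section \<open>Square-summable families\<close>

text \<open>\<open>('i, 'h) l2\<close> is the Hilbert space tensor product of \<open>'h\<close> with the Hilbert space
  \<open>('i, complex) l2\<close>, whose orthonormal basis is indexed by \<open>'i\<close>; see \<open>tensor_vec\<close> below.\<close>

typedef (overloaded) ('i, 'h) l2 =
  "{f :: 'i \<Rightarrow> 'h::chilbert_space. (\<lambda>i. (norm (f i))\<^sup>2) summable_on UNIV}"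
  morphisms l2_nth Abs_l2
  by (rule exI[of _ "\<lambda>_. 0"]) simp

setup_lifting type_definition_l2

lemma l2_summable: "(\<lambda>i. (norm (l2_nth f i))\<^sup>2) summable_on UNIV"
  using l2_nth[of f] by simp

lemma square_summable_add:
  fixes f g :: "'i \<Rightarrow> 'h::chilbert_space"
  assumes "(\<lambda>i. (norm (f i))\<^sup>2) summable_on UNIV" "(\<lambda>i. (norm (g i))\<^sup>2) summable_on UNIV"
  shows "(\<lambda>i. (norm (f i + g i))\<^sup>2) summable_on UNIV"
proof (rule summable_on_comparison_test)
  show "(\<lambda>i. 2 * (norm (f i))\<^sup>2 + 2 * (norm (g i))\<^sup>2) summable_on UNIV"
    using assms by (intro summable_on_add summable_on_cmult_right)
  fix i
  have "(norm (f i + g i))\<^sup>2 \<le> (norm (f i) + norm (g i))\<^sup>2"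
    by (intro power_mono norm_triangle_ineq) simp
  also have "\<dots> \<le> 2 * (norm (f i))\<^sup>2 + 2 * (norm (g i))\<^sup>2"
    using sum_squares_bound[of "norm (f i)" "norm (g i)"] by (simp add: power2_sum)
  finally show "(norm (f i + g i))\<^sup>2 \<le> 2 * (norm (f i))\<^sup>2 + 2 * (norm (g i))\<^sup>2" .
qed simp

lemma square_summable_scale:
  fixes f :: "'i \<Rightarrow> 'h::chilbert_space"
  assumes "(\<lambda>i. (norm (f i))\<^sup>2) summable_on UNIV"
  shows "(\<lambda>i. (norm (c *\<^sub>C f i))\<^sup>2) summable_on UNIV"
  using assms by (simp add: norm_scaleC power_mult_distrib summable_on_cmult_right)

lemma l2_cinner_summable:
  "(\<lambda>i. cinner (l2_nth f i) (l2_nth g i)) summable_on UNIV"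
proof (rule abs_summable_summable, rule summable_on_comparison_test)
  show "(\<lambda>i. (norm (l2_nth f i))\<^sup>2 + (norm (l2_nth g i))\<^sup>2) summable_on UNIV"
    by (intro summable_on_add l2_summable)
  fix i
  have "2 * (norm (l2_nth f i) * norm (l2_nth g i))
          \<le> (norm (l2_nth f i))\<^sup>2 + (norm (l2_nth g i))\<^sup>2"
    using sum_squares_bound[of "norm (l2_nth f i)" "norm (l2_nth g i)"] by simp
  moreover have "0 \<le> norm (l2_nth f i) * norm (l2_nth g i)" by simp
  ultimately show "cmod (cinner (l2_nth f i) (l2_nth g i))
      \<le> (norm (l2_nth f i))\<^sup>2 + (norm (l2_nth g i))\<^sup>2"
    using cmod_cinner_le[of "l2_nth f i" "l2_nth g i"] by linarith
qed simp

lemma l2_inner_summable: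
  "(\<lambda>i. inner (l2_nth f i) (l2_nth g i)) summable_on UNIV"
  unfolding inner_cinner by (rule summable_on_Re[OF l2_cinner_summable])

instantiation l2 :: (type, chilbert_space) real_inner
begin

lift_definition zero_l2 :: "('a, 'b) l2" is "\<lambda>_. 0" by simp

lift_definition plus_l2 :: "('a, 'b) l2 \<Rightarrow> ('a, 'b) l2 \<Rightarrow> ('a, 'b) l2"
  is "\<lambda>f g i. f i + g i" by (rule square_summable_add)

lift_definition uminus_l2 :: "('a, 'b) l2 \<Rightarrow> ('a, 'b) l2"
  is "\<lambda>f i. - f i" by simp

lift_definition minus_l2 :: "('a, 'b) l2 \<Rightarrow> ('a, 'b) l2 \<Rightarrow> ('a, 'b) l2"
  is "\<lambda>f g i. f i - g i"
  using square_summable_add[of _ "\<lambda>i. - _ i"] by fastforce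

lift_definition scaleR_l2 :: "real \<Rightarrow> ('a, 'b) l2 \<Rightarrow> ('a, 'b) l2"
  is "\<lambda>c f i. c *\<^sub>R f i" unfolding scaleR_scaleC by (rule square_summable_scale)

definition inner_l2 :: "('a, 'b) l2 \<Rightarrow> ('a, 'b) l2 \<Rightarrow> real" where
  "inner_l2 f g = (\<Sum>\<^sub>\<infinity>i. inner (l2_nth f i) (l2_nth g i))"

definition norm_l2 :: "('a, 'b) l2 \<Rightarrow> real" where
  "norm_l2 f = sqrt (inner f f)"

definition sgn_l2 :: "('a, 'b) l2 \<Rightarrow> ('a, 'b) l2" where
  "sgn_l2 f = inverse (norm f) *\<^sub>R f"

definition dist_l2 :: "('a, 'b) l2 \<Rightarrow> ('a, 'b) l2 \<Rightarrow> real" where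
  "dist_l2 f g = norm (f - g)"

definition uniformity_l2 :: "(('a, 'b) l2 \<times> ('a, 'b) l2) filter" where
  "uniformity_l2 = (INF e\<in>{0 <..}. principal {(x, y). dist x y < e})"

definition open_l2 :: "('a, 'b) l2 set \<Rightarrow> bool" where
  "open_l2 U = (\<forall>x\<in>U. eventually (\<lambda>(x', y). x' = x \<longrightarrow> y \<in> U) uniformity)"

lemma inner_l2_self: "inner (f::('a, 'b) l2) f = (\<Sum>\<^sub>\<infinity>i. (norm (l2_nth f i))\<^sup>2)"
  by (simp add: inner_l2_def dot_square_norm)

instance
proof
  fix f g h :: "('a, 'b) l2" and a b :: real
  show "f + g + h = f + (g + h)" by transfer (simp add: add.assoc)
  show "f + g = g + f" by transfer (simp add: add.commute)
  show "0 + f = f" by transfer simp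
  show "- f + f = 0" by transfer simp
  show "f - g = f + - g" by transfer simp
  show "a *\<^sub>R (f + g) = a *\<^sub>R f + a *\<^sub>R g" by transfer (simp add: scaleR_add_right)
  show "(a + b) *\<^sub>R f = a *\<^sub>R f + b *\<^sub>R f" by transfer (simp add: scaleR_add_left)
  show "a *\<^sub>R b *\<^sub>R f = (a * b) *\<^sub>R f" by transfer simp
  show "1 *\<^sub>R f = f" by transfer simp
  show "sgn f = inverse (norm f) *\<^sub>R f" by (rule sgn_l2_def)
  show "dist f g = norm (f - g)" by (rule dist_l2_def)
  show "uniformity = (INF e\<in>{0 <..}. principal {(x, y::('a, 'b) l2). dist x y < e})"
    by (rule uniformity_l2_def)
  show "open U = (\<forall>x\<in>U. \<forall>\<^sub>F (x', y) in uniformity. x' = x \<longrightarrow> y \<in> U)"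
    for U :: "('a, 'b) l2 set" by (rule open_l2_def)
  show "inner f g = inner g f"
    by (simp add: inner_l2_def inner_commute)
  show "inner (f + g) h = inner f h + inner g h"
    unfolding inner_l2_def plus_l2.rep_eq inner_add_left
    by (intro infsum_add l2_inner_summable)
  show "inner (a *\<^sub>R f) g = a * inner f g"
    unfolding inner_l2_def scaleR_l2.rep_eq inner_scaleR_left
    by (intro infsum_cmult_right l2_inner_summable)
  show "0 \<le> inner f f"
    unfolding inner_l2_self by (intro infsum_nonneg) simp
  show "(inner f f = 0) = (f = 0)"
  proof
    assume "inner f f = 0"
    then have "(norm (l2_nth f i))\<^sup>2 = 0" for i
      using nonneg_infsum_le_0D[OF _ l2_summable[of f], of i] by (simp add: inner_l2_self)
    then show "f = 0" by (transfer) auto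
  next
    assume "f = 0"
    then show "inner f f = 0" by (simp add: inner_l2_self zero_l2.rep_eq)
  qed
  show "norm f = sqrt (inner f f)" by (rule norm_l2_def)
qed

end

lemma norm_l2_sq: "(norm (f::('i, 'h::chilbert_space) l2))\<^sup>2 = (\<Sum>\<^sub>\<infinity>i. (norm (l2_nth f i))\<^sup>2)"
  by (simp add: inner_l2_self flip: dot_square_norm)

instance l2 :: (type, chilbert_space) complete_space
proof
  fix F :: "nat \<Rightarrow> ('a, 'b::chilbert_space) l2"
  assume "Cauchy F"
  have dist_sq: "(dist f g)\<^sup>2 = (\<Sum>\<^sub>\<infinity>i. (norm (l2_nth f i - l2_nth g i))\<^sup>2)"
    for f g :: "('a, 'b::chilbert_space) l2"
    by (simp add: dist_norm norm_l2_sq minus_l2.rep_eq)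
  have summ: "(\<lambda>i. (norm (l2_nth f i - l2_nth g i))\<^sup>2) summable_on UNIV"
    for f g :: "('a, 'b::chilbert_space) l2"
    using l2_summable[of "f - g"] by (simp add: minus_l2.rep_eq)
  have fin: "(\<Sum>i\<in>A. (norm (l2_nth f i - l2_nth g i))\<^sup>2) \<le> (dist f g)\<^sup>2"
    if "finite A" for A and f g :: "('a, 'b::chilbert_space) l2"
    unfolding dist_sq by (rule finite_sum_le_infsum[OF summ that]) auto
  have cau: "\<exists>N. \<forall>m\<ge>N. \<forall>n\<ge>N. dist (F m) (F n) < e" if "e > 0" for e
    using \<open>Cauchy F\<close> that unfolding Cauchy_def by blast
  have coord: "norm (l2_nth f i - l2_nth g i) \<le> dist f g" for f g :: "('a, 'b::chilbert_space) l2" and i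
    using fin[of "{i}" f g] by (simp add: power2_le_iff_abs_le)
  have "Cauchy (\<lambda>n. l2_nth (F n) i)" for i
    unfolding Cauchy_def by (metis cau coord dist_norm order_le_less_trans)
  then have "\<exists>x. (\<lambda>n. l2_nth (F n) i) \<longlonglongrightarrow> x" for i
    using Cauchy_convergent_iff convergent_def by blast
  then obtain g where g: "\<And>i. (\<lambda>n. l2_nth (F n) i) \<longlonglongrightarrow> g i" by metis
  have lim: "(\<Sum>i\<in>A. (norm (l2_nth (F m) i - g i))\<^sup>2) \<le> e\<^sup>2"
    if "finite A" and N: "\<forall>m\<ge>N. \<forall>n\<ge>N. dist (F m) (F n) < e" and "m \<ge> N" for A N m e
  proof (rule LIMSEQ_le_const2)
    show "(\<lambda>n. \<Sum>i\<in>A. (norm (l2_nth (F m) i - l2_nth (F n) i))\<^sup>2)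
        \<longlonglongrightarrow> (\<Sum>i\<in>A. (norm (l2_nth (F m) i - g i))\<^sup>2)"
      by (intro tendsto_sum tendsto_power tendsto_norm tendsto_diff tendsto_const g)
    show "\<exists>M. \<forall>n\<ge>M. (\<Sum>i\<in>A. (norm (l2_nth (F m) i - l2_nth (F n) i))\<^sup>2) \<le> e\<^sup>2"
    proof (intro exI allI impI)
      fix n assume "N \<le> n"
      then have "dist (F m) (F n) < e" using N \<open>m \<ge> N\<close> by blast
      then have "(dist (F m) (F n))\<^sup>2 \<le> e\<^sup>2" by (intro power_mono zero_le_dist) simp
      with fin[OF \<open>finite A\<close>, of "F m" "F n"]
      show "(\<Sum>i\<in>A. (norm (l2_nth (F m) i - l2_nth (F n) i))\<^sup>2) \<le> e\<^sup>2" by simp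
    qed
  qed
  have lim_summ: "(\<lambda>i. (norm (l2_nth (F m) i - g i))\<^sup>2) summable_on UNIV"
    if "\<forall>m\<ge>N. \<forall>n\<ge>N. dist (F m) (F n) < e" "m \<ge> N" for N m e
    by (rule nonneg_bdd_above_summable_on) (auto intro!: bdd_aboveI2 lim that)
  obtain N1 where N1: "\<forall>m\<ge>N1. \<forall>n\<ge>N1. dist (F m) (F n) < 1"
    using cau[of 1] by auto
  have "(\<lambda>i. (norm (g i))\<^sup>2) summable_on UNIV"
  proof -
    have "(\<lambda>i. (norm (l2_nth (F N1) i + - (l2_nth (F N1) i - g i)))\<^sup>2) summable_on UNIV"
      using lim_summ[OF N1 order_refl]
      by (intro square_summable_add l2_summable) (simp add: norm_minus_commute)
    then show ?thesis by simp
  qed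
  then obtain G :: "('a, 'b::chilbert_space) l2" where G: "\<And>i. l2_nth G i = g i"
    by (metis Abs_l2_inverse mem_Collect_eq)
  have "F \<longlonglongrightarrow> G"
    unfolding lim_sequentially
  proof (intro allI impI)
    fix e :: real assume "e > 0"
    then obtain N where N: "\<forall>m\<ge>N. \<forall>n\<ge>N. dist (F m) (F n) < e / 2"
      using cau[of "e / 2"] by auto
    have "dist (F m) G < e" if "m \<ge> N" for m
    proof -
      have "(dist (F m) G)\<^sup>2 \<le> (e / 2)\<^sup>2"
        unfolding dist_sq G
        by (rule infsum_le_finite_sums[OF lim_summ[OF N that]]) (rule lim[OF _ N that])
      then have "dist (F m) G \<le> e / 2"
        using \<open>e > 0\<close> by (simp add: power2_le_iff_abs_le)
      then show ?thesis using \<open>e > 0\<close> by simp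
    qed
    then show "\<exists>N. \<forall>n\<ge>N. dist (F n) G < e" by blast
  qed
  then show "convergent F" by (auto simp: convergent_def)
qed

instantiation l2 :: (type, chilbert_space) chilbert_space
begin

lift_definition scaleC_l2 :: "complex \<Rightarrow> ('a, 'b) l2 \<Rightarrow> ('a, 'b) l2"
  is "\<lambda>c f i. c *\<^sub>C f i" by (rule square_summable_scale)

definition cinner_l2 :: "('a, 'b) l2 \<Rightarrow> ('a, 'b) l2 \<Rightarrow> complex" where
  "cinner_l2 f g = (\<Sum>\<^sub>\<infinity>i. cinner (l2_nth f i) (l2_nth g i))"

instance
proof
  fix f g h :: "('a, 'b) l2" and a :: real and c d :: complex
  show "c *\<^sub>C (f + g) = c *\<^sub>C f + c *\<^sub>C g" by transfer (simp add: scaleC_add_right)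
  show "(c + d) *\<^sub>C f = c *\<^sub>C f + d *\<^sub>C f" by transfer (simp add: scaleC_add_left)
  show "c *\<^sub>C d *\<^sub>C f = (c * d) *\<^sub>C f" by transfer (simp add: scaleC_scaleC)
  show "a *\<^sub>R f = complex_of_real a *\<^sub>C f" by transfer (simp add: scaleR_scaleC)
  show "cinner (f + g) h = cinner f h + cinner g h"
    unfolding cinner_l2_def plus_l2.rep_eq cinner_add_left
    by (intro infsum_add l2_cinner_summable)
  show "cinner (c *\<^sub>C f) g = c * cinner f g"
    unfolding cinner_l2_def scaleC_l2.rep_eq cinner_scaleC_left
    by (intro infsum_cmult_right l2_cinner_summable)
  show "cinner f g = cnj (cinner g f)"
    unfolding cinner_l2_def infsum_cnj[symmetric]
    by (subst cinner_commute) (rule refl)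
  show "inner f g = Re (cinner f g)"
    unfolding cinner_l2_def inner_l2_def inner_cinner
    by (rule infsum_Re[OF l2_cinner_summable])
qed

end


section \<open>Bounded operators\<close>

text \<open>\<^typ>\<open>'a \<Rightarrow>\<^sub>L 'b\<close> consists of the real-linear bounded maps, with the operator norm; the
  elements of \<open>B(H)\<close> are those satisfying \<open>clinear_op\<close>.\<close>

definition clinear_op :: "('a::chilbert_space \<Rightarrow>\<^sub>L 'b::chilbert_space) \<Rightarrow> bool" where
  "clinear_op A \<longleftrightarrow> (\<forall>c x. A (c *\<^sub>C x) = c *\<^sub>C A x)"

lift_definition scalar_op :: "complex \<Rightarrow> 'a::chilbert_space \<Rightarrow>\<^sub>L 'a" is scaleC
proof
  fix c :: complex and x y :: 'a and r :: real
  show "c *\<^sub>C (x + y) = c *\<^sub>C x + c *\<^sub>C y" by (rule scaleC_add_right)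
  show "c *\<^sub>C r *\<^sub>R x = r *\<^sub>R c *\<^sub>C x"
    by (simp add: scaleR_scaleC scaleC_scaleC mult.commute)
  show "\<exists>K. \<forall>x::'a. norm (c *\<^sub>C x) \<le> norm x * K"
    by (rule exI[of _ "cmod c"]) (simp add: norm_scaleC mult.commute)
qed

definition adj :: "('a::chilbert_space \<Rightarrow>\<^sub>L 'b::chilbert_space) \<Rightarrow> 'b \<Rightarrow>\<^sub>L 'a" where
  "adj A = (THE S :: 'b \<Rightarrow>\<^sub>L 'a. \<forall>x y. cinner (A x) y = cinner x (S y))"

definition pos_op :: "('a::chilbert_space \<Rightarrow>\<^sub>L 'a) \<Rightarrow> bool" where
  "pos_op A \<longleftrightarrow> clinear_op A \<and> (\<forall>x. cinner (A x) x \<in> \<real>\<^sub>\<ge>\<^sub>0)"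

definition sqrt_op :: "('a::chilbert_space \<Rightarrow>\<^sub>L 'a) \<Rightarrow> 'a \<Rightarrow>\<^sub>L 'a" where
  "sqrt_op A = (THE B. pos_op B \<and> B o\<^sub>L B = A)"

definition inv_op :: "('a::chilbert_space \<Rightarrow>\<^sub>L 'a) \<Rightarrow> 'a \<Rightarrow>\<^sub>L 'a" where
  "inv_op A = (THE B. A o\<^sub>L B = id_blinfun \<and> B o\<^sub>L A = id_blinfun)"

definition isometry_op :: "('a::chilbert_space \<Rightarrow>\<^sub>L 'b::chilbert_space) \<Rightarrow> bool" where
  "isometry_op V \<longleftrightarrow> clinear_op V \<and> (\<forall>x. norm (V x) = norm x)"

text \<open>The free semigroup on the generators \<open>'n\<close> is \<^typ>\<open>'n list\<close>, its identity is \<^term>\<open>[]\<close>.\<close>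

definition word_op :: "('n \<Rightarrow> 'a::chilbert_space \<Rightarrow>\<^sub>L 'a) \<Rightarrow> 'n list \<Rightarrow> 'a \<Rightarrow>\<^sub>L 'a" where
  "word_op T \<alpha> = foldr (\<lambda>i B. T i o\<^sub>L B) \<alpha> id_blinfun"


section \<open>The class of tuples with a \<rho>-dilation\<close>

text \<open>Membership in the class is witnessed by a Hilbert space \<open>G\<close> containing \<open>H\<close>. HOL does not
  quantify existentially over types, so the type \<open>'g\<close> of \<open>G\<close> is a parameter; where membership is
  a premise and \<open>'g\<close> is a type variable, this amounts to an arbitrary witness. The inclusion of
  \<open>H\<close> in \<open>G\<close> is the isometry \<open>J\<close>, so \<open>adj J o\<^sub>L S o\<^sub>L J\<close> is the compression of \<open>S\<close> to \<open>H\<close>.\<close>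

definition class_C ::
  "'g::chilbert_space itself \<Rightarrow> real \<Rightarrow> ('n::finite \<Rightarrow> 'h::chilbert_space \<Rightarrow>\<^sub>L 'h) \<Rightarrow> bool" where
  "class_C _ \<rho> T \<longleftrightarrow>
     (\<forall>i. clinear_op (T i)) \<and>
     (\<exists>(J :: 'h \<Rightarrow>\<^sub>L 'g) (V :: 'n \<Rightarrow> 'g \<Rightarrow>\<^sub>L 'g).
        isometry_op J \<and>
        (\<forall>i. isometry_op (V i)) \<and>
        (\<forall>i j. i \<noteq> j \<longrightarrow> (\<forall>x y. cinner (V i x) (V j y) = 0)) \<and>
        (\<forall>\<alpha>. \<alpha> \<noteq> [] \<longrightarrow> word_op T \<alpha> = \<rho> *\<^sub>R (adj J o\<^sub>L word_op V \<alpha> o\<^sub>L J)))"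


section \<open>Harnack domination and the hyperbolic metric\<close>

text \<open>An operator on \<open>H \<otimes> \<complex>\<^sup>m\<close> is an \<open>m \<times> m\<close> matrix of operators on \<open>H\<close>, acting on
  the columns \<open>v 0, \<dots>, v (m - 1)\<close>.\<close>

definition block_adj :: "('a::chilbert_space \<Rightarrow>\<^sub>L 'a) mat \<Rightarrow> ('a \<Rightarrow>\<^sub>L 'a) mat" where
  "block_adj P = Matrix.mat (dim_col P) (dim_row P) (\<lambda>(i, j). adj (P $$ (j, i)))"

definition block_scale :: "real \<Rightarrow> ('a::chilbert_space \<Rightarrow>\<^sub>L 'a) mat \<Rightarrow> ('a \<Rightarrow>\<^sub>L 'a) mat" where
  "block_scale r P = map_mat (scaleR r) P"

definition block_pos :: "('a::chilbert_space \<Rightarrow>\<^sub>L 'a) mat \<Rightarrow> bool" where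
  "block_pos P \<longleftrightarrow>
     (\<forall>v. (\<Sum>i<dim_row P. \<Sum>j<dim_col P. cinner ((P $$ (i, j)) (v j)) (v i)) \<in> \<real>\<^sub>\<ge>\<^sub>0)"

definition block_le ::
  "('a::chilbert_space \<Rightarrow>\<^sub>L 'a) mat \<Rightarrow> ('a \<Rightarrow>\<^sub>L 'a) mat \<Rightarrow> bool" where
  "block_le P Q \<longleftrightarrow> block_pos (Q - P)"

definition block_Re :: "('a::chilbert_space \<Rightarrow>\<^sub>L 'a) mat \<Rightarrow> ('a \<Rightarrow>\<^sub>L 'a) mat" where
  "block_Re P = block_scale (1 / 2) (block_adj P + P)"

text \<open>A noncommutative polynomial with coefficients in \<open>M\<^sub>m\<close> is its family of coefficients.\<close>

definition nc_poly :: "nat \<Rightarrow> ('n list \<Rightarrow> complex mat) \<Rightarrow> bool" where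
  "nc_poly m p \<longleftrightarrow> (\<forall>\<alpha>. p \<alpha> \<in> carrier_mat m m) \<and> finite {\<alpha>. p \<alpha> \<noteq> 0\<^sub>m m m}"

definition nc_eval ::
  "nat \<Rightarrow> ('n list \<Rightarrow> complex mat) \<Rightarrow> ('n \<Rightarrow> 'a::chilbert_space \<Rightarrow>\<^sub>L 'a) \<Rightarrow> ('a \<Rightarrow>\<^sub>L 'a) mat" where
  "nc_eval m p A =
     Matrix.mat m m (\<lambda>(i, j). \<Sum>\<alpha> | p \<alpha> \<noteq> 0\<^sub>m m m. scalar_op (p \<alpha> $$ (i, j)) o\<^sub>L word_op A \<alpha>)"

definition Re_nonneg_on_ball ::
  "'k::chilbert_space itself \<Rightarrow> nat \<Rightarrow> ('n::finite list \<Rightarrow> complex mat) \<Rightarrow> bool" where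
  "Re_nonneg_on_ball _ m p \<longleftrightarrow>
     (\<forall>X :: 'n \<Rightarrow> 'k \<Rightarrow>\<^sub>L 'k.
        (\<forall>i. clinear_op (X i)) \<and> norm (\<Sum>i\<in>UNIV. X i o\<^sub>L adj (X i)) < 1 \<longrightarrow>
        block_pos (block_Re (nc_eval m p X)))"

definition harnack_dom ::
  "'k::chilbert_space itself \<Rightarrow> real \<Rightarrow> real \<Rightarrow>
   ('n::finite \<Rightarrow> 'h::chilbert_space \<Rightarrow>\<^sub>L 'h) \<Rightarrow> ('n \<Rightarrow> 'h \<Rightarrow>\<^sub>L 'h) \<Rightarrow> bool" where
  "harnack_dom k \<rho> c A B \<longleftrightarrow>
     (\<forall>m p. nc_poly m p \<and> Re_nonneg_on_ball k m p \<longrightarrow>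
        block_le
          (block_Re (nc_eval m p A) +
             block_scale (\<rho> - 1) (block_Re (nc_eval m p (\<lambda>_. 0))))
          (block_scale (c\<^sup>2)
            (block_Re (nc_eval m p B) +
               block_scale (\<rho> - 1) (block_Re (nc_eval m p (\<lambda>_. 0))))))"

definition harnack_equiv_const ::
  "'k::chilbert_space itself \<Rightarrow> real \<Rightarrow> real \<Rightarrow>
   ('n::finite \<Rightarrow> 'h::chilbert_space \<Rightarrow>\<^sub>L 'h) \<Rightarrow> ('n \<Rightarrow> 'h \<Rightarrow>\<^sub>L 'h) \<Rightarrow> bool" where
  "harnack_equiv_const k \<rho> c A B \<longleftrightarrow> harnack_dom k \<rho> c A B \<and> harnack_dom k \<rho> c B A"

definition harnack_equiv ::
  "'k::chilbert_space itself \<Rightarrow> real \<Rightarrow>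
   ('n::finite \<Rightarrow> 'h::chilbert_space \<Rightarrow>\<^sub>L 'h) \<Rightarrow> ('n \<Rightarrow> 'h \<Rightarrow>\<^sub>L 'h) \<Rightarrow> bool" where
  "harnack_equiv k \<rho> A B \<longleftrightarrow> (\<exists>c\<ge>1. harnack_equiv_const k \<rho> c A B)"

definition hyperbolic_dist ::
  "'k::chilbert_space itself \<Rightarrow> real \<Rightarrow>
   ('n::finite \<Rightarrow> 'h::chilbert_space \<Rightarrow>\<^sub>L 'h) \<Rightarrow> ('n \<Rightarrow> 'h \<Rightarrow>\<^sub>L 'h) \<Rightarrow> real" where
  "hyperbolic_dist k \<rho> A B = ln (Inf {c. c > 1 \<and> harnack_equiv_const k \<rho> c A B})"


section \<open>The reconstruction operator\<close>

lift_definition tensor_vec ::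
  "'h::chilbert_space \<Rightarrow> ('i, complex) l2 \<Rightarrow> ('i, 'h) l2" is "\<lambda>h \<phi> i. \<phi> i *\<^sub>C h"
  by (simp add: norm_scaleC power_mult_distrib summable_on_cmult_left)

text \<open>The vectors \<^term>\<open>tensor_vec h \<phi>\<close> have dense span, so at most one bounded operator qualifies;
  for complex-linear \<open>A\<close> and \<open>S\<close> there is one.\<close>

definition tensor_op ::
  "('h::chilbert_space \<Rightarrow>\<^sub>L 'h) \<Rightarrow> (('i, complex) l2 \<Rightarrow>\<^sub>L ('i, complex) l2) \<Rightarrow>
   ('i, 'h) l2 \<Rightarrow>\<^sub>L ('i, 'h) l2" where
  "tensor_op A S =
     (THE B :: ('i, 'h) l2 \<Rightarrow>\<^sub>L ('i, 'h) l2. \<forall>h \<phi>. B (tensor_vec h \<phi>) = tensor_vec (A h) (S \<phi>))"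

text \<open>The full Fock space over an \<open>n\<close>-dimensional Hilbert space, in the coordinates of its
  orthonormal basis \<open>e\<^sub>\<alpha> = e\<^bsub>i1\<^esub> \<otimes> \<dots> \<otimes> e\<^bsub>ik\<^esub>\<close> for \<open>\<alpha> = [i1, \<dots>, ik]\<close>, where \<open>e\<^bsub>[]\<^esub>\<close> is the
  vacuum vector.\<close>

type_synonym 'n fock = "('n list, complex) l2"

lemma has_sum_append_iff:
  fixes g :: "'n list \<Rightarrow> real"
  shows "((\<lambda>\<alpha>. if \<alpha> \<noteq> [] \<and> last \<alpha> = i then g (butlast \<alpha>) else 0) has_sum s) UNIV
    \<longleftrightarrow> (g has_sum s) UNIV"
proof -
  let ?f = "\<lambda>\<alpha>. if \<alpha> \<noteq> [] \<and> last \<alpha> = i then g (butlast \<alpha>) else 0"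
  have "\<alpha> \<in> range (\<lambda>\<beta>. \<beta> @ [i])" if "\<alpha> \<noteq> []" "last \<alpha> = i" for \<alpha>
    using append_butlast_last_id[OF that(1)] that(2) by (metis rangeI)
  then have "(?f has_sum s) UNIV \<longleftrightarrow> (?f has_sum s) (range (\<lambda>\<beta>. \<beta> @ [i]))"
    by (intro has_sum_cong_neutral) auto
  also have "\<dots> \<longleftrightarrow> (g has_sum s) UNIV"
    by (subst has_sum_reindex) (auto simp: inj_def o_def)
  finally show ?thesis .
qed

text \<open>Tensoring with \<open>e\<^sub>i\<close> on the right maps \<open>e\<^sub>\<beta>\<close> to \<open>e\<^bsub>\<beta> @ [i]\<^esub>\<close>.\<close>

lift_definition append_basis :: "'n \<Rightarrow> 'n fock \<Rightarrow> 'n fock"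
  is "\<lambda>i \<phi> \<alpha>. if \<alpha> \<noteq> [] \<and> last \<alpha> = i then \<phi> (butlast \<alpha>) else 0"
proof -
  fix i :: 'n and \<phi> :: "'n list \<Rightarrow> complex"
  assume "(\<lambda>\<alpha>. (cmod (\<phi> \<alpha>))\<^sup>2) summable_on UNIV"
  then show "(\<lambda>\<alpha>. (cmod (if \<alpha> \<noteq> [] \<and> last \<alpha> = i then \<phi> (butlast \<alpha>) else 0))\<^sup>2) summable_on UNIV"
    using has_sum_append_iff[of i "\<lambda>\<alpha>. (cmod (\<phi> \<alpha>))\<^sup>2"]
    by (simp add: summable_on_def if_distrib[of cmod] if_distrib[of "\<lambda>x. x\<^sup>2"] cong: if_cong)
qed

lemma norm_append_basis: "norm (append_basis i \<phi>) = norm \<phi>"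
proof -
  have "((\<lambda>\<alpha>. (cmod (l2_nth (append_basis i \<phi>) \<alpha>))\<^sup>2) has_sum (norm \<phi>)\<^sup>2) UNIV"
    using has_sum_append_iff[of i "\<lambda>\<alpha>. (cmod (l2_nth \<phi> \<alpha>))\<^sup>2"]
      has_sum_infsum[OF l2_summable[of \<phi>]]
    by (simp add: append_basis.rep_eq norm_l2_sq if_distrib[of cmod] if_distrib[of "\<lambda>x. x\<^sup>2"]
        cong: if_cong)
  then have "(norm (append_basis i \<phi>))\<^sup>2 = (norm \<phi>)\<^sup>2"
    unfolding norm_l2_sq[of "append_basis i \<phi>"] by (rule infsumI)
  then show ?thesis by (simp add: power2_eq_iff_nonneg)
qed

lift_definition right_creation :: "'n \<Rightarrow> 'n fock \<Rightarrow>\<^sub>L 'n fock" is append_basis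
proof
  fix i :: 'n and \<phi> \<psi> :: "'n fock" and r :: real
  show "append_basis i (\<phi> + \<psi>) = append_basis i \<phi> + append_basis i \<psi>"
    by transfer auto
  show "append_basis i (r *\<^sub>R \<phi>) = r *\<^sub>R append_basis i \<phi>"
    by transfer auto
  show "\<exists>K. \<forall>\<phi>. norm (append_basis i \<phi>) \<le> norm \<phi> * K"
    by (rule exI[of _ 1]) (simp add: norm_append_basis)
qed

definition recon_op ::
  "('n::finite \<Rightarrow> 'h::chilbert_space \<Rightarrow>\<^sub>L 'h) \<Rightarrow> ('n list, 'h) l2 \<Rightarrow>\<^sub>L ('n list, 'h) l2" where
  "recon_op Z = (\<Sum>i\<in>UNIV. tensor_op (adj (Z i)) (right_creation i))"

definition Delta_op ::
  "real \<Rightarrow> ('n::finite \<Rightarrow> 'h::chilbert_space \<Rightarrow>\<^sub>L 'h) \<Rightarrow>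
   ('n list, 'h) l2 \<Rightarrow>\<^sub>L ('n list, 'h) l2" where
  "Delta_op \<rho> Z =
     sqrt_op (\<rho> *\<^sub>R id_blinfun + (1 - \<rho>) *\<^sub>R (adj (recon_op Z) + recon_op Z)
       + (\<rho> - 2) *\<^sub>R (adj (recon_op Z) o\<^sub>L recon_op Z))"

definition C_op ::
  "real \<Rightarrow> ('n::finite \<Rightarrow> 'h::chilbert_space \<Rightarrow>\<^sub>L 'h) \<Rightarrow>
   ('n list, 'h) l2 \<Rightarrow>\<^sub>L ('n list, 'h) l2" where
  "C_op \<rho> Z = Delta_op \<rho> Z o\<^sub>L inv_op (id_blinfun - recon_op Z)"

end

theory Submission
  imports Defs
begin

text \<open>
  Writing \<open>w = (I - R\<^sub>Z) u\<close> gives \<open>C\<^sup>* C = K\<^sub>Z\<close> with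
  \<open>K\<^sub>Z = (I - R\<^sub>Z)\<^sup>-\<^sup>1 + (I - R\<^sub>Z\<^sup>*)\<^sup>-\<^sup>1 + (\<rho> - 2) I\<close>, a multi-Toeplitz operator whose entries are
  \<open>\<rho> I\<close>, \<open>Z\<^sub>\<gamma>\<close> and \<open>Z\<^sub>\<gamma>\<^sup>*\<close>. For \<open>Z = r X\<close> with \<open>X\<close> of class \<open>C\<^sub>\<rho>\<close> it is a multiple of a compression of
  the kernel of a row of isometries, hence strictly positive. So \<open>\<parallel>C\<^sub>X C\<^sub>Y\<^sup>-\<^sup>1\<parallel> \<le> c\<close> means
  \<open>K\<^sub>X \<le> c\<^sup>2 K\<^sub>Y\<close>, and it suffices to show that Harnack domination with constant \<open>c\<close> is the inequality
  \<open>K\<^bsub>rX\<^esub> \<le> c\<^sup>2 K\<^bsub>rY\<^esub>\<close> for all \<open>r < 1\<close>. One direction tests domination on polynomials whose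
  real part is a finite truncation of the kernel. For the other, a strictly positive multi-Toeplitz
  operator \<open>D\<close> yields the row isometry \<open>V\<^sub>i = D\<^sup>1\<^sup>/\<^sup>2 L\<^sub>i D\<^sup>-\<^sup>1\<^sup>/\<^sup>2\<close>, \<open>L\<^sub>i\<close> being the left creation
  operators, and \<open>Re p(V) \<ge> 0\<close> follows from compressing \<open>s V\<close>, \<open>s < 1\<close>, to a finite-dimensional
  subspace embedded in the given infinite-dimensional space.
\<close>

section \<open>Bounded operators\<close>

text \<open>All estimates are made at r < 1: at r = 1 the operator I - R_X need not be invertible,
  and for \<rho> > 1 even R_{rX} may have norm above 1, so its resolvent is taken from that of the
  dilating row isometry and not from a Neumann series. The inequality K_{rX} \<le> c^2 K_{rY} makes
  the difference of its two sides only positive semidefinite. Replacing c^2 by c^2 + \<epsilon>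
  gives a D that is bounded below, so that D^{1/2} is invertible and no quotient or completion
  enters. The V_i arise as follows: in the inner product <D u, w> the left creation operators are
  isometries with orthogonal ranges, and D^{1/2} carries this inner product back to the given one.
  The entry of D between e_\<gamma> and the vacuum becomes a matrix coefficient of V_\<gamma>, so Re
  p(V) evaluates to the gap between the two sides of the domination inequality. The detour through
  finite dimensions is forced by the hypothesis on p, which concerns the open ball over one given
  space, while V acts elsewhere and lies on the boundary.\<close>

lemma cinner_zero_left [simp]: "cinner 0 (y::'a::chilbert_space) = 0"
  using cinner_add_left[of 0 0 y] by simp

lemma cinner_zero_right [simp]: "cinner (x::'a::chilbert_space) 0 = 0"
  using cinner_add_right[of x 0 0] by simp

lemma cinner_scaleR_left: "cinner (r *\<^sub>R x) (y::'a::chilbert_space) = of_real r * cinner x y"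
  by (simp add: scaleR_scaleC cinner_scaleC_left)

lemma cinner_scaleR_right: "cinner (x::'a::chilbert_space) (r *\<^sub>R y) = of_real r * cinner x y"
  by (simp add: scaleR_scaleC cinner_scaleC_right)

lemma cinner_diff_left: "cinner (x - y) (z::'a::chilbert_space) = cinner x z - cinner y z"
  using cinner_add_left[of "x - y" y z] by simp

lemma cinner_diff_right: "cinner (z::'a::chilbert_space) (x - y) = cinner z x - cinner z y"
  using cinner_add_right[of z "x - y" y] by simp

lemma cinner_sum_left: "cinner (sum f A) (z::'a::chilbert_space) = (\<Sum>a\<in>A. cinner (f a) z)"
  by (induction A rule: infinite_finite_induct) (simp_all add: cinner_add_left)

lemma cinner_sum_right: "cinner (z::'a::chilbert_space) (sum f A) = (\<Sum>a\<in>A. cinner z (f a))"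
  by (induction A rule: infinite_finite_induct) (simp_all add: cinner_add_right)

lemma scaleC_zero_right [simp]: "c *\<^sub>C (0::'a::chilbert_space) = 0"
  using scaleC_add_right[of c 0 0] by simp

lemma scaleC_zero_left [simp]: "0 *\<^sub>C (x::'a::chilbert_space) = 0"
  using scaleC_add_left[of 0 0 x] by simp

lemma scaleC_diff_right: "c *\<^sub>C (x - y) = c *\<^sub>C x - c *\<^sub>C (y::'a::chilbert_space)"
  using scaleC_add_right[of c "x - y" y] by simp

lemma scaleC_sum_right: "c *\<^sub>C sum f A = (\<Sum>a\<in>A. c *\<^sub>C (f a::'a::chilbert_space))"
  by (induction A rule: infinite_finite_induct) (simp_all add: scaleC_add_right)

lemma scaleC_scaleR: "c *\<^sub>C (r *\<^sub>R x) = r *\<^sub>R (c *\<^sub>C (x::'a::chilbert_space))"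
  by (simp add: scaleR_scaleC scaleC_scaleC mult.commute)

lemma cinner_conv_inner:
  "cinner x y = Complex (inner x y) (inner x (\<i> *\<^sub>C (y::'a::chilbert_space)))"
  by (simp add: complex_eq_iff inner_cinner cinner_scaleC_right)

lemma bounded_linear_cinner_left: "bounded_linear (\<lambda>x. cinner x (y::'a::chilbert_space))"
proof
  show "\<exists>K. \<forall>x. norm (cinner x y) \<le> norm x * K"
    using cmod_cinner_le by blast
qed (simp_all add: cinner_add_left cinner_scaleR_left scaleR_conv_of_real)

lemma bounded_linear_cinner_right: "bounded_linear (\<lambda>y. cinner (x::'a::chilbert_space) y)"
proof
  show "\<exists>K. \<forall>y. norm (cinner x y) \<le> norm y * K"
    by (rule exI[of _ "norm x"]) (metis cmod_cinner_le mult.commute)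
qed (simp_all add: cinner_add_right cinner_scaleR_right scaleR_conv_of_real)

lemma cinner_left_eqI:
  assumes "\<And>x. cinner x y = cinner x (z::'a::chilbert_space)"
  shows "y = z"
proof -
  have "cinner (y - z) (y - z) = 0"
    using assms[of "y - z"] by (simp add: cinner_diff_right)
  then show ?thesis by (simp add: cinner_self)
qed

text \<open>Minimise |x|^2 - 2 f x, which is bounded below. The parallelogram law makes a minimising
  sequence Cauchy, and at its limit the first variation vanishes, which is the desired
  identity.\<close>

lemma riesz_representation:
  fixes f :: "'a::{real_inner, complete_space} \<Rightarrow> real"
  assumes "bounded_linear f"
  obtains y where "\<And>x. f x = inner x y"
proof -
  interpret f: bounded_linear f by fact
  obtain K where K: "\<And>x. \<bar>f x\<bar> \<le> norm x * K" using f.bounded by auto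
  define g where "g x = (norm x)\<^sup>2 - 2 * f x" for x
  have lower: "- K\<^sup>2 \<le> g x" for x
  proof -
    have "0 \<le> (norm x - K)\<^sup>2" by simp
    then show ?thesis using K[of x] by (auto simp: g_def power2_eq_square algebra_simps)
  qed
  define m where "m = Inf (range g)"
  have bdd: "bdd_below (range g)" using lower by (auto intro!: bdd_belowI2)
  have m: "m \<le> g x" for x unfolding m_def by (rule cInf_lower[OF rangeI bdd])
  have "\<exists>x. g x < m + 1 / real (Suc n)" for n
    using cInf_lessD[of "range g" "m + 1 / real (Suc n)"] unfolding m_def by auto
  then obtain X where X: "\<And>n. g (X n) < m + 1 / real (Suc n)" by metis
  have par: "(norm (x - y))\<^sup>2 \<le> 2 * (g x - m) + 2 * (g y - m)" for x y
  proof -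
    have "4 * g ((1 / 2) *\<^sub>R (x + y)) = (norm (x + y))\<^sup>2 - 4 * f x - 4 * f y"
    proof -
      have a: "f ((1 / 2) *\<^sub>R (x + y)) = (1 / 2) * (f x + f y)"
        by (simp only: f.add f.scaleR real_scaleR_def)
      have b: "(norm ((1 / 2) *\<^sub>R (x + y)))\<^sup>2 = (1 / 4) * (norm (x + y))\<^sup>2"
        by (simp only: norm_scaleR power_mult_distrib) (simp add: power2_eq_square)
      show ?thesis unfolding g_def a b by (simp add: algebra_simps)
    qed
    then have "(norm (x - y))\<^sup>2 = 2 * g x + 2 * g y - 4 * g ((1 / 2) *\<^sub>R (x + y))"
      by (simp add: g_def power2_norm_eq_inner inner_add inner_diff inner_commute[of y x])
    then show ?thesis using m[of "(1 / 2) *\<^sub>R (x + y)"] by simp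
  qed
  have "Cauchy X"
    unfolding Cauchy_def
  proof (intro allI impI)
    fix e :: real assume "e > 0"
    then obtain N where N: "4 / e\<^sup>2 < real N" using reals_Archimedean2 by blast
    have "dist (X i) (X j) < e" if "i \<ge> N" "j \<ge> N" for i j
    proof -
      have small: "g (X i) - m < e\<^sup>2 / 4" if "i \<ge> N" for i
      proof -
        have "4 / e\<^sup>2 < real (Suc i)" using N that by linarith
        then have "1 / real (Suc i) < e\<^sup>2 / 4" using \<open>e > 0\<close> by (simp add: field_simps)
        then show ?thesis using X[of i] by linarith
      qed
      have "(dist (X i) (X j))\<^sup>2 < e\<^sup>2"
        using par[of "X i" "X j"] small[OF that(1)] small[OF that(2)] by (simp add: dist_norm)
      then show ?thesis using \<open>e > 0\<close> by (simp add: power_less_imp_less_base)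
    qed
    then show "\<exists>N. \<forall>i\<ge>N. \<forall>j\<ge>N. dist (X i) (X j) < e" by blast
  qed
  then obtain y where y: "X \<longlonglongrightarrow> y" using Cauchy_convergent_iff convergent_def by blast
  have "(\<lambda>n. g (X n)) \<longlonglongrightarrow> g y"
    unfolding g_def by (intro tendsto_intros y f.tendsto)
  moreover have "(\<lambda>n. m + 1 / real (Suc n)) \<longlonglongrightarrow> m + 0"
    using LIMSEQ_inverse_real_of_nat by (intro tendsto_intros) (simp add: inverse_eq_divide)
  ultimately have "g y \<le> m" using X by (intro LIMSEQ_le[of _ "g y" _ m]) (auto intro: less_imp_le)
  have "f h = inner h y" for h
  proof (rule ccontr)
    assume ne: "f h \<noteq> inner h y"
    define d where "d = inner h y - f h"
    have "h \<noteq> 0" using ne f.zero by auto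
    \<comment> \<open>Minimiser of the quadratic in \<open>t\<close> computed next; a nonzero
      \<open>d\<close> would push \<open>g\<close> below its infimum.\<close>
    define t where "t = - d / (norm h)\<^sup>2"
    have nz: "(norm h)\<^sup>2 > 0" using \<open>h \<noteq> 0\<close> by simp
    have "g (y + t *\<^sub>R h) = g y + t\<^sup>2 * (norm h)\<^sup>2 + 2 * t * d"
      by (simp add: g_def d_def f.add f.scaleR power2_norm_eq_inner inner_add inner_commute[of y h])
        (simp add: power2_eq_square algebra_simps)
    also have "\<dots> = g y - d\<^sup>2 / (norm h)\<^sup>2"
      using nz by (simp add: t_def power2_eq_square field_simps)
    also have "\<dots> < g y" using nz ne by (simp add: d_def)
    finally show False using m[of "y + t *\<^sub>R h"] \<open>g y \<le> m\<close> by linarith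
  qed
  then show ?thesis using that by blast
qed

section \<open>Complex-linear operators and their adjoints\<close>

lemma clinear_opD: "clinear_op A \<Longrightarrow> A (c *\<^sub>C x) = c *\<^sub>C A x"
  by (simp add: clinear_op_def)

lemma clinear_op_zero [simp]: "clinear_op 0"
  by (simp add: clinear_op_def)

lemma clinear_op_id [simp]: "clinear_op id_blinfun"
  by (simp add: clinear_op_def)

lemma clinear_op_add: "clinear_op A \<Longrightarrow> clinear_op B \<Longrightarrow> clinear_op (A + B)"
  by (simp add: clinear_op_def blinfun.add_left scaleC_add_right)

lemma clinear_op_diff: "clinear_op A \<Longrightarrow> clinear_op B \<Longrightarrow> clinear_op (A - B)"
  by (simp add: clinear_op_def blinfun.diff_left scaleC_diff_right)

lemma clinear_op_scaleR: "clinear_op A \<Longrightarrow> clinear_op (r *\<^sub>R A)"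
  by (simp add: clinear_op_def blinfun.scaleR_left scaleC_scaleR)

lemma clinear_op_compose: "clinear_op A \<Longrightarrow> clinear_op B \<Longrightarrow> clinear_op (A o\<^sub>L B)"
  by (simp add: clinear_op_def)

lemma clinear_op_sum: "(\<And>i. i \<in> I \<Longrightarrow> clinear_op (A i)) \<Longrightarrow> clinear_op (\<Sum>i\<in>I. A i)"
  by (induction I rule: infinite_finite_induct) (auto intro: clinear_op_add)

lemma clinear_op_word_op: "(\<And>i. clinear_op (T i)) \<Longrightarrow> clinear_op (word_op T \<alpha>)"
  by (induction \<alpha>) (auto simp: word_op_def intro: clinear_op_compose)

text \<open>Discharges the definite description in \<open>adj\<close>. Riesz representation gives
  \<open>S\<close> for the real inner product; the imaginary part of \<open>cinner x y\<close> is
  the real inner product of \<open>x\<close> with \<open>\<i> *\<^sub>C y\<close>, so complex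
  linearity of \<open>A\<close> extends the identity to \<open>cinner\<close>.\<close>

lemma cinner_adj:
  fixes A :: "'a::chilbert_space \<Rightarrow>\<^sub>L 'b::chilbert_space"
  assumes "clinear_op A"
  shows "cinner (A x) y = cinner x (adj A y)"
proof -
  have "\<exists>s. \<forall>x. inner (A x) y = inner x s" for y
  proof -
    have "bounded_linear (\<lambda>x. inner (A x) y)" by (intro bounded_linear_intros)
    then show ?thesis using riesz_representation by metis
  qed
  then obtain S where S: "\<And>x y. inner (A x) y = inner x (S y)" by metis
  have c: "cinner (A x) y = cinner x (S y)" for x y
  proof -
    have "inner (A x) (\<i> *\<^sub>C y) = inner x (\<i> *\<^sub>C S y)"
    proof -
      have "inner (A x) (\<i> *\<^sub>C y) = - inner (\<i> *\<^sub>C A x) y"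
        by (simp add: inner_cinner cinner_scaleC_left cinner_scaleC_right)
      also have "\<dots> = - inner (\<i> *\<^sub>C x) (S y)"
        by (simp add: S flip: clinear_opD[OF assms])
      finally show ?thesis by (simp add: inner_cinner cinner_scaleC_left cinner_scaleC_right)
    qed
    then show ?thesis by (simp add: cinner_conv_inner S)
  qed
  have bl: "bounded_linear S"
  proof (rule bounded_linear_intro[of _ "norm A"])
    show "S (x + y) = S x + S y" for x y
      by (rule cinner_left_eqI) (simp add: c[symmetric] cinner_add_right)
    show "S (r *\<^sub>R x) = r *\<^sub>R S x" for r x
      by (rule cinner_left_eqI) (simp add: c[symmetric] cinner_scaleR_right)
    show "norm (S y) \<le> norm y * norm A" for y
    proof (cases "S y = 0")
      case False
      have "norm (S y) * norm (S y) = inner (A (S y)) y"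
        by (simp add: S flip: power2_norm_eq_inner power2_eq_square)
      also have "\<dots> \<le> norm (A (S y)) * norm y" by (rule norm_cauchy_schwarz)
      also have "\<dots> \<le> norm A * norm (S y) * norm y"
        by (intro mult_right_mono norm_blinfun) simp
      finally show ?thesis using False by (simp add: mult.commute mult.left_commute)
    qed simp
  qed
  have "\<forall>x y. cinner (A x) y = cinner x (adj A y)"
    unfolding adj_def
  proof (rule theI[of _ "Blinfun S"])
    show "\<forall>x y. cinner (A x) y = cinner x (Blinfun S y)"
      by (simp add: c bounded_linear_Blinfun_apply[OF bl])
    fix T assume "\<forall>x y. cinner (A x) y = cinner x (blinfun_apply T y)"
    then show "T = Blinfun S"
      by - (rule blinfun_eqI, rule cinner_left_eqI, simp add: c[symmetric] bounded_linear_Blinfun_apply[OF bl])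
  qed
  then show ?thesis by blast
qed

lemma cinner_adj': "clinear_op A \<Longrightarrow> cinner (adj A y) x = cinner y (A x)"
  by (metis cinner_adj cinner_commute)

lemma inner_adj: "clinear_op A \<Longrightarrow> inner (A x) y = inner x (adj A y)"
  by (simp add: inner_cinner cinner_adj)

lemma inner_adj': "clinear_op A \<Longrightarrow> inner (adj A y) x = inner y (A x)"
  by (simp add: inner_cinner cinner_adj')

lemma adj_eqI:
  fixes A :: "'a::chilbert_space \<Rightarrow>\<^sub>L 'b::chilbert_space" and S :: "'b \<Rightarrow>\<^sub>L 'a"
  assumes "\<And>x y. cinner (A x) y = cinner x (S y)" "clinear_op A"
  shows "adj A = S"
  by (rule blinfun_eqI, rule cinner_left_eqI) (simp add: cinner_adj[OF assms(2), symmetric] assms(1))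

lemma clinear_op_adj:
  assumes "clinear_op A"
  shows "clinear_op (adj A)"
  unfolding clinear_op_def
  by (intro allI, rule cinner_left_eqI)
    (simp add: cinner_adj[OF assms, symmetric] cinner_scaleC_right)

lemma adj_compose:
  assumes "clinear_op A" "clinear_op B"
  shows "adj (A o\<^sub>L B) = adj B o\<^sub>L adj A"
  by (intro adj_eqI clinear_op_compose assms) (simp add: cinner_adj assms)

lemma adj_scaleR:
  assumes "clinear_op A"
  shows "adj (r *\<^sub>R A) = r *\<^sub>R adj A"
  by (intro adj_eqI clinear_op_scaleR assms)
    (simp add: cinner_adj assms blinfun.scaleR_left cinner_scaleR_left cinner_scaleR_right)

lemma adj_id [simp]: "adj id_blinfun = id_blinfun"
  by (intro adj_eqI) simp_all

text \<open>Polarisation: preserving norms means preserving the real inner product.\<close>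

lemma adj_isometry_isometry:
  assumes "isometry_op V"
  shows "adj V (V x) = x"
proof -
  have lin: "clinear_op V" and nrm: "\<And>x. norm (V x) = norm x"
    using assms by (auto simp: isometry_op_def)
  have i: "inner (V x) (V y) = inner x y" for x y
  proof -
    have "(norm (V (x + y)))\<^sup>2 = (norm (x + y))\<^sup>2" by (simp only: nrm)
    then show ?thesis
      using nrm[of x] nrm[of y] by (simp add: blinfun.add_right dot_norm)
  qed
  have "inner y (adj V (V x)) = inner y x" for y
    by (simp add: inner_adj[OF lin, symmetric] i)
  then show ?thesis using vector_eq_ldot by blast
qed

text \<open>Neumann series. Powers are expanded on either side (\<open>PS\<close> and
  \<open>PS'\<close>) because the inverse has to be two-sided.\<close>

lemma neumann_inverse:
  fixes T :: "'a::banach \<Rightarrow>\<^sub>L 'a"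
  assumes "norm T < 1"
  obtains N where "(id_blinfun - T) o\<^sub>L N = id_blinfun" "N o\<^sub>L (id_blinfun - T) = id_blinfun"
proof -
  define P where "P k = ((o\<^sub>L) T ^^ k) id_blinfun" for k
  have P0: "P 0 = id_blinfun" and PS: "P (Suc k) = T o\<^sub>L P k" for k by (simp_all add: P_def)
  have PS': "P (Suc k) = P k o\<^sub>L T" for k
  proof (induction k)
    case 0
    show ?case by (rule blinfun_eqI) (simp add: P0 PS)
  next
    case (Suc k)
    have "P (Suc (Suc k)) = T o\<^sub>L (P k o\<^sub>L T)" by (simp only: PS[of "Suc k"] Suc)
    also have "\<dots> = P (Suc k) o\<^sub>L T" by (rule blinfun_eqI) (simp add: PS)
    finally show ?case .
  qed
  \<comment> \<open>The factor \<open>norm (P 0)\<close> is the norm of the identity, which is 0 on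
    the zero space and 1 otherwise.\<close>
  have bound: "norm (P k) \<le> norm T ^ k * norm (P 0)" for k
  proof (induction k)
    case (Suc k)
    have "norm (P (Suc k)) \<le> norm T * norm (P k)" unfolding PS by (rule norm_blinfun_compose)
    also have "\<dots> \<le> norm T * (norm T ^ k * norm (P 0))" by (intro mult_left_mono Suc) simp
    finally show ?case by (simp add: mult.assoc)
  qed simp
  have "summable (\<lambda>k. norm T ^ k * norm (P 0))"
    by (rule summable_mult2, rule summable_geometric) (use assms in simp)
  then have sP: "summable P" by (rule summable_comparison_test') (rule bound)
  have shift: "(\<Sum>k. P (Suc k)) = suminf P - id_blinfun"
    using suminf_split_head[OF sP] unfolding P0 .
  have "(T o\<^sub>L suminf P) = (\<Sum>k. T o\<^sub>L P k)"
    by (rule bounded_linear.suminf[OF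
          bounded_bilinear.bounded_linear_right[OF bounded_bilinear_blinfun_compose] sP])
  then have 1: "T o\<^sub>L suminf P = suminf P - id_blinfun" unfolding PS[symmetric] shift .
  have "suminf P o\<^sub>L T = (\<Sum>k. P k o\<^sub>L T)"
    by (rule bounded_linear.suminf[OF
          bounded_bilinear.bounded_linear_left[OF bounded_bilinear_blinfun_compose] sP])
  then have 2: "suminf P o\<^sub>L T = suminf P - id_blinfun" unfolding PS'[symmetric] shift .
  have "(id_blinfun - T) o\<^sub>L suminf P = suminf P - (T o\<^sub>L suminf P)"
    "suminf P o\<^sub>L (id_blinfun - T) = suminf P - (suminf P o\<^sub>L T)"
    by (rule blinfun_eqI, simp add: blinfun.diff_left blinfun.diff_right)+
  then show ?thesis unfolding 1 2 by (intro that[of "suminf P"]) simp_all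
qed

section \<open>Square roots of strictly positive operators\<close>

lemma blinfun_compose_simps:
  fixes A B C :: "'a::real_normed_vector \<Rightarrow>\<^sub>L 'a"
  shows "A o\<^sub>L (B + C) = (A o\<^sub>L B) + (A o\<^sub>L C)" "(B + C) o\<^sub>L A = (B o\<^sub>L A) + (C o\<^sub>L A)"
    "A o\<^sub>L (B - C) = (A o\<^sub>L B) - (A o\<^sub>L C)" "(B - C) o\<^sub>L A = (B o\<^sub>L A) - (C o\<^sub>L A)"
    "A o\<^sub>L (r *\<^sub>R B) = r *\<^sub>R (A o\<^sub>L B)" "(r *\<^sub>R B) o\<^sub>L A = r *\<^sub>R (B o\<^sub>L A)"
    "A o\<^sub>L (B o\<^sub>L C) = (A o\<^sub>L B) o\<^sub>L C" "A o\<^sub>L id_blinfun = A" "id_blinfun o\<^sub>L A = A"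
  by (rule blinfun_eqI; simp add: blinfun.bilinear_simps)+

text \<open>Polarisation at x + y and x + iy. Complex scalars are essential: a real rotation by a
  right angle has vanishing quadratic form.\<close>

lemma zero_opI:
  assumes "clinear_op D" "\<And>x. cinner (D x) x = 0"
  shows "D = 0"
proof (rule blinfun_eqI, rule cinner_left_eqI)
  fix x y
  have a: "cinner (D y) x + cinner (D x) y = 0"
    using assms(2)[of "x + y"] by (simp add: assms(2) blinfun.add_right cinner_add_left cinner_add_right)
  have b: "- \<i> * cinner (D x) y + \<i> * cinner (D y) x = 0"
    using assms(2)[of "x + \<i> *\<^sub>C y"]
    by (simp add: assms(2) blinfun.add_right cinner_add_left cinner_add_right clinear_opD[OF assms(1)]
        cinner_scaleC_left cinner_scaleC_right)
  have "\<i> * (cinner (D y) x - cinner (D x) y) = 0"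
    using b by (simp add: algebra_simps)
  then have "cinner (D y) x = cinner (D x) y" by simp
  with a have "cinner (D y) x = 0" by simp
  then have "cinner x (D y) = 0" by (subst cinner_commute) simp
  then show "cinner x (D y) = cinner x (blinfun_apply 0 y)" by simp
qed

text \<open>A real quadratic form equals its conjugate, so the form of \<open>adj A - A\<close>
  vanishes and \<open>zero_opI\<close> applies.\<close>

lemma pos_op_selfadjoint:
  assumes "pos_op A"
  shows "adj A = A"
proof -
  have lin: "clinear_op A" and re: "cinner (A x) x \<in> \<real>\<^sub>\<ge>\<^sub>0" for x
    using assms by (auto simp: pos_op_def)
  have "adj A - A = 0"
  proof (rule zero_opI)
    show "clinear_op (adj A - A)" by (intro clinear_op_diff clinear_op_adj lin)
    show "cinner ((adj A - A) x) x = 0" for x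
      using re[of x]
      by (subst blinfun.diff_left, subst cinner_diff_left, subst cinner_adj'[OF lin],
          subst cinner_commute) (auto simp: nonneg_Reals_def)
  qed
  then show ?thesis by simp
qed

lemma pos_opI:
  assumes "clinear_op A" "adj A = A" "\<And>x. 0 \<le> inner (A x) x"
  shows "pos_op A"
  unfolding pos_op_def
proof (intro conjI allI assms(1))
  fix x
  have "cinner (A x) x = cnj (cinner (A x) x)"
    using cinner_adj[OF assms(1), of x x] by (metis assms(2) cinner_commute)
  then have "Im (cinner (A x) x) = 0" by (metis complex_cnj_cancel_iff Im_complex_of_real Reals_cnj_iff complex_is_Real_iff)
  then show "cinner (A x) x \<in> \<real>\<^sub>\<ge>\<^sub>0"
    using assms(3)[of x] by (simp add: complex_nonneg_Reals_iff inner_cinner)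
qed

text \<open>Positivity at the single vector x - T x / q is enough: expanding it and bounding the
  cubic term by q |T x|^2 leaves |T x|^2 / q \<le> q |x|^2.\<close>

lemma norm_selfadjoint_le:
  assumes "clinear_op T" "adj T = T" "q > 0"
    and "\<And>x. 0 \<le> inner (T x) x" "\<And>x. inner (T x) x \<le> q * (norm x)\<^sup>2"
  shows "norm T \<le> q"
proof (rule norm_blinfun_bound)
  show "0 \<le> q" using assms(3) by simp
  fix x
  define b where "b = (norm (T x))\<^sup>2"
  have sa: "inner (T x) y = inner x (T y)" for x y using inner_adj[OF assms(1)] assms(2) by simp
  let ?y = "x - (1 / q) *\<^sub>R T x"
  have bb: "inner (T x) (T x) = b" by (simp add: b_def dot_square_norm)
  have "inner (T ?y) ?y = inner (T x) x - 2 / q * b + (1 / q)\<^sup>2 * inner (T (T x)) (T x)"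
    by (simp add: blinfun.diff_right blinfun.scaleR_right inner_diff_left inner_diff_right
        sa[of "T x" x] bb power2_eq_square diff_divide_distrib)
  also have "\<dots> \<le> q * (norm x)\<^sup>2 - 2 / q * b + (1 / q)\<^sup>2 * (q * b)"
    using assms(5)[of x] assms(5)[of "T x"] unfolding b_def
    by (intro add_mono diff_right_mono mult_left_mono) auto
  also have "\<dots> = q * (norm x)\<^sup>2 - b / q"
    using \<open>q > 0\<close> by (simp add: power2_eq_square field_simps)
  finally have "b / q \<le> q * (norm x)\<^sup>2" using assms(4)[of ?y] by linarith
  then have "b \<le> (q * norm x)\<^sup>2"
    using \<open>q > 0\<close> by (simp add: pos_divide_le_eq power_mult_distrib power2_eq_square mult_ac)
  then show "norm (T x) \<le> q * norm x"
    unfolding b_def using \<open>q > 0\<close> by (simp add: power2_le_iff_abs_le)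
qed

text \<open>For \<open>A = \<lambda>(I - T)\<close> with \<open>\<parallel>T\<parallel> < 1\<close> the root is \<open>\<surd>\<lambda> (I - Y)\<close>, where \<open>Y = (T + Y\<^sup>2) / 2\<close> is the
  fixed point of a contraction.\<close>

lemma strictly_positive_sqrt_exists:
  fixes A :: "'a::chilbert_space \<Rightarrow>\<^sub>L 'a"
  assumes lin: "clinear_op A" and sa: "adj A = A" and "\<delta> > 0"
    and lower: "\<And>x. \<delta> * (norm x)\<^sup>2 \<le> inner (A x) x"
  obtains B \<eta> N where "pos_op B" "B o\<^sub>L B = A"
    "\<And>E. E o\<^sub>L A = A o\<^sub>L E \<Longrightarrow> E o\<^sub>L B = B o\<^sub>L E"
    "\<eta> > 0" "\<And>x. \<eta> * (norm x)\<^sup>2 \<le> inner (B x) x" "B o\<^sub>L N = id_blinfun" "N o\<^sub>L B = id_blinfun"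
proof -
  \<comment> \<open>The summand 2 \<delta> keeps \<open>L\<close> positive even when
    \<open>A\<close> has norm 0, and gives \<delta> / L \<le> 1/2, so that \<open>q\<close> is
    positive.\<close>
  define L where "L = norm A + 2 * \<delta>"
  define q where "q = 1 - \<delta> / L"
  define T where "T = id_blinfun - (1 / L) *\<^sub>R A"
  have L: "L > 0" "norm A \<le> L" "2 * \<delta> \<le> L" using \<open>\<delta> > 0\<close> by (simp_all add: L_def add_nonneg_pos)
  have q: "0 < q" "q < 1" using L \<open>\<delta> > 0\<close> by (simp_all add: q_def field_simps)
  have linT: "clinear_op T" unfolding T_def by (intro clinear_op_diff clinear_op_scaleR lin clinear_op_id)
  have saA: "inner (A x) y = inner x (A y)" for x y using inner_adj[OF lin] sa by simp
  have saT: "inner (T x) y = inner x (T y)" for x y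
    by (simp add: T_def blinfun.bilinear_simps inner_diff saA)
  have adjT: "adj T = T"
    by (rule adj_eqI[OF _ linT])
      (simp add: T_def blinfun.bilinear_simps cinner_diff_left cinner_diff_right
        cinner_scaleR_left cinner_scaleR_right cinner_adj[OF lin] sa)
  have inT: "inner (T x) x = (norm x)\<^sup>2 - inner (A x) x / L" for x
    by (simp add: T_def blinfun.bilinear_simps inner_diff dot_square_norm)
  have "norm T \<le> q"
  proof (rule norm_selfadjoint_le[OF linT adjT q(1)])
    fix x
    have "inner (A x) x \<le> norm (A x) * norm x" by (rule norm_cauchy_schwarz)
    also have "\<dots> \<le> norm A * norm x * norm x" by (intro mult_right_mono norm_blinfun) simp
    also have "\<dots> \<le> L * norm x * norm x" by (intro mult_right_mono L) simp_all
    finally show "0 \<le> inner (T x) x" using L by (simp add: inT field_simps power2_eq_square)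
    show "inner (T x) x \<le> q * (norm x)\<^sup>2"
      using lower[of x] L by (simp add: inT q_def field_simps)
  qed
  \<comment> \<open>The smaller root of s = (q + s^2) / 2: the ball of radius \<open>s\<close> is
    mapped into itself by \<open>f\<close>, and there \<open>f\<close> has Lipschitz constant s <
    1.\<close>
  define s where "s = 1 - sqrt (1 - q)"
  have s: "0 \<le> s" "s < 1" using q by (simp_all add: s_def)
  have sq: "(q + s\<^sup>2) / 2 = s" using q by (simp add: s_def power2_diff)
  define f where "f Y = (1 / 2) *\<^sub>R (T + (Y o\<^sub>L Y))" for Y
  define Com where "Com = {E. E o\<^sub>L A = A o\<^sub>L E}"
  \<comment> \<open>Symmetry and commutation with the commutant of \<open>A\<close> are closed
    conditions preserved by \<open>f\<close>; building them into the domain of the contraction hands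
    them to the fixed point.\<close>
  define K where "K = {Y::'a \<Rightarrow>\<^sub>L 'a. norm Y \<le> s \<and> (\<forall>x y. cinner (blinfun_apply Y x) y = cinner x (blinfun_apply Y y))}
    \<inter> (\<Inter>E\<in>Com. {Y. E o\<^sub>L Y = Y o\<^sub>L E})"
  have "closed K"
    unfolding K_def
    by (intro closed_Int closed_INT ballI closed_Collect_conj closed_Collect_all closed_Collect_le
        closed_Collect_eq continuous_intros bounded_linear.continuous_on[OF bounded_linear_cinner_left]
        bounded_linear.continuous_on[OF bounded_linear_cinner_right])
  then have "complete K" by (simp add: complete_eq_closed)
  moreover have "0 \<in> K" by (auto simp: K_def s intro!: blinfun_eqI)
  moreover have "f Y \<in> K" if "Y \<in> K" for Y
  proof -
    have Y: "norm Y \<le> s" "\<And>x y. cinner (blinfun_apply Y x) y = cinner x (blinfun_apply Y y)"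
      "\<And>E. E o\<^sub>L A = A o\<^sub>L E \<Longrightarrow> E o\<^sub>L Y = Y o\<^sub>L E" using that by (auto simp: K_def Com_def)
    have "norm (f Y) \<le> (norm T + norm (Y o\<^sub>L Y)) / 2"
      unfolding f_def by (simp add: norm_triangle_ineq)
    also have "norm (Y o\<^sub>L Y) \<le> s * s"
      using norm_blinfun_compose[of Y Y] mult_mono[OF Y(1) Y(1) s(1) norm_ge_zero] by linarith
    also have "(norm T + s * s) / 2 \<le> (q + s\<^sup>2) / 2"
      using \<open>norm T \<le> q\<close> by (simp add: power2_eq_square)
    finally have "norm (f Y) \<le> s" unfolding sq by simp
    moreover have "cinner (f Y x) y = cinner x (f Y y)" for x y
      using cinner_adj[OF linT, of x y]
      by (simp add: f_def blinfun.bilinear_simps cinner_scaleR_left cinner_scaleR_right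
          cinner_add_left cinner_add_right Y(2) adjT)
    moreover have "E o\<^sub>L f Y = f Y o\<^sub>L E" if E: "E o\<^sub>L A = A o\<^sub>L E" for E
    proof -
      have "E o\<^sub>L (Y o\<^sub>L Y) = (Y o\<^sub>L Y) o\<^sub>L E"
        by (metis Y(3)[OF E] blinfun_compose_simps(7))
      then show ?thesis unfolding f_def T_def by (simp add: blinfun_compose_simps(1-6,8,9) E)
    qed
    ultimately show ?thesis by (auto simp: K_def Com_def)
  qed
  moreover have "dist (f Y) (f Z) \<le> s * dist Y Z" if "Y \<in> K" "Z \<in> K" for Y Z
  proof -
    have n: "norm Y \<le> s" "norm Z \<le> s" using that by (auto simp: K_def)
    have "f Y - f Z = (1 / 2) *\<^sub>R ((Y o\<^sub>L (Y - Z)) + ((Y - Z) o\<^sub>L Z))"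
      by (simp add: f_def blinfun_compose_simps(1-6,8,9) flip: scaleR_diff_right)
    then have "norm (f Y - f Z) \<le> (norm (Y o\<^sub>L (Y - Z)) + norm ((Y - Z) o\<^sub>L Z)) / 2"
      by (simp add: norm_triangle_ineq)
    also have "norm (Y o\<^sub>L (Y - Z)) \<le> s * norm (Y - Z)"
      by (rule order_trans[OF norm_blinfun_compose]) (intro mult_right_mono n norm_ge_zero)
    also have "norm ((Y - Z) o\<^sub>L Z) \<le> norm (Y - Z) * s"
      by (rule order_trans[OF norm_blinfun_compose]) (intro mult_left_mono n norm_ge_zero)
    finally show ?thesis by (simp add: dist_norm)
  qed
  ultimately obtain Y where YK: "Y \<in> K" and fp: "f Y = Y"
    using Banach_fix[of K s f] s by blast
  have Y: "norm Y \<le> s" "\<And>x y. cinner (Y x) y = cinner x (Y y)"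
    "\<And>E. E o\<^sub>L A = A o\<^sub>L E \<Longrightarrow> E o\<^sub>L Y = Y o\<^sub>L E" using YK by (auto simp: K_def Com_def)
  \<comment> \<open>Symmetry with respect to the complex inner product already forces complex
    linearity.\<close>
  have linY: "clinear_op Y"
    unfolding clinear_op_def
    by (intro allI, rule cinner_left_eqI) (simp add: Y(2)[symmetric] cinner_scaleC_right)
  define B where "B = sqrt L *\<^sub>R (id_blinfun - Y)"
  \<comment> \<open>The fixed-point equation in the form that gives (I - Y)^2 = I - T = A /
    L.\<close>
  have YY: "Y o\<^sub>L Y = 2 *\<^sub>R Y - T" using arg_cong[OF fp, of "scaleR 2"] by (simp add: f_def eq_diff_eq add.commute)
  obtain N where N: "(id_blinfun - Y) o\<^sub>L N = id_blinfun" "N o\<^sub>L (id_blinfun - Y) = id_blinfun"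
    using neumann_inverse[of Y] Y(1) s by (metis order.strict_trans1)
  have inB: "sqrt L * (1 - s) * (norm x)\<^sup>2 \<le> inner (B x) x" for x
  proof -
    have "inner (Y x) x \<le> norm (Y x) * norm x" by (rule norm_cauchy_schwarz)
    also have "\<dots> \<le> s * norm x * norm x"
      by (intro mult_right_mono order_trans[OF norm_blinfun] Y) simp_all
    finally have "(1 - s) * (norm x)\<^sup>2 \<le> inner ((id_blinfun - Y) x) x"
      by (simp add: blinfun.diff_left inner_diff dot_square_norm power2_eq_square algebra_simps)
    then show ?thesis using L
      by (simp add: B_def blinfun.scaleR_left mult.assoc)
  qed
  show ?thesis
  proof (rule that[of B "sqrt L * (1 - s)" "(1 / sqrt L) *\<^sub>R N"])
    show "pos_op B"
    proof (rule pos_opI)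
      show lB: "clinear_op B" unfolding B_def by (intro clinear_op_scaleR clinear_op_diff linY clinear_op_id)
      show "adj B = B"
        by (rule adj_eqI[OF _ lB]) (simp add: B_def blinfun.bilinear_simps cinner_scaleR_left
            cinner_scaleR_right cinner_diff_left cinner_diff_right Y(2))
      show "0 \<le> inner (B x) x" for x
        using L s by (intro order_trans[OF _ inB[of x]] mult_nonneg_nonneg) auto
    qed
    have "B o\<^sub>L B = (sqrt L * sqrt L) *\<^sub>R ((id_blinfun - Y) o\<^sub>L (id_blinfun - Y))"
      by (simp only: B_def blinfun_compose_simps(5,6) scaleR_scaleR)
    also have "\<dots> = L *\<^sub>R (id_blinfun - 2 *\<^sub>R Y + (Y o\<^sub>L Y))"
      using L by (simp add: blinfun_compose_simps(1-4,8,9) scaleR_2)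
    also have "\<dots> = A" using L by (simp add: YY T_def)
    finally show "B o\<^sub>L B = A" .
    show "E o\<^sub>L B = B o\<^sub>L E" if "E o\<^sub>L A = A o\<^sub>L E" for E
      by (simp add: B_def blinfun_compose_simps(1-6,8,9) Y(3)[OF that])
    show "sqrt L * (1 - s) > 0" using L s by simp
    show "B o\<^sub>L (1 / sqrt L) *\<^sub>R N = id_blinfun" "(1 / sqrt L) *\<^sub>R N o\<^sub>L B = id_blinfun"
      using L by (simp_all add: B_def blinfun_compose_simps(5,6) N)
  qed (rule inB)
qed

text \<open>Uniqueness, required by the definite description in \<open>sqrt_op\<close>, comes from
  the commutation clause: a positive \<open>C\<close> with C^2 = A commutes with A, hence with B, so
  (B + C)(B - C) = 0, and B + C is injective because B is bounded below.\<close>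

lemma sqrt_op_strictly_positive:
  fixes A :: "'a::chilbert_space \<Rightarrow>\<^sub>L 'a"
  assumes lin: "clinear_op A" and sa: "adj A = A" and "\<delta> > 0"
    and lower: "\<And>x. \<delta> * (norm x)\<^sup>2 \<le> inner (A x) x"
  shows "pos_op (sqrt_op A)" "sqrt_op A o\<^sub>L sqrt_op A = A"
    "\<exists>N. sqrt_op A o\<^sub>L N = id_blinfun \<and> N o\<^sub>L sqrt_op A = id_blinfun"
proof -
  obtain B \<eta> N where B: "pos_op B" "B o\<^sub>L B = A"
    "\<And>E. E o\<^sub>L A = A o\<^sub>L E \<Longrightarrow> E o\<^sub>L B = B o\<^sub>L E"
    "\<eta> > 0" "\<And>x. \<eta> * (norm x)\<^sup>2 \<le> inner (B x) x" "B o\<^sub>L N = id_blinfun" "N o\<^sub>L B = id_blinfun"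
    using strictly_positive_sqrt_exists[OF assms] by blast
  have "sqrt_op A = B"
    unfolding sqrt_op_def
  proof (rule the_equality)
    fix C assume C: "pos_op C \<and> C o\<^sub>L C = A"
    then have "C o\<^sub>L A = A o\<^sub>L C" by (metis blinfun_compose_simps(7))
    then have "C o\<^sub>L B = B o\<^sub>L C" by (rule B(3))
    then have eq: "(B + C) o\<^sub>L (B - C) = 0"
      using B(2) C by (simp add: blinfun_compose_simps(1-6))
    show "C = B"
    proof (rule blinfun_eqI)
      fix x
      define y where "y = B x - C x"
      have "inner ((B + C) y) y = 0"
        using arg_cong[OF eq, of "\<lambda>T. inner (blinfun_apply T x) y"] by (simp add: y_def blinfun.diff_left)
      moreover have "inner (C y) y \<ge> 0"
        using C by (simp add: pos_op_def complex_nonneg_Reals_iff inner_cinner)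
      ultimately have "\<eta> * (norm y)\<^sup>2 \<le> 0" using B(5)[of y] by (simp add: blinfun.add_left inner_add_left)
      then have "y = 0" using \<open>\<eta> > 0\<close> by (simp add: mult_le_0_iff)
      then show "C x = B x" by (simp add: y_def)
    qed
  qed (use B in blast)
  then show "pos_op (sqrt_op A)" "sqrt_op A o\<^sub>L sqrt_op A = A"
    "\<exists>N. sqrt_op A o\<^sub>L N = id_blinfun \<and> N o\<^sub>L sqrt_op A = id_blinfun"
    using B(1,2,6,7) by blast+
qed

section \<open>Inverses\<close>

lemma inv_op_eqI:
  fixes A :: "'a::chilbert_space \<Rightarrow>\<^sub>L 'a"
  assumes "A o\<^sub>L B = id_blinfun" "B o\<^sub>L A = id_blinfun"
  shows "inv_op A = B"
  unfolding inv_op_def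
proof (rule the_equality)
  fix C assume C: "A o\<^sub>L C = id_blinfun \<and> C o\<^sub>L A = id_blinfun"
  have "C = C o\<^sub>L (A o\<^sub>L B)" by (simp add: assms(1) blinfun_compose_simps(8))
  also have "\<dots> = B" using C by (simp add: blinfun_compose_simps(7,9))
  finally show "C = B" .
qed (use assms in blast)

lemma clinear_op_inverse:
  fixes A :: "'a::chilbert_space \<Rightarrow>\<^sub>L 'a"
  assumes "clinear_op A" "A o\<^sub>L B = id_blinfun" "B o\<^sub>L A = id_blinfun"
  shows "clinear_op B"
  unfolding clinear_op_def
proof (intro allI)
  fix c x
  have AB: "A (B x) = x" and BA: "B (A x) = x" for x
    using arg_cong[OF assms(2), of "\<lambda>T. blinfun_apply T x"]
      arg_cong[OF assms(3), of "\<lambda>T. blinfun_apply T x"] by simp_all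
  have "B (c *\<^sub>C x) = B (A (c *\<^sub>C B x))" by (simp add: clinear_opD[OF assms(1)] AB)
  then show "B (c *\<^sub>C x) = c *\<^sub>C B x" by (simp add: BA)
qed

section \<open>Operators on square-summable families\<close>

lemma l2_eqI: "(\<And>i. l2_nth f i = l2_nth g i) \<Longrightarrow> f = g"
  by (metis ext l2_nth_inject)

lemmas l2_nth_simps = plus_l2.rep_eq minus_l2.rep_eq uminus_l2.rep_eq zero_l2.rep_eq
  scaleR_l2.rep_eq scaleC_l2.rep_eq

lemma l2_nth_sum: "l2_nth (sum f A) i = (\<Sum>a\<in>A. l2_nth (f a) i)"
  by (induction A rule: infinite_finite_induct) (simp_all add: l2_nth_simps)

text \<open>For injective \<open>\<iota>\<close> this is the tensor product of A with the isometry
  sending the basis vector at i to the one at \<open>\<iota> i\<close>. Appending a letter gives the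
  summands of \<open>recon_op\<close>, prefixing a letter the left creation operators, and
  \<open>id\<close> the coordinatewise action of A.\<close>

definition l2_push ::
  "('i \<Rightarrow> 'j) \<Rightarrow> ('a::chilbert_space \<Rightarrow>\<^sub>L 'b::chilbert_space) \<Rightarrow> ('i, 'a) l2 \<Rightarrow>\<^sub>L ('j, 'b) l2" where
  "l2_push \<iota> A =
     Blinfun (\<lambda>v. Abs_l2 (\<lambda>j. if j \<in> range \<iota> then A (l2_nth v (inv_into UNIV \<iota> j)) else 0))"

text \<open>Coordinates off the range of \<open>\<iota>\<close> vanish, so square sums reindex along
  \<open>\<iota>\<close>. The norm is stated through \<open>has_sum\<close> so that the norms of
  several pushes can be added coordinate by coordinate.\<close>

lemma l2_push:
  fixes \<iota> :: "'i \<Rightarrow> 'j" and A :: "'a::chilbert_space \<Rightarrow>\<^sub>L 'b::chilbert_space"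
  assumes "inj \<iota>"
  shows l2_nth_l2_push: "l2_nth (l2_push \<iota> A v) j
      = (if j \<in> range \<iota> then A (l2_nth v (inv_into UNIV \<iota> j)) else 0)" (is ?nth)
    and norm_l2_push: "((\<lambda>i. (norm (A (l2_nth v i)))\<^sup>2) has_sum (norm (l2_push \<iota> A v))\<^sup>2) UNIV" (is ?norm)
proof -
  let ?g = "\<lambda>v j. if j \<in> range \<iota> then A (l2_nth v (inv_into UNIV \<iota> j)) else 0"
  have hs: "((\<lambda>j. (norm (?g v j))\<^sup>2) has_sum s) UNIV
    \<longleftrightarrow> ((\<lambda>i. (norm (A (l2_nth v i)))\<^sup>2) has_sum s) UNIV" for v s
  proof -
    have "((\<lambda>j. (norm (?g v j))\<^sup>2) has_sum s) UNIV
        \<longleftrightarrow> ((\<lambda>j. (norm (?g v j))\<^sup>2) has_sum s) (range \<iota>)"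
      by (intro has_sum_cong_neutral) auto
    also have "\<dots> \<longleftrightarrow> ((\<lambda>i. (norm (A (l2_nth v i)))\<^sup>2) has_sum s) UNIV"
      by (subst has_sum_reindex) (auto simp: assms o_def)
    finally show ?thesis .
  qed
  have bnd: "(norm (A (l2_nth v i)))\<^sup>2 \<le> (norm A)\<^sup>2 * (norm (l2_nth v i))\<^sup>2" for v i
    using power_mono[OF norm_blinfun norm_ge_zero, of A "l2_nth v i" 2] by (simp add: power_mult_distrib)
  have summ: "(\<lambda>i. (norm (A (l2_nth v i)))\<^sup>2) summable_on UNIV" for v
    by (rule summable_on_comparison_test[OF summable_on_cmult_right[OF l2_summable]])
      (auto intro: bnd)
  define G where "G v = Abs_l2 (?g v)" for v
  have nthG: "l2_nth (G v) = ?g v" for v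
    unfolding G_def
  proof (rule Abs_l2_inverse)
    show "?g v \<in> {f. (\<lambda>i. (norm (f i))\<^sup>2) summable_on UNIV}"
      using summ[of v] hs[of v] unfolding summable_on_def by blast
  qed
  have hsG: "((\<lambda>i. (norm (A (l2_nth v i)))\<^sup>2) has_sum (norm (G v))\<^sup>2) UNIV" for v
  proof -
    have "((\<lambda>j. (norm (l2_nth (G v) j))\<^sup>2) has_sum (norm (G v))\<^sup>2) UNIV"
      unfolding norm_l2_sq by (rule has_sum_infsum[OF l2_summable])
    then show ?thesis unfolding nthG hs .
  qed
  have "bounded_linear G"
  proof (rule bounded_linear_intro[of _ "norm A"])
    show "G (v + w) = G v + G w" for v w
      by (rule l2_eqI) (simp add: nthG l2_nth_simps blinfun.add_right)
    show "G (r *\<^sub>R v) = r *\<^sub>R G v" for r v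
      by (rule l2_eqI) (simp add: nthG l2_nth_simps blinfun.scaleR_right)
    show "norm (G v) \<le> norm v * norm A" for v
    proof -
      have "((\<lambda>i. (norm A)\<^sup>2 * (norm (l2_nth v i))\<^sup>2) has_sum (norm A)\<^sup>2 * (norm v)\<^sup>2) UNIV"
        unfolding norm_l2_sq by (rule has_sum_cmult_right[OF has_sum_infsum[OF l2_summable]])
      then have "(norm (G v))\<^sup>2 \<le> (norm A)\<^sup>2 * (norm v)\<^sup>2"
        by (rule has_sum_mono[OF hsG]) (rule bnd)
      then have "(norm (G v))\<^sup>2 \<le> (norm v * norm A)\<^sup>2"
        by (simp add: power_mult_distrib mult.commute)
      then show ?thesis by (rule power2_le_imp_le) simp
    qed
  qed
  then have push: "blinfun_apply (l2_push \<iota> A) = G"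
    unfolding l2_push_def G_def by (rule bounded_linear_Blinfun_apply)
  show ?nth unfolding push nthG ..
  show ?norm unfolding push by (rule hsG)
qed

lemma l2_nth_l2_push_image: "inj \<iota> \<Longrightarrow> l2_nth (l2_push \<iota> A v) (\<iota> i) = A (l2_nth v i)"
  by (simp add: l2_nth_l2_push)

lemma clinear_op_l2_push:
  assumes "inj \<iota>" "clinear_op A"
  shows "clinear_op (l2_push \<iota> A)"
  unfolding clinear_op_def
  by (intro allI, rule l2_eqI) (simp add: l2_nth_l2_push assms l2_nth_simps clinear_opD)

lemma cinner_l2_push_disjoint:
  assumes "inj \<iota>" "inj \<kappa>" "range \<iota> \<inter> range \<kappa> = {}"
  shows "cinner (l2_push \<iota> A v) (l2_push \<kappa> B w) = 0"
proof -
  have "cinner (l2_nth (l2_push \<iota> A v) j) (l2_nth (l2_push \<kappa> B w) j) = 0" for j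
    using assms by (auto simp: l2_nth_l2_push)
  then show ?thesis by (simp add: cinner_l2_def)
qed

lemma cinner_l2_push_id:
  assumes "inj \<iota>"
  shows "cinner (l2_push \<iota> id_blinfun v) (l2_push \<iota> id_blinfun w) = cinner v w"
proof -
  let ?f = "\<lambda>j. cinner (l2_nth (l2_push \<iota> id_blinfun v) j) (l2_nth (l2_push \<iota> id_blinfun w) j)"
  have "infsum ?f UNIV = infsum ?f (range \<iota>)"
    by (intro infsum_cong_neutral) (auto simp: l2_nth_l2_push assms)
  also have "\<dots> = infsum (\<lambda>i. cinner (l2_nth v i) (l2_nth w i)) UNIV"
    by (subst infsum_reindex) (auto simp: assms o_def l2_nth_l2_push_image)
  finally show ?thesis by (simp add: cinner_l2_def)
qed

lift_definition l2_single :: "'i \<Rightarrow> 'h::chilbert_space \<Rightarrow> ('i, 'h) l2" is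
  "\<lambda>i h j. if j = i then h else 0"
proof -
  fix i :: 'i and h :: 'h
  have "(\<lambda>j. (norm (if j = i then h else 0))\<^sup>2) summable_on {i}" by simp
  then show "(\<lambda>j. (norm (if j = i then h else 0))\<^sup>2) summable_on UNIV"
    by (rule summable_on_cong_neutral[THEN iffD1, rotated -1]) auto
qed

lemma cinner_l2_single: "cinner (l2_single i h) v = cinner h (l2_nth v i)"
proof -
  have "cinner (l2_single i h) v = infsum (\<lambda>j. cinner (l2_nth (l2_single i h) j) (l2_nth v j)) {i}"
    unfolding cinner_l2_def by (intro infsum_cong_neutral) (auto simp: l2_single.rep_eq)
  then show ?thesis by (simp add: l2_single.rep_eq)
qed

lemma inner_l2_single: "inner (l2_single i h) v = inner h (l2_nth v i)"
  by (simp add: inner_cinner cinner_l2_single)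

text \<open>By Pythagoras the squared error is the squared norm minus a partial sum of it.\<close>

lemma l2_truncation_tendsto:
  "((\<lambda>F. \<Sum>i\<in>F. l2_single i (l2_nth v i)) \<longlongrightarrow> v) (finite_subsets_at_top UNIV)"
proof -
  let ?t = "\<lambda>F. \<Sum>i\<in>F. l2_single i (l2_nth v i)"
  have nth: "l2_nth (?t F) i = (if i \<in> F then l2_nth v i else 0)" if "finite F" for F i
    using that by (simp add: l2_nth_sum l2_single.rep_eq if_distrib sum.delta cong: if_cong)
  have inn: "inner (?t F) w = (\<Sum>i\<in>F. inner (l2_nth v i) (l2_nth w i))" for F w
    by (simp add: inner_sum_left inner_l2_single)
  have norm: "(norm (?t F - v))\<^sup>2 = (norm v)\<^sup>2 - (\<Sum>i\<in>F. (norm (l2_nth v i))\<^sup>2)" if "finite F" for F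
  proof -
    have "inner (?t F) (?t F) = (\<Sum>i\<in>F. (norm (l2_nth v i))\<^sup>2)"
      unfolding inn by (intro sum.cong refl) (simp add: nth[OF that] dot_square_norm)
    moreover have "inner (?t F) v = (\<Sum>i\<in>F. (norm (l2_nth v i))\<^sup>2)"
      unfolding inn by (simp add: dot_square_norm)
    ultimately show ?thesis
      by (simp add: power2_norm_eq_inner inner_diff inner_commute[of v "?t F"])
  qed
  have "((\<lambda>F. \<Sum>i\<in>F. (norm (l2_nth v i))\<^sup>2) \<longlongrightarrow> (norm v)\<^sup>2) (finite_subsets_at_top UNIV)"
    unfolding norm_l2_sq by (rule infsum_tendsto[OF l2_summable])
  then have "((\<lambda>F. (norm v)\<^sup>2 - (\<Sum>i\<in>F. (norm (l2_nth v i))\<^sup>2)) \<longlongrightarrow> (norm v)\<^sup>2 - (norm v)\<^sup>2)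
      (finite_subsets_at_top UNIV)"
    by (intro tendsto_intros)
  then have "((\<lambda>F. (norm v)\<^sup>2 - (\<Sum>i\<in>F. (norm (l2_nth v i))\<^sup>2)) \<longlongrightarrow> 0)
      (finite_subsets_at_top UNIV)" by simp
  then have "((\<lambda>F. (norm (?t F - v))\<^sup>2) \<longlongrightarrow> 0) (finite_subsets_at_top UNIV)"
    by (rule Lim_transform_eventually)
      (auto simp: norm intro!: eventually_finite_subsets_at_top_weakI)
  then have "((\<lambda>F. sqrt ((norm (?t F - v))\<^sup>2)) \<longlongrightarrow> sqrt 0) (finite_subsets_at_top UNIV)"
    by (rule tendsto_real_sqrt)
  then show ?thesis by (simp add: tendsto_norm_zero_iff LIM_zero_iff)
qed

lemma blinfun_l2_eqI:
  fixes A B :: "('i, 'a::chilbert_space) l2 \<Rightarrow>\<^sub>L 'b::real_normed_vector"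
  assumes "\<And>i h. A (l2_single i h) = B (l2_single i h)"
  shows "A = B"
proof (rule blinfun_eqI)
  fix v :: "('i, 'a) l2"
  let ?t = "\<lambda>F. \<Sum>i\<in>F. l2_single i (l2_nth v i)"
  have "A (?t F) = B (?t F)" for F by (simp add: blinfun.sum_right assms)
  moreover have "((\<lambda>F. A (?t F)) \<longlongrightarrow> A v) (finite_subsets_at_top UNIV)"
    "((\<lambda>F. B (?t F)) \<longlongrightarrow> B v) (finite_subsets_at_top UNIV)"
    by (intro blinfun.tendsto tendsto_const l2_truncation_tendsto)+
  ultimately show "A v = B v"
    using tendsto_unique[OF finite_subsets_at_top_neq_bot] by simp
qed

section \<open>The reconstruction operator in coordinates\<close>

lemma inj_snoc: "inj (\<lambda>\<beta>. \<beta> @ [i])"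
  by (simp add: inj_def)

lemma range_snoc: "range (\<lambda>\<beta>. \<beta> @ [i]) = {\<alpha>. \<alpha> \<noteq> [] \<and> last \<alpha> = i}"
  by (auto simp: image_iff) (metis append_butlast_last_id)

text \<open>Discharges the definite description in \<open>tensor_op\<close>: vectors supported at
  one word are elementary tensors, and their span is dense.\<close>

lemma tensor_op_right_creation:
  assumes "clinear_op A"
  shows "tensor_op A (right_creation i) = l2_push (\<lambda>\<beta>. \<beta> @ [i]) A"
  unfolding tensor_op_def
proof (rule the_equality)
  let ?P = "l2_push (\<lambda>\<beta>. \<beta> @ [i]) A"
  have inv: "inv_into UNIV (\<lambda>\<beta>. \<beta> @ [i]) \<alpha> = butlast \<alpha>" if "\<alpha> \<noteq> []" "last \<alpha> = i" for \<alpha>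
    using that by (intro inv_f_eq[OF inj_snoc]) auto
  show P: "\<forall>h \<phi>. ?P (tensor_vec h \<phi>) = tensor_vec (A h) (right_creation i \<phi>)"
    by (intro allI, rule l2_eqI)
      (auto simp: l2_nth_l2_push[OF inj_snoc] range_snoc tensor_vec.rep_eq right_creation.rep_eq
        append_basis.rep_eq inv clinear_opD[OF assms])
  fix B :: "('b list, 'a) l2 \<Rightarrow>\<^sub>L ('b list, 'a) l2"
  assume B: "\<forall>h \<phi>. B (tensor_vec h \<phi>) = tensor_vec (A h) (right_creation i \<phi>)"
  have single: "l2_single \<alpha> h = tensor_vec h (l2_single \<alpha> 1)" for \<alpha> :: "'b list" and h :: 'a
    by (rule l2_eqI) (simp add: l2_single.rep_eq tensor_vec.rep_eq scaleC_one)
  show "B = ?P"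
    by (rule blinfun_l2_eqI) (simp only: single P B)
qed

lemma recon_op_eq:
  assumes "\<And>i. clinear_op (Z i)"
  shows "recon_op Z = (\<Sum>i\<in>UNIV. l2_push (\<lambda>\<beta>. \<beta> @ [i]) (adj (Z i)))"
  unfolding recon_op_def by (simp add: tensor_op_right_creation clinear_op_adj assms)

lemma clinear_op_recon_op:
  assumes "\<And>i. clinear_op (Z i)"
  shows "clinear_op (recon_op Z)"
  unfolding recon_op_eq[OF assms]
  by (intro clinear_op_sum clinear_op_l2_push inj_snoc clinear_op_adj assms)

text \<open>A nonempty word has exactly one last letter, so only one summand of
  \<open>recon_op\<close> reaches a given coordinate.\<close>

lemma l2_nth_recon_op:
  assumes "\<And>i. clinear_op (Z i)"
  shows "l2_nth (recon_op Z v) [] = 0"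
    and "l2_nth (recon_op Z v) (\<alpha> @ [i]) = adj (Z i) (l2_nth v \<alpha>)"
proof -
  have "l2_nth (l2_push (\<lambda>\<beta>. \<beta> @ [j]) (adj (Z j)) v) (\<alpha> @ [i])
      = (if j = i then adj (Z i) (l2_nth v \<alpha>) else 0)" for j
    using l2_nth_l2_push_image[OF inj_snoc[of j], of _ v \<alpha>]
    by (auto simp: l2_nth_l2_push inj_snoc range_snoc)
  then show "l2_nth (recon_op Z v) (\<alpha> @ [i]) = adj (Z i) (l2_nth v \<alpha>)"
    by (simp add: recon_op_eq[OF assms] blinfun.sum_left l2_nth_sum sum.delta)
  show "l2_nth (recon_op Z v) [] = 0"
    by (simp add: recon_op_eq[OF assms] blinfun.sum_left l2_nth_sum l2_nth_l2_push inj_snoc range_snoc)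
qed

lemma has_sum_finite_sum:
  fixes f :: "'i \<Rightarrow> 'a \<Rightarrow> 'b::topological_comm_monoid_add"
  assumes "\<And>i. i \<in> I \<Longrightarrow> (f i has_sum s i) A"
  shows "((\<lambda>x. \<Sum>i\<in>I. f i x) has_sum (\<Sum>i\<in>I. s i)) A"
  using assms by (induction I rule: infinite_finite_induct) (simp_all add: has_sum_0 has_sum_add)

text \<open>The summands have orthogonal ranges, being supported on words with different last
  letters; Pythagoras then reduces the bound to the row hypothesis in each coordinate.\<close>

lemma norm_recon_op_le:
  fixes Z :: "'n::finite \<Rightarrow> 'h::chilbert_space \<Rightarrow>\<^sub>L 'h"
  assumes "\<And>i. clinear_op (Z i)" and row: "\<And>x. (\<Sum>i\<in>UNIV. (norm (adj (Z i) x))\<^sup>2) \<le> s\<^sup>2 * (norm x)\<^sup>2"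
    and "0 \<le> s"
  shows "norm (recon_op Z) \<le> s"
proof (rule norm_blinfun_bound[OF \<open>0 \<le> s\<close>])
  fix v
  let ?P = "\<lambda>i. l2_push (\<lambda>\<beta>. \<beta> @ [i]) (adj (Z i)) v"
  have orth: "inner (?P i) (?P j) = 0" if "i \<noteq> j" for i j
    unfolding inner_cinner using that
    by (subst cinner_l2_push_disjoint) (auto simp: inj_snoc range_snoc)
  have "(norm (\<Sum>i\<in>UNIV. ?P i))\<^sup>2 = (\<Sum>i\<in>UNIV. (norm (?P i))\<^sup>2)"
    by (rule norm_sum_Pythagorean) (auto simp: pairwise_def real_inner_class.orthogonal_def orth)
  moreover have "((\<lambda>\<beta>. \<Sum>i\<in>UNIV. (norm (adj (Z i) (l2_nth v \<beta>)))\<^sup>2) has_sum (\<Sum>i\<in>UNIV. (norm (?P i))\<^sup>2)) UNIV"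
    by (intro has_sum_finite_sum norm_l2_push inj_snoc)
  moreover have "((\<lambda>\<beta>. s\<^sup>2 * (norm (l2_nth v \<beta>))\<^sup>2) has_sum s\<^sup>2 * (norm v)\<^sup>2) UNIV"
    unfolding norm_l2_sq by (rule has_sum_cmult_right[OF has_sum_infsum[OF l2_summable]])
  ultimately have "(norm (recon_op Z v))\<^sup>2 \<le> s\<^sup>2 * (norm v)\<^sup>2"
    using has_sum_mono row by (fastforce simp: recon_op_eq[OF assms(1)] blinfun.sum_left)
  then have "(norm (recon_op Z v))\<^sup>2 \<le> (s * norm v)\<^sup>2"
    by (simp add: power_mult_distrib)
  then show "norm (recon_op Z v) \<le> s * norm v"
    by (rule power2_le_imp_le) (simp add: \<open>0 \<le> s\<close>)
qed

section \<open>Words of operators and the triangular form of I - R_Z\<close>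

lemma word_op_Nil [simp]: "word_op T [] = id_blinfun"
  by (simp add: word_op_def)

lemma word_op_Cons: "word_op T (i # \<alpha>) = T i o\<^sub>L word_op T \<alpha>"
  by (simp add: word_op_def)

lemma word_op_append: "word_op T (\<alpha> @ \<beta>) = word_op T \<alpha> o\<^sub>L word_op T \<beta>"
  by (induction \<alpha>) (simp_all add: word_op_Cons blinfun_compose_simps(7,9))

lemma word_op_scaleR: "word_op (\<lambda>i. r *\<^sub>R T i) \<alpha> = r ^ length \<alpha> *\<^sub>R word_op T \<alpha>"
  by (induction \<alpha>) (simp_all add: word_op_Cons blinfun_compose_simps(5,6))

text \<open>The coordinates of \<open>(I - R\<^sub>Z)\<^sup>-\<^sup>1 w\<close>.\<close>

definition prefix_sum ::
  "('n \<Rightarrow> 'h::chilbert_space \<Rightarrow>\<^sub>L 'h) \<Rightarrow> ('n list, 'h) l2 \<Rightarrow> 'n list \<Rightarrow> 'h" where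
  "prefix_sum Z w \<alpha> = (\<Sum>k\<le>length \<alpha>. adj (word_op Z (drop k \<alpha>)) (l2_nth w (take k \<alpha>)))"

lemma prefix_sum_Nil: "prefix_sum Z w [] = l2_nth w []"
  by (simp add: prefix_sum_def)

lemma prefix_sum_snoc:
  assumes "\<And>i. clinear_op (Z i)"
  shows "prefix_sum Z w (\<alpha> @ [i]) = adj (Z i) (prefix_sum Z w \<alpha>) + l2_nth w (\<alpha> @ [i])"
proof -
  have "(\<Sum>k\<le>length \<alpha>. adj (word_op Z (drop k (\<alpha> @ [i]))) (l2_nth w (take k (\<alpha> @ [i]))))
      = (\<Sum>k\<le>length \<alpha>. adj (Z i) (adj (word_op Z (drop k \<alpha>)) (l2_nth w (take k \<alpha>))))"
    by (intro sum.cong refl)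
      (simp add: word_op_append word_op_Cons adj_compose clinear_op_word_op assms blinfun_compose_simps(8))
  then show ?thesis
    by (simp add: prefix_sum_def blinfun.sum_right)
qed

text \<open>The equation u = w + R_Z u determines u at a word from u at the word without its last
  letter, so it is solved by recursion. Whether I - R_Z is invertible is thus only a question of
  square-summability and boundedness.\<close>

lemma minus_recon_op_eq_iff:
  assumes "\<And>i. clinear_op (Z i)"
  shows "(id_blinfun - recon_op Z) u = w \<longleftrightarrow> (\<forall>\<alpha>. l2_nth u \<alpha> = prefix_sum Z w \<alpha>)"
proof
  assume eq: "(id_blinfun - recon_op Z) u = w"
  have w: "l2_nth w \<alpha> = l2_nth u \<alpha> - l2_nth (recon_op Z u) \<alpha>" for \<alpha>
    unfolding eq[symmetric] by (simp add: blinfun.diff_left l2_nth_simps)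
  show "\<forall>\<alpha>. l2_nth u \<alpha> = prefix_sum Z w \<alpha>"
  proof
    show "l2_nth u \<alpha> = prefix_sum Z w \<alpha>" for \<alpha>
    proof (induction \<alpha> rule: rev_induct)
      case Nil
      show ?case by (simp add: prefix_sum_Nil w l2_nth_recon_op assms)
    next
      case (snoc i \<alpha>)
      then show ?case by (simp add: prefix_sum_snoc assms w l2_nth_recon_op)
    qed
  qed
next
  assume u: "\<forall>\<alpha>. l2_nth u \<alpha> = prefix_sum Z w \<alpha>"
  show "(id_blinfun - recon_op Z) u = w"
  proof (rule l2_eqI)
    fix \<alpha> :: "'a list"
    show "l2_nth ((id_blinfun - recon_op Z) u) \<alpha> = l2_nth w \<alpha>"
      by (cases \<alpha> rule: rev_cases)
        (simp_all add: blinfun.diff_left l2_nth_simps l2_nth_recon_op assms u prefix_sum_Nil prefix_sum_snoc)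
  qed
qed

section \<open>Resolvents and the operators \<open>C\<close>\<close>

definition invertible_op :: "('a::chilbert_space \<Rightarrow>\<^sub>L 'a) \<Rightarrow> bool" where
  "invertible_op A \<longleftrightarrow> (\<exists>B. A o\<^sub>L B = id_blinfun \<and> B o\<^sub>L A = id_blinfun)"

lemma invertible_op_inv_op:
  assumes "invertible_op A"
  shows "A o\<^sub>L inv_op A = id_blinfun" "inv_op A o\<^sub>L A = id_blinfun"
    and "A (inv_op A x) = x" "inv_op A (A x) = x"
proof -
  obtain B where B: "A o\<^sub>L B = id_blinfun" "B o\<^sub>L A = id_blinfun"
    using assms by (auto simp: invertible_op_def)
  have eq: "inv_op A = B" by (rule inv_op_eqI[OF B])
  show 1: "A o\<^sub>L inv_op A = id_blinfun" and 2: "inv_op A o\<^sub>L A = id_blinfun" using B eq by simp_all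
  show "A (inv_op A x) = x" "inv_op A (A x) = x"
    using arg_cong[OF 1, of "\<lambda>T. blinfun_apply T x"] arg_cong[OF 2, of "\<lambda>T. blinfun_apply T x"]
    by simp_all
qed

lemma invertible_op_inverse: "invertible_op A \<Longrightarrow> invertible_op (inv_op A)"
  using invertible_op_inv_op unfolding invertible_op_def by blast

lemma clinear_op_inv_op: "invertible_op A \<Longrightarrow> clinear_op A \<Longrightarrow> clinear_op (inv_op A)"
  using invertible_op_inv_op clinear_op_inverse by blast

lemma invertible_op_compose:
  fixes A B :: "'a::chilbert_space \<Rightarrow>\<^sub>L 'a"
  assumes "invertible_op A" "invertible_op B"
  shows "invertible_op (A o\<^sub>L B)"
  unfolding invertible_op_def
proof (intro exI conjI)
  show "(A o\<^sub>L B) o\<^sub>L (inv_op B o\<^sub>L inv_op A) = id_blinfun"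
    "(inv_op B o\<^sub>L inv_op A) o\<^sub>L (A o\<^sub>L B) = id_blinfun"
    by (rule blinfun_eqI; simp add: invertible_op_inv_op assms)+
qed

definition resolvent :: "('n::finite \<Rightarrow> 'h::chilbert_space \<Rightarrow>\<^sub>L 'h) \<Rightarrow> ('n list, 'h) l2 \<Rightarrow>\<^sub>L ('n list, 'h) l2"
  where "resolvent Z = inv_op (id_blinfun - recon_op Z)"

text \<open>The quadratic form of \<open>C\<^sup>* C = (I - R\<^sub>Z)\<^sup>-\<^sup>1 + (I - R\<^sub>Z\<^sup>*)\<^sup>-\<^sup>1 + (\<rho> - 2) I\<close>.\<close>

definition poisson_form :: "real \<Rightarrow> ('n::finite \<Rightarrow> 'h::chilbert_space \<Rightarrow>\<^sub>L 'h) \<Rightarrow> ('n list, 'h) l2 \<Rightarrow> real"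
  where "poisson_form \<rho> Z w = 2 * inner (resolvent Z w) w + (\<rho> - 2) * (norm w)\<^sup>2"

lemma l2_nth_resolvent:
  assumes "\<And>i. clinear_op (Z i)" "invertible_op (id_blinfun - recon_op Z)"
  shows "l2_nth (resolvent Z w) \<alpha> = prefix_sum Z w \<alpha>"
proof -
  have "(id_blinfun - recon_op Z) (resolvent Z w) = w"
    unfolding resolvent_def by (rule invertible_op_inv_op(3)[OF assms(2)])
  then show ?thesis using minus_recon_op_eq_iff[of Z] assms(1) by blast
qed

text \<open>A bounded operator with the recursively determined coordinates is automatically a
  two-sided inverse. This gives invertibility when \<open>norm (recon_op Z)\<close> is not below 1,
  as may happen in \<open>class_C\<close> for \<rho> > 1.\<close>

lemma resolvent_eqI:
  assumes "\<And>i. clinear_op (Z i)" "\<And>w \<alpha>. l2_nth (blinfun_apply N w) \<alpha> = prefix_sum Z w \<alpha>"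
  shows "invertible_op (id_blinfun - recon_op Z)" "resolvent Z = N"
proof -
  have 1: "(id_blinfun - recon_op Z) o\<^sub>L N = id_blinfun"
  proof (rule blinfun_eqI)
    fix w
    have "(id_blinfun - recon_op Z) (N w) = w"
      using minus_recon_op_eq_iff[of Z "N w" w] assms by blast
    then show "((id_blinfun - recon_op Z) o\<^sub>L N) w = id_blinfun w" by simp
  qed
  have 2: "N o\<^sub>L (id_blinfun - recon_op Z) = id_blinfun"
  proof (rule blinfun_eqI, rule l2_eqI)
    fix u \<alpha>
    have "\<forall>\<alpha>. l2_nth u \<alpha> = prefix_sum Z ((id_blinfun - recon_op Z) u) \<alpha>"
      using minus_recon_op_eq_iff[of Z u] assms(1) by blast
    then show "l2_nth ((N o\<^sub>L (id_blinfun - recon_op Z)) u) \<alpha> = l2_nth (id_blinfun u) \<alpha>"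
      by (simp add: assms(2))
  qed
  show "invertible_op (id_blinfun - recon_op Z)" unfolding invertible_op_def using 1 2 by blast
  show "resolvent Z = N" unfolding resolvent_def by (rule inv_op_eqI[OF 1 2])
qed

text \<open>With w = (I - R) u the form for \<rho> = 1 is |u|^2 - |R u|^2, at least (1 - s^2) |u|^2,
  while |w| \<le> (1 + s) |u|; the quotient of the two bounds is the Harnack constant (1 - s) / (1 +
  s).\<close>

lemma poisson_form_contraction:
  assumes "\<And>i. clinear_op (Z i)" and nrm: "norm (recon_op Z) \<le> s" and s: "0 \<le> s" "s < 1"
  shows "invertible_op (id_blinfun - recon_op Z)"
    and "(1 - s) / (1 + s) * (norm w)\<^sup>2 \<le> poisson_form 1 Z w"
proof -
  have "norm (recon_op Z) < 1" using nrm s by linarith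
  then show inv: "invertible_op (id_blinfun - recon_op Z)"
    unfolding invertible_op_def using neumann_inverse by metis
  define u where "u = resolvent Z w"
  have w: "w = u - recon_op Z u"
    using invertible_op_inv_op(3)[OF inv, of w] by (simp add: u_def resolvent_def blinfun.diff_left)
  have Ru: "norm (recon_op Z u) \<le> s * norm u"
    by (rule order_trans[OF norm_blinfun]) (intro mult_right_mono nrm norm_ge_zero)
  have "poisson_form 1 Z w = (norm u)\<^sup>2 - (norm (recon_op Z u))\<^sup>2"
    unfolding poisson_form_def u_def[symmetric] unfolding w
    by (simp add: power2_norm_eq_inner inner_diff inner_commute[of "recon_op Z u" u])
  moreover have "(norm (recon_op Z u))\<^sup>2 \<le> (s * norm u)\<^sup>2" by (intro power_mono Ru norm_ge_zero)
  moreover have "(1 - s) / (1 + s) * (norm w)\<^sup>2 \<le> (1 - s) / (1 + s) * ((1 + s) * norm u)\<^sup>2"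
  proof (intro mult_left_mono power_mono norm_ge_zero)
    show "norm w \<le> (1 + s) * norm u"
      using norm_triangle_ineq4[of u "recon_op Z u"] Ru by (simp add: w algebra_simps)
  qed (use s in simp)
  moreover have "(1 - s) / (1 + s) * ((1 + s) * norm u)\<^sup>2 = (norm u)\<^sup>2 - (s * norm u)\<^sup>2"
    using s by (simp add: power2_eq_square field_simps)
  ultimately show "(1 - s) / (1 + s) * (norm w)\<^sup>2 \<le> poisson_form 1 Z w" by linarith
qed

text \<open>Bessel's inequality: \<open>y\<close> is the projection of \<open>x\<close> onto the sum
  of the ranges, and \<open>inner y x\<close> is the square of its norm.\<close>

lemma sum_norm_adj_le:
  fixes V :: "'n::finite \<Rightarrow> 'a::chilbert_space \<Rightarrow>\<^sub>L 'b::chilbert_space"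
  assumes lin: "\<And>i. clinear_op (V i)"
    and orth: "\<And>i j x y. i \<noteq> j \<Longrightarrow> cinner (V i x) (V j y) = 0" and iso: "\<And>i x. norm (V i x) = norm x"
  shows "(\<Sum>i\<in>UNIV. (norm (adj (V i) x))\<^sup>2) \<le> (norm x)\<^sup>2"
proof -
  define y where "y = (\<Sum>i\<in>UNIV. V i (adj (V i) x))"
  have "(norm y)\<^sup>2 = (\<Sum>i\<in>UNIV. (norm (V i (adj (V i) x)))\<^sup>2)"
    unfolding y_def
    by (rule norm_sum_Pythagorean)
      (auto simp: pairwise_def real_inner_class.orthogonal_def inner_cinner orth)
  then have y: "(norm y)\<^sup>2 = (\<Sum>i\<in>UNIV. (norm (adj (V i) x))\<^sup>2)" by (simp add: iso)
  have "inner y x = (\<Sum>i\<in>UNIV. (norm (adj (V i) x))\<^sup>2)"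
    by (simp add: y_def inner_sum_left inner_adj[OF lin] dot_square_norm)
  moreover have "0 \<le> (norm (x - y))\<^sup>2" by simp
  ultimately show ?thesis
    using y by (simp add: power2_norm_eq_inner inner_diff inner_commute[of x y])
qed

lemma adj_adj: "clinear_op A \<Longrightarrow> adj (adj A) = A"
  by (rule adj_eqI) (simp_all add: cinner_adj' clinear_op_adj)

text \<open>The resolvent of rX is a corrected compression of that of the dilating tuple rV. This
  turns the form of rX at w into \<rho> times the \<rho> = 1 form of rV at the embedded vector,
  where the bound for contractions applies.\<close>

lemma class_C_resolvent:
  fixes X :: "'n::finite \<Rightarrow> 'h::chilbert_space \<Rightarrow>\<^sub>L 'h"
  assumes "class_C TYPE('g::chilbert_space) \<rho> X" and r: "0 \<le> r" "r < 1" and "0 < \<rho>"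
  shows "invertible_op (id_blinfun - recon_op (\<lambda>i. r *\<^sub>R X i))"
    and "\<rho> * ((1 - r) / (1 + r)) * (norm w)\<^sup>2 \<le> poisson_form \<rho> (\<lambda>i. r *\<^sub>R X i) w"
proof -
  obtain J :: "'h \<Rightarrow>\<^sub>L 'g" and V :: "'n \<Rightarrow> 'g \<Rightarrow>\<^sub>L 'g" where
    J: "isometry_op J" and V: "\<And>i. isometry_op (V i)"
    and orth: "\<And>i j x y. i \<noteq> j \<Longrightarrow> cinner (V i x) (V j y) = 0"
    and dil: "\<And>\<alpha>. \<alpha> \<noteq> [] \<Longrightarrow> word_op X \<alpha> = \<rho> *\<^sub>R (adj J o\<^sub>L word_op V \<alpha> o\<^sub>L J)"
    and linX: "\<And>i. clinear_op (X i)"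
    using assms(1) unfolding class_C_def by metis
  have linJ: "clinear_op J" and normJ: "\<And>x. norm (J x) = norm x"
    and linV: "\<And>i. clinear_op (V i)" and normV: "\<And>i x. norm (V i x) = norm x"
    using J V by (auto simp: isometry_op_def)
  define Z where "Z = (\<lambda>i. r *\<^sub>R X i)"
  define W where "W = (\<lambda>i. r *\<^sub>R V i)"
  have linZ: "clinear_op (Z i)" and linW: "clinear_op (W i)" for i
    by (simp_all add: Z_def W_def clinear_op_scaleR linX linV)
  have "norm (recon_op W) \<le> r"
  proof (rule norm_recon_op_le[OF linW _ r(1)])
    fix x
    have "(\<Sum>i\<in>UNIV. (norm (adj (W i) x))\<^sup>2) = r\<^sup>2 * (\<Sum>i\<in>UNIV. (norm (adj (V i) x))\<^sup>2)"
      by (simp add: W_def adj_scaleR linV blinfun.scaleR_left power_mult_distrib sum_distrib_left)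
    also have "\<dots> \<le> r\<^sup>2 * (norm x)\<^sup>2"
      by (intro mult_left_mono sum_norm_adj_le linV orth normV) simp_all
    finally show "(\<Sum>i\<in>UNIV. (norm (adj (W i) x))\<^sup>2) \<le> r\<^sup>2 * (norm x)\<^sup>2" .
  qed
  note pW = poisson_form_contraction[OF linW this r]
  define JJ where "JJ = (l2_push id J :: ('n list, 'h) l2 \<Rightarrow>\<^sub>L ('n list, 'g) l2)"
  define JS where "JS = (l2_push id (adj J) :: ('n list, 'g) l2 \<Rightarrow>\<^sub>L ('n list, 'h) l2)"
  have nthJJ: "l2_nth (JJ v) \<alpha> = J (l2_nth v \<alpha>)" for v \<alpha>
    using l2_nth_l2_push_image[OF inj_on_id, of J v \<alpha>] by (simp add: JJ_def)
  have nthJS: "l2_nth (JS v) \<alpha> = adj J (l2_nth v \<alpha>)" for v \<alpha>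
    using l2_nth_l2_push_image[OF inj_on_id, of "adj J" v \<alpha>] by (simp add: JS_def)
  have normJJ: "(norm (JJ v))\<^sup>2 = (norm v)\<^sup>2" for v by (simp add: norm_l2_sq nthJJ normJ)
  have innerJS: "inner (JS v) w = inner v (JJ w)" for v w
    by (simp add: inner_l2_def nthJS nthJJ inner_adj'[OF linJ])
  \<comment> \<open>The dilation formula holds for nonempty words only. At the empty word \<rho>
    times the compression is \<rho> I instead of I, and the summand with 1 - \<rho> corrects
    this.\<close>
  define N where "N = (1 - \<rho>) *\<^sub>R id_blinfun + \<rho> *\<^sub>R (JS o\<^sub>L resolvent W o\<^sub>L JJ)"
  have nthN: "l2_nth (N w) \<alpha> = prefix_sum Z w \<alpha>" for w \<alpha>
  proof -
    have "adj (word_op Z (drop k \<alpha>)) (l2_nth w (take k \<alpha>)) =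
        (if k = length \<alpha> then (1 - \<rho>) *\<^sub>R l2_nth w \<alpha> else 0)
        + \<rho> *\<^sub>R adj J (adj (word_op W (drop k \<alpha>)) (J (l2_nth w (take k \<alpha>))))"
      if "k \<le> length \<alpha>" for k
    proof (cases "k = length \<alpha>")
      case True
      then show ?thesis
        by (simp add: adj_isometry_isometry[OF J] flip: scaleR_add_left)
    next
      case False
      then have "drop k \<alpha> \<noteq> []" using that by simp
      have "adj (word_op Z (drop k \<alpha>))
          = r ^ length (drop k \<alpha>) *\<^sub>R \<rho> *\<^sub>R (adj J o\<^sub>L adj (word_op V (drop k \<alpha>)) o\<^sub>L J)"
        unfolding Z_def word_op_scaleR dil[OF \<open>drop k \<alpha> \<noteq> []\<close>]
        by (intro blinfun_eqI) (simp add: adj_scaleR adj_compose clinear_op_scaleR clinear_op_compose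
            clinear_op_adj clinear_op_word_op linJ linV adj_adj blinfun.bilinear_simps)
      then show ?thesis using False
        by (simp add: W_def word_op_scaleR adj_scaleR clinear_op_word_op linV blinfun.bilinear_simps
            mult.commute)
    qed
    then have "prefix_sum Z w \<alpha> = (\<Sum>k\<le>length \<alpha>. (if k = length \<alpha> then (1 - \<rho>) *\<^sub>R l2_nth w \<alpha> else 0)
        + \<rho> *\<^sub>R adj J (adj (word_op W (drop k \<alpha>)) (J (l2_nth w (take k \<alpha>)))))"
      unfolding prefix_sum_def by (intro sum.cong) auto
    also have "\<dots> = (1 - \<rho>) *\<^sub>R l2_nth w \<alpha> + \<rho> *\<^sub>R adj J (prefix_sum W (JJ w) \<alpha>)"
      by (simp add: sum.distrib sum.delta prefix_sum_def nthJJ blinfun.sum_right scaleR_sum_right)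
    also have "\<dots> = l2_nth (N w) \<alpha>"
      by (simp add: N_def blinfun.bilinear_simps l2_nth_simps nthJS l2_nth_resolvent[OF linW pW(1)])
    finally show ?thesis by simp
  qed
  note res = resolvent_eqI[OF linZ nthN]
  show "invertible_op (id_blinfun - recon_op (\<lambda>i. r *\<^sub>R X i))"
    using res(1) unfolding Z_def .
  have "poisson_form \<rho> Z w = \<rho> * poisson_form 1 W (JJ w)"
    by (simp add: poisson_form_def res(2) N_def blinfun.bilinear_simps inner_add_left innerJS normJJ
        dot_square_norm algebra_simps)
  moreover have "\<rho> * ((1 - r) / (1 + r) * (norm w)\<^sup>2) \<le> \<rho> * poisson_form 1 W (JJ w)"
    using pW(2)[of "JJ w"] \<open>0 < \<rho>\<close> by (intro mult_left_mono) (simp_all add: normJJ)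
  ultimately show "\<rho> * ((1 - r) / (1 + r)) * (norm w)\<^sup>2 \<le> poisson_form \<rho> (\<lambda>i. r *\<^sub>R X i) w"
    by (simp add: Z_def mult.assoc)
qed

text \<open>The operator under the root of \<open>Delta_op\<close>, taken at u, has the quadratic
  form of the kernel at w = (I - R) u. Since the resolvent is bounded, the lower bound in w becomes
  one in u, so the root exists and is invertible.\<close>

lemma C_op_norm:
  fixes Z :: "'n::finite \<Rightarrow> 'h::chilbert_space \<Rightarrow>\<^sub>L 'h"
  assumes lin: "\<And>i. clinear_op (Z i)" and inv: "invertible_op (id_blinfun - recon_op Z)"
    and "\<delta> > 0" and lower: "\<And>w. \<delta> * (norm w)\<^sup>2 \<le> poisson_form \<rho> Z w"
  shows "invertible_op (C_op \<rho> Z)" "(norm (C_op \<rho> Z w))\<^sup>2 = poisson_form \<rho> Z w"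
proof -
  define R where "R = recon_op Z"
  have linR: "clinear_op R" unfolding R_def by (rule clinear_op_recon_op[OF lin])
  define A where "A = \<rho> *\<^sub>R id_blinfun + (1 - \<rho>) *\<^sub>R (adj R + R) + (\<rho> - 2) *\<^sub>R (adj R o\<^sub>L R)"
  have linA: "clinear_op A" unfolding A_def
    by (intro clinear_op_add clinear_op_scaleR clinear_op_compose clinear_op_adj clinear_op_id linR)
  have saA: "adj A = A"
    by (rule adj_eqI[OF _ linA], simp add: A_def blinfun.bilinear_simps cinner_add_left cinner_add_right cinner_scaleR_left
        cinner_scaleR_right cinner_adj[OF linR] cinner_adj'[OF linR], (simp add: algebra_simps)?)
  have res: "resolvent Z ((id_blinfun - R) u) = u" for u
    unfolding resolvent_def R_def by (rule invertible_op_inv_op(4)[OF inv])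
  have form: "inner (A u) u = poisson_form \<rho> Z ((id_blinfun - R) u)" for u
    unfolding poisson_form_def res
    by (simp add: A_def blinfun.bilinear_simps power2_norm_eq_inner inner_add_left inner_diff
        inner_adj'[OF linR] inner_commute[of "R u" u] algebra_simps)
  \<comment> \<open>The summand 1 keeps \<open>M\<close> positive when the resolvent has norm
    0.\<close>
  define M where "M = 1 + norm (resolvent Z)"
  have "M > 0" by (simp add: M_def add_pos_nonneg)
  have lowerA: "\<delta> / M\<^sup>2 * (norm u)\<^sup>2 \<le> inner (A u) u" for u
  proof -
    have "norm u \<le> norm (resolvent Z) * norm ((id_blinfun - R) u)"
      using norm_blinfun[of "resolvent Z" "(id_blinfun - R) u"] by (simp add: res)
    also have "\<dots> \<le> M * norm ((id_blinfun - R) u)" by (intro mult_right_mono) (simp_all add: M_def)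
    finally have "(norm u)\<^sup>2 \<le> (M * norm ((id_blinfun - R) u))\<^sup>2" by (intro power_mono norm_ge_zero)
    then have "\<delta> / M\<^sup>2 * (norm u)\<^sup>2 \<le> \<delta> / M\<^sup>2 * (M\<^sup>2 * (norm ((id_blinfun - R) u))\<^sup>2)"
      using \<open>\<delta> > 0\<close> by (intro mult_left_mono) (simp_all add: power_mult_distrib)
    also have "\<dots> = \<delta> * (norm ((id_blinfun - R) u))\<^sup>2" using \<open>M > 0\<close> by simp
    also have "\<dots> \<le> inner (A u) u" unfolding form by (rule lower)
    finally show ?thesis .
  qed
  have "\<delta> / M\<^sup>2 > 0" using \<open>\<delta> > 0\<close> \<open>M > 0\<close> by simp
  note sq = sqrt_op_strictly_positive[OF linA saA this lowerA]
  have Delta: "Delta_op \<rho> Z = sqrt_op A" unfolding Delta_op_def A_def R_def ..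
  show "invertible_op (C_op \<rho> Z)"
    unfolding C_op_def Delta
    by (intro invertible_op_compose invertible_op_inverse inv) (use sq(3) in \<open>simp add: invertible_op_def\<close>)
  have "(norm (sqrt_op A u))\<^sup>2 = inner (A u) u" for u
  proof -
    have lS: "clinear_op (sqrt_op A)" using sq(1) by (simp add: pos_op_def)
    have "(norm (sqrt_op A u))\<^sup>2 = inner (sqrt_op A (sqrt_op A u)) u"
      using inner_adj[OF lS, of "sqrt_op A u" u] pos_op_selfadjoint[OF sq(1)]
      by (simp add: power2_norm_eq_inner)
    also have "\<dots> = inner (A u) u"
      using arg_cong[OF sq(2), of "\<lambda>T. inner (blinfun_apply T u) u"] by simp
    finally show ?thesis .
  qed
  then have "(norm (C_op \<rho> Z w))\<^sup>2 = poisson_form \<rho> Z ((id_blinfun - R) (resolvent Z w))"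
    by (simp add: C_op_def Delta form resolvent_def R_def)
  then show "(norm (C_op \<rho> Z w))\<^sup>2 = poisson_form \<rho> Z w"
    unfolding resolvent_def R_def by (simp only: invertible_op_inv_op(3)[OF inv])
qed

lemma norm_compose_inv_op_le_iff:
  fixes A B :: "'a::chilbert_space \<Rightarrow>\<^sub>L 'a"
  assumes "invertible_op B" "0 \<le> c"
  shows "norm (A o\<^sub>L inv_op B) \<le> c \<longleftrightarrow> (\<forall>w. (norm (A w))\<^sup>2 \<le> c\<^sup>2 * (norm (B w))\<^sup>2)"
proof -
  have "norm (A o\<^sub>L inv_op B) \<le> c \<longleftrightarrow> (\<forall>w. norm (A w) \<le> c * norm (B w))"
  proof
    assume le: "norm (A o\<^sub>L inv_op B) \<le> c"
    show "\<forall>w. norm (A w) \<le> c * norm (B w)"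
    proof
      fix w
      have "norm (A w) = norm ((A o\<^sub>L inv_op B) (B w))" by (simp add: invertible_op_inv_op(4)[OF assms(1)])
      also have "\<dots> \<le> norm (A o\<^sub>L inv_op B) * norm (B w)" by (rule norm_blinfun)
      also have "\<dots> \<le> c * norm (B w)" by (intro mult_right_mono le norm_ge_zero)
      finally show "norm (A w) \<le> c * norm (B w)" .
    qed
  next
    assume "\<forall>w. norm (A w) \<le> c * norm (B w)"
    then show "norm (A o\<^sub>L inv_op B) \<le> c"
      using \<open>0 \<le> c\<close> by (intro norm_blinfun_bound) (metis invertible_op_inv_op(3)[OF assms(1)] blinfun_apply_blinfun_compose)+
  qed
  also have "\<dots> \<longleftrightarrow> (\<forall>w. (norm (A w))\<^sup>2 \<le> c\<^sup>2 * (norm (B w))\<^sup>2)"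
  proof -
    have "norm (A w) \<le> c * norm (B w) \<longleftrightarrow> (norm (A w))\<^sup>2 \<le> (c * norm (B w))\<^sup>2" for w
      using \<open>0 \<le> c\<close> by (intro power_mono_iff[symmetric]) simp_all
    then show ?thesis by (simp add: power_mult_distrib)
  qed
  finally show ?thesis .
qed

section \<open>Harnack domination in terms of quadratic forms\<close>

definition block_form :: "nat \<Rightarrow> ('a::chilbert_space \<Rightarrow>\<^sub>L 'a) mat \<Rightarrow> (nat \<Rightarrow> 'a) \<Rightarrow> complex" where
  "block_form m P v = (\<Sum>i<m. \<Sum>j<m. cinner ((P $$ (i, j)) (v j)) (v i))"

lemma block_pos_iff:
  "P \<in> carrier_mat m m \<Longrightarrow> block_pos P \<longleftrightarrow> (\<forall>v. block_form m P v \<in> \<real>\<^sub>\<ge>\<^sub>0)"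
  by (auto simp: block_pos_def block_form_def)

lemma block_form_add:
  "P \<in> carrier_mat m m \<Longrightarrow> Q \<in> carrier_mat m m \<Longrightarrow>
    block_form m (P + Q) v = block_form m P v + block_form m Q v"
  by (simp add: block_form_def blinfun.add_left cinner_add_left sum.distrib)

lemma block_form_diff:
  "P \<in> carrier_mat m m \<Longrightarrow> Q \<in> carrier_mat m m \<Longrightarrow>
    block_form m (P - Q) v = block_form m P v - block_form m Q v"
  by (simp add: block_form_def blinfun.diff_left cinner_diff_left sum_subtractf)

lemma block_form_scale:
  "P \<in> carrier_mat m m \<Longrightarrow> block_form m (block_scale r P) v = of_real r * block_form m P v"
  by (simp add: block_form_def block_scale_def blinfun.scaleR_left cinner_scaleR_left sum_distrib_left)

lemma block_Re_carrier: "P \<in> carrier_mat m m \<Longrightarrow> block_Re P \<in> carrier_mat m m"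
  by (auto simp: block_Re_def block_scale_def block_adj_def)

lemma block_scale_carrier: "P \<in> carrier_mat m m \<Longrightarrow> block_scale r P \<in> carrier_mat m m"
  by (auto simp: block_scale_def)

lemma block_form_Re:
  assumes P: "P \<in> carrier_mat m m" and lin: "\<And>i j. i < m \<Longrightarrow> j < m \<Longrightarrow> clinear_op (P $$ (i, j))"
  shows "block_form m (block_Re P) v = of_real (Re (block_form m P v))"
proof -
  have A: "block_adj P \<in> carrier_mat m m" using P by (auto simp: block_adj_def)
  have "block_form m (block_adj P) v = (\<Sum>i<m. \<Sum>j<m. cnj (cinner ((P $$ (j, i)) (v i)) (v j)))"
    unfolding block_form_def
  proof (intro sum.cong refl)
    fix i j assume "i \<in> {..<m}" "j \<in> {..<m}"
    then show "cinner ((block_adj P $$ (i, j)) (v j)) (v i) = cnj (cinner ((P $$ (j, i)) (v i)) (v j))"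
      using P by (simp add: block_adj_def cinner_adj'[OF lin] flip: cinner_commute)
  qed
  also have "\<dots> = cnj (block_form m P v)"
    unfolding block_form_def cnj_sum by (rule sum.swap)
  finally have "block_form m (block_Re P) v = (1 / 2) * (cnj (block_form m P v) + block_form m P v)"
    unfolding block_Re_def using A P by (simp add: block_form_scale block_form_add)
  then show ?thesis by (simp add: complex_eq_iff)
qed

lemma nc_eval_carrier: "nc_eval m p Z \<in> carrier_mat m m"
  by (simp add: nc_eval_def)

lemma clinear_op_scalar_op: "clinear_op (scalar_op c)"
  by (simp add: clinear_op_def scalar_op.rep_eq scaleC_scaleC mult.commute)

lemma clinear_op_nc_eval:
  assumes "\<And>i. clinear_op (Z i)" "i < m" "j < m"
  shows "clinear_op (nc_eval m p Z $$ (i, j))"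
  using assms(2,3)
  by (auto simp: nc_eval_def intro!: clinear_op_sum clinear_op_compose clinear_op_scalar_op
      clinear_op_word_op assms(1))

text \<open>For complex-linear \<open>Z\<close> this is the quadratic form of
  \<open>block_Re (nc_eval m p Z)\<close>, by \<open>block_form_Re\<close>.\<close>

definition poly_form ::
  "nat \<Rightarrow> ('n list \<Rightarrow> complex mat) \<Rightarrow> ('n \<Rightarrow> 'a::chilbert_space \<Rightarrow>\<^sub>L 'a) \<Rightarrow> (nat \<Rightarrow> 'a) \<Rightarrow> real" where
  "poly_form m p Z v = Re (block_form m (nc_eval m p Z) v)"

lemma poly_form_eq:
  assumes "finite S" "{\<gamma>. p \<gamma> \<noteq> 0\<^sub>m m m} \<subseteq> S"
  shows "poly_form m p Z v =
    Re (\<Sum>i<m. \<Sum>j<m. \<Sum>\<gamma>\<in>S. p \<gamma> $$ (i, j) * cinner (word_op Z \<gamma> (v j)) (v i))"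
proof -
  have "cinner ((nc_eval m p Z $$ (i, j)) (v j)) (v i)
      = (\<Sum>\<gamma>\<in>S. p \<gamma> $$ (i, j) * cinner (word_op Z \<gamma> (v j)) (v i))" if "i < m" "j < m" for i j
  proof -
    have "cinner ((nc_eval m p Z $$ (i, j)) (v j)) (v i)
      = (\<Sum>\<gamma> | p \<gamma> \<noteq> 0\<^sub>m m m. p \<gamma> $$ (i, j) * cinner (word_op Z \<gamma> (v j)) (v i))"
      using that by (simp add: nc_eval_def blinfun.sum_left cinner_sum_left scalar_op.rep_eq
          cinner_scaleC_left)
    also have "\<dots> = (\<Sum>\<gamma>\<in>S. p \<gamma> $$ (i, j) * cinner (word_op Z \<gamma> (v j)) (v i))"
      using that by (intro sum.mono_neutral_left assms) auto
    finally show ?thesis .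
  qed
  then show ?thesis by (simp add: poly_form_def block_form_def)
qed

lemma Re_nonneg_on_ballD:
  fixes X :: "'n::finite \<Rightarrow> 'k::chilbert_space \<Rightarrow>\<^sub>L 'k"
  assumes "Re_nonneg_on_ball TYPE('k) m p" "\<And>i. clinear_op (X i)"
    "norm (\<Sum>i\<in>UNIV. X i o\<^sub>L adj (X i)) < 1"
  shows "0 \<le> poly_form m p X v"
proof -
  have "block_pos (block_Re (nc_eval m p X))"
    using assms unfolding Re_nonneg_on_ball_def by blast
  then have "block_form m (block_Re (nc_eval m p X)) v \<in> \<real>\<^sub>\<ge>\<^sub>0"
    using block_pos_iff[OF block_Re_carrier[OF nc_eval_carrier]] by blast
  then show ?thesis
    by (simp add: block_form_Re[OF nc_eval_carrier clinear_op_nc_eval] assms(2) poly_form_def)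
qed

lemma Re_nonneg_on_ballI:
  assumes "\<And>(X :: 'n::finite \<Rightarrow> 'k::chilbert_space \<Rightarrow>\<^sub>L 'k) v. (\<And>i. clinear_op (X i)) \<Longrightarrow>
    norm (\<Sum>i\<in>UNIV. X i o\<^sub>L adj (X i)) < 1 \<Longrightarrow> 0 \<le> poly_form m p X v"
  shows "Re_nonneg_on_ball TYPE('k) m p"
  unfolding Re_nonneg_on_ball_def
proof (intro allI impI)
  fix X :: "'n \<Rightarrow> 'k \<Rightarrow>\<^sub>L 'k"
  assume X: "(\<forall>i. clinear_op (X i)) \<and> norm (\<Sum>i\<in>UNIV. X i o\<^sub>L adj (X i)) < 1"
  have "block_form m (block_Re (nc_eval m p X)) v \<in> \<real>\<^sub>\<ge>\<^sub>0" for v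
    using assms[of X v] X
    by (simp add: block_form_Re[OF nc_eval_carrier clinear_op_nc_eval] poly_form_def)
  then show "block_pos (block_Re (nc_eval m p X))"
    using block_pos_iff[OF block_Re_carrier[OF nc_eval_carrier]] by blast
qed

definition harnack_form ::
  "real \<Rightarrow> nat \<Rightarrow> ('n list \<Rightarrow> complex mat) \<Rightarrow> ('n \<Rightarrow> 'a::chilbert_space \<Rightarrow>\<^sub>L 'a) \<Rightarrow> (nat \<Rightarrow> 'a) \<Rightarrow> real"
  where "harnack_form \<rho> m p Z v = poly_form m p Z v + (\<rho> - 1) * poly_form m p (\<lambda>_. 0) v"

lemma harnack_dom_iff:
  fixes A B :: "'n::finite \<Rightarrow> 'h::chilbert_space \<Rightarrow>\<^sub>L 'h"
  assumes "\<And>i. clinear_op (A i)" "\<And>i. clinear_op (B i)"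
  shows "harnack_dom TYPE('k::chilbert_space) \<rho> c A B \<longleftrightarrow>
    (\<forall>m p v. nc_poly m p \<and> Re_nonneg_on_ball TYPE('k) m p \<longrightarrow>
       harnack_form \<rho> m p A v \<le> c\<^sup>2 * harnack_form \<rho> m p B v)"
proof -
  have re: "block_form m (block_Re (nc_eval m p Z)) v = of_real (poly_form m p Z v)"
    if "\<And>i. clinear_op (Z i)" for m p v and Z :: "'n \<Rightarrow> 'h \<Rightarrow>\<^sub>L 'h"
    unfolding poly_form_def using that by (intro block_form_Re nc_eval_carrier clinear_op_nc_eval)
  have "block_le (block_Re (nc_eval m p A) + block_scale (\<rho> - 1) (block_Re (nc_eval m p (\<lambda>_. 0))))
      (block_scale (c\<^sup>2) (block_Re (nc_eval m p B) + block_scale (\<rho> - 1) (block_Re (nc_eval m p (\<lambda>_. 0)))))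
    \<longleftrightarrow> (\<forall>v. harnack_form \<rho> m p A v \<le> c\<^sup>2 * harnack_form \<rho> m p B v)" (is "block_le ?P ?Q \<longleftrightarrow> _") for m p
  proof -
    note car = block_Re_carrier[OF nc_eval_carrier] block_scale_carrier add_carrier_mat
    have PQ: "?P \<in> carrier_mat m m" "?Q \<in> carrier_mat m m" by (intro car)+
    have "?Q - ?P \<in> carrier_mat m m" by (rule minus_carrier_mat[OF PQ(1)])
    then have "block_le ?P ?Q \<longleftrightarrow> (\<forall>v. block_form m ?Q v - block_form m ?P v \<in> \<real>\<^sub>\<ge>\<^sub>0)"
      by (simp add: block_le_def block_pos_iff block_form_diff[OF PQ(2,1)])
    moreover have "block_form m ?P v = of_real (harnack_form \<rho> m p A v)"
      "block_form m ?Q v = of_real (c\<^sup>2 * harnack_form \<rho> m p B v)" for v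
      by (simp_all add: block_form_add[where m = m] block_form_scale[where m = m] car re assms harnack_form_def)
    ultimately show ?thesis by (simp flip: of_real_diff of_real_mult of_real_power)
  qed
  then show ?thesis unfolding harnack_dom_def by blast
qed

section \<open>Test polynomials from the Poisson kernel\<close>

text \<open>The real part of this polynomial is a finite truncation of the Poisson kernel.\<close>

definition poisson_poly :: "real \<Rightarrow> 'n list list \<Rightarrow> 'n list \<Rightarrow> complex mat" where
  "poisson_poly r ws \<gamma> = Matrix.mat (length ws) (length ws)
     (\<lambda>(i, j). if ws ! j = ws ! i @ \<gamma> then of_real ((if \<gamma> = [] then 1 else 2) * r ^ length \<gamma>) else 0)"

lemma poisson_poly_support:
  "{\<gamma>. poisson_poly r ws \<gamma> \<noteq> 0\<^sub>m (length ws) (length ws)}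
    \<subseteq> (\<lambda>(i, j). drop (length (ws ! i)) (ws ! j)) ` ({..<length ws} \<times> {..<length ws})"
proof
  fix \<gamma> assume "\<gamma> \<in> {\<gamma>. poisson_poly r ws \<gamma> \<noteq> 0\<^sub>m (length ws) (length ws)}"
  then obtain i j where ij: "i < length ws" "j < length ws" "poisson_poly r ws \<gamma> $$ (i, j) \<noteq> 0"
    by (auto simp: poisson_poly_def mat_eq_iff)
  then have "\<gamma> = drop (length (ws ! i)) (ws ! j)"
    by (simp add: poisson_poly_def split: if_splits)
  with ij(1,2) show "\<gamma> \<in> (\<lambda>(i, j). drop (length (ws ! i)) (ws ! j)) ` ({..<length ws} \<times> {..<length ws})"
    by (intro image_eqI[of _ _ "(i, j)"]) auto
qed

lemma nc_poly_poisson_poly: "nc_poly (length ws) (poisson_poly r ws)"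
  unfolding nc_poly_def
proof (intro conjI allI)
  show "finite {\<gamma>. poisson_poly r ws \<gamma> \<noteq> 0\<^sub>m (length ws) (length ws)}"
    by (rule finite_subset[OF poisson_poly_support]) simp
qed (simp add: poisson_poly_def)

text \<open>For two distinct words at most one extends the other, so only one of the pairs (i, j)
  and (j, i) contributes. Its factor 2 accounts for the conjugate entry of the kernel; the diagonal
  is its own conjugate and has factor 1.\<close>

lemma poly_form_poisson_poly:
  fixes Z :: "'n \<Rightarrow> 'a::chilbert_space \<Rightarrow>\<^sub>L 'a"
  assumes "distinct ws"
  shows "poly_form (length ws) (poisson_poly r ws) Z v =
    (\<Sum>i<length ws. \<Sum>j<length ws.
       if take (length (ws ! i)) (ws ! j) = ws ! i then (if i = j then 1 else 2) *
         inner (word_op (\<lambda>k. r *\<^sub>R Z k) (drop (length (ws ! i)) (ws ! j)) (v j)) (v i) else 0)"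
proof -
  define S where "S = (\<lambda>(i, j). drop (length (ws ! i)) (ws ! j)) ` ({..<length ws} \<times> {..<length ws})"
  have "Re (\<Sum>\<gamma>\<in>S. poisson_poly r ws \<gamma> $$ (i, j) * cinner (word_op Z \<gamma> (v j)) (v i)) =
      (if take (length (ws ! i)) (ws ! j) = ws ! i then (if i = j then 1 else 2) *
         inner (word_op (\<lambda>k. r *\<^sub>R Z k) (drop (length (ws ! i)) (ws ! j)) (v j)) (v i) else 0)"
    (is "?L = ?R") if ij: "i < length ws" "j < length ws" for i j
  proof -
    let ?\<gamma> = "drop (length (ws ! i)) (ws ! j)"
    have "?\<gamma> \<in> S" using ij by (auto simp: S_def)
    have iff: "ws ! j = ws ! i @ \<gamma> \<longleftrightarrow> take (length (ws ! i)) (ws ! j) = ws ! i \<and> \<gamma> = ?\<gamma>" for \<gamma>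
      by (metis append_eq_conv_conj append_take_drop_id)
    have "?L = (\<Sum>\<gamma>\<in>S. if \<gamma> = ?\<gamma> then (if take (length (ws ! i)) (ws ! j) = ws ! i
        then Re (of_real ((if ?\<gamma> = [] then 1 else 2) * r ^ length ?\<gamma>) * cinner (word_op Z ?\<gamma> (v j)) (v i))
        else 0) else 0)"
      unfolding Re_sum using ij by (intro sum.cong refl) (auto simp: poisson_poly_def iff)
    also have "\<dots> = (if take (length (ws ! i)) (ws ! j) = ws ! i
        then Re (of_real ((if ?\<gamma> = [] then 1 else 2) * r ^ length ?\<gamma>) * cinner (word_op Z ?\<gamma> (v j)) (v i))
        else 0)"
      using \<open>?\<gamma> \<in> S\<close> by (simp add: S_def sum.delta)
    also have "\<dots> = ?R"
    proof (cases "take (length (ws ! i)) (ws ! j) = ws ! i")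
      case True
      then have "?\<gamma> = [] \<longleftrightarrow> ws ! i = ws ! j" by (metis append_Nil2 append_take_drop_id append_self_conv)
      then have "?\<gamma> = [] \<longleftrightarrow> i = j" using assms ij by (simp add: nth_eq_iff_index_eq)
      with True show ?thesis
        by (cases "i = j") (simp_all add: word_op_scaleR blinfun.scaleR_left inner_cinner cinner_scaleR_left)
    qed simp
    finally show ?thesis .
  qed
  moreover have "finite S" by (simp add: S_def)
  ultimately show ?thesis
    using poly_form_eq[of S "poisson_poly r ws" "length ws" Z v] poisson_poly_support[of r ws]
    by (simp add: S_def[symmetric] Re_sum)
qed

text \<open>At most one prefix of \<open>\<alpha>\<close> equals \<open>\<beta>\<close>, the one of
  length \<open>length \<beta>\<close>. These are the matrix entries of the resolvent.\<close>

lemma prefix_sum_single: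
  "prefix_sum Z (l2_single \<beta> h) \<alpha>
    = (if take (length \<beta>) \<alpha> = \<beta> then adj (word_op Z (drop (length \<beta>) \<alpha>)) h else 0)"
proof -
  have iff: "take k \<alpha> = \<beta> \<longleftrightarrow> k = length \<beta> \<and> take (length \<beta>) \<alpha> = \<beta>" if "k \<le> length \<alpha>" for k
    using that by auto
  have nth: "l2_nth (l2_single \<beta> h) (take k \<alpha>) = (if k = length \<beta> \<and> take (length \<beta>) \<alpha> = \<beta> then h else 0)"
    if "k \<le> length \<alpha>" for k
    unfolding l2_single.rep_eq iff[OF that] ..
  have "prefix_sum Z (l2_single \<beta> h) \<alpha> = (\<Sum>k\<le>length \<alpha>. if k = length \<beta> then
      (if take (length \<beta>) \<alpha> = \<beta> then adj (word_op Z (drop (length \<beta>) \<alpha>)) h else 0) else 0)"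
    unfolding prefix_sum_def by (intro sum.cong refl) (simp add: nth)
  also have "\<dots> = (if take (length \<beta>) \<alpha> = \<beta> then adj (word_op Z (drop (length \<beta>) \<alpha>)) h else 0)"
    using arg_cong[of "take (length \<beta>) \<alpha>" \<beta> length] by (auto simp: sum.delta)
  finally show ?thesis .
qed

text \<open>Blocks \<open>v i\<close> fed to the polynomial correspond to the vector with coordinate
  \<open>v i\<close> at the word \<open>ws ! i\<close>. The polynomial contributes 2 <resolvent w,
  w> - |w|^2 and its value at the zero tuple is |w|^2, so the term with \<rho> - 1 turns the
  coefficient -1 into \<rho> - 2.\<close>

lemma poisson_form_finite_support:
  fixes Z :: "'n::finite \<Rightarrow> 'a::chilbert_space \<Rightarrow>\<^sub>L 'a"
  assumes lin: "\<And>i. clinear_op (Z i)" and inv: "invertible_op (id_blinfun - recon_op (\<lambda>i. r *\<^sub>R Z i))"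
    and "distinct ws"
  shows "harnack_form \<rho> (length ws) (poisson_poly r ws) Z v
    = poisson_form \<rho> (\<lambda>i. r *\<^sub>R Z i) (\<Sum>i<length ws. l2_single (ws ! i) (v i))"
proof -
  define m where "m = length ws"
  define w where "w = (\<Sum>i<m. l2_single (ws ! i) (v i))"
  define G where "G i j = (if take (length (ws ! i)) (ws ! j) = ws ! i
    then inner (word_op (\<lambda>k. r *\<^sub>R Z k) (drop (length (ws ! i)) (ws ! j)) (v j)) (v i) else 0)" for i j
  have lin': "clinear_op (r *\<^sub>R Z i)" for i by (intro clinear_op_scaleR lin)
  let ?N = "resolvent (\<lambda>i. r *\<^sub>R Z i)"
  have nthN: "l2_nth (?N w) \<alpha> = (\<Sum>i<m. l2_nth (?N (l2_single (ws ! i) (v i))) \<alpha>)" for \<alpha>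
    by (simp add: w_def blinfun.sum_right l2_nth_sum)
  have "inner (?N w) w = (\<Sum>j<m. inner (l2_single (ws ! j) (v j)) (?N w))"
    by (subst inner_commute) (simp add: w_def inner_sum_left)
  also have "\<dots> = (\<Sum>j<m. \<Sum>i<m. inner (l2_nth (?N (l2_single (ws ! i) (v i))) (ws ! j)) (v j))"
    unfolding inner_l2_single nthN inner_sum_right by (intro sum.cong refl) (rule inner_commute)
  also have "\<dots> = (\<Sum>j<m. \<Sum>i<m. G i j)"
  proof -
    have "inner (adj (word_op (\<lambda>k. r *\<^sub>R Z k) \<gamma>) x) y = inner (word_op (\<lambda>k. r *\<^sub>R Z k) \<gamma> y) x" for \<gamma> x y
      by (subst inner_adj'[OF clinear_op_word_op[OF lin']]) (rule inner_commute)
    then show ?thesis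
      by (intro sum.cong refl) (simp add: l2_nth_resolvent[OF lin' inv] prefix_sum_single G_def)
  qed
  also have "\<dots> = (\<Sum>i<m. \<Sum>j<m. G i j)" by (rule sum.swap)
  finally have Nw: "inner (?N w) w = (\<Sum>i<m. \<Sum>j<m. G i j)" .
  have diag: "(\<Sum>i<m. \<Sum>j<m. if i = j then inner (v j) (v i) else 0) = (\<Sum>i<m. (norm (v i))\<^sup>2)"
    by (simp add: sum.delta' dot_square_norm)
  have "(norm w)\<^sup>2 = (\<Sum>i<m. \<Sum>j<m. if i = j then inner (v j) (v i) else 0)"
    unfolding power2_norm_eq_inner w_def inner_sum_left inner_sum_right inner_l2_single l2_single.rep_eq
    using assms(3) by (intro sum.cong refl) (auto simp: m_def nth_eq_iff_index_eq)
  then have nw: "(norm w)\<^sup>2 = (\<Sum>i<m. (norm (v i))\<^sup>2)" unfolding diag .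
  \<comment> \<open>Doubling every \<open>G i j\<close> counts the diagonal once too often; the
    subtracted term compensates.\<close>
  have "poly_form m (poisson_poly r ws) Z v
      = (\<Sum>i<m. \<Sum>j<m. 2 * G i j - (if i = j then inner (v j) (v i) else 0))"
    unfolding m_def poly_form_poisson_poly[OF assms(3)]
    by (intro sum.cong refl) (auto simp: G_def)
  also have "\<dots> = 2 * inner (?N w) w - (norm w)\<^sup>2"
    by (simp only: sum_subtractf Nw nw diag sum_distrib_left)
  finally have 1: "poly_form m (poisson_poly r ws) Z v = 2 * inner (?N w) w - (norm w)\<^sup>2" .
  have zero: "word_op (\<lambda>k. r *\<^sub>R (0 :: 'a \<Rightarrow>\<^sub>L 'a)) \<gamma> = (if \<gamma> = [] then id_blinfun else 0)" for \<gamma> :: "'n list"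
    by (cases \<gamma>) (auto simp: word_op_Cons intro: blinfun_eqI)
  have "poly_form m (poisson_poly r ws) (\<lambda>_. 0 :: 'a \<Rightarrow>\<^sub>L 'a) v
      = (\<Sum>i<m. \<Sum>j<m. if i = j then inner (v j) (v i) else 0)"
    unfolding m_def poly_form_poisson_poly[OF assms(3)]
  proof (intro sum.cong refl)
    fix i j assume ij: "i \<in> {..<length ws}" "j \<in> {..<length ws}"
    have "i = j" if "take (length (ws ! i)) (ws ! j) = ws ! i" "length (ws ! j) \<le> length (ws ! i)"
      using that assms(3) ij by (simp add: nth_eq_iff_index_eq)
    then show "(if take (length (ws ! i)) (ws ! j) = ws ! i then (if i = j then 1 else 2) *
         inner (word_op (\<lambda>k. r *\<^sub>R (0 :: 'a \<Rightarrow>\<^sub>L 'a)) (drop (length (ws ! i)) (ws ! j)) (v j)) (v i) else 0)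
        = (if i = j then inner (v j) (v i) else 0)"
      unfolding zero by auto
  qed
  then have 2: "poly_form m (poisson_poly r ws) (\<lambda>_. 0 :: 'a \<Rightarrow>\<^sub>L 'a) v = (norm w)\<^sup>2" unfolding diag nw .
  show ?thesis
    unfolding harnack_form_def m_def[symmetric] w_def[symmetric] poisson_form_def 1 2
    by (simp add: algebra_simps)
qed

lemma sum_norm_adj_le_row_contraction:
  fixes T :: "'n::finite \<Rightarrow> 'k::chilbert_space \<Rightarrow>\<^sub>L 'k"
  assumes "\<And>i. clinear_op (T i)" "norm (\<Sum>i\<in>UNIV. T i o\<^sub>L adj (T i)) \<le> 1"
  shows "(\<Sum>i\<in>UNIV. (norm (adj (T i) x))\<^sup>2) \<le> (norm x)\<^sup>2"
proof -
  let ?S = "\<Sum>i\<in>UNIV. T i o\<^sub>L adj (T i)"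
  have "(\<Sum>i\<in>UNIV. (norm (adj (T i) x))\<^sup>2) = inner (?S x) x"
    by (simp add: blinfun.sum_left inner_sum_left inner_adj assms(1) dot_square_norm)
  also have "\<dots> \<le> norm (?S x) * norm x" by (rule norm_cauchy_schwarz)
  also have "\<dots> \<le> (1 * norm x) * norm x"
    by (intro mult_right_mono order_trans[OF norm_blinfun] assms(2) norm_ge_zero)
  finally show ?thesis by (simp add: power2_eq_square)
qed

text \<open>At \<rho> = 1 the term with the zero tuple drops out, so the polynomial at a row
  contraction T is the Poisson form of rT, which is nonnegative.\<close>

lemma Re_nonneg_on_ball_poisson_poly:
  assumes "distinct ws" "0 \<le> r" "r < 1"
  shows "Re_nonneg_on_ball TYPE('k::chilbert_space) (length ws) (poisson_poly r (ws :: 'n::finite list list))"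
proof (rule Re_nonneg_on_ballI)
  fix T :: "'n \<Rightarrow> 'k \<Rightarrow>\<^sub>L 'k" and v :: "nat \<Rightarrow> 'k"
  assume lin: "\<And>i. clinear_op (T i)" and ball: "norm (\<Sum>i\<in>UNIV. T i o\<^sub>L adj (T i)) < 1"
  have lin': "clinear_op (r *\<^sub>R T i)" for i by (intro clinear_op_scaleR lin)
  have "norm (recon_op (\<lambda>i. r *\<^sub>R T i)) \<le> r"
  proof (rule norm_recon_op_le[OF lin' _ assms(2)])
    fix x
    have "(\<Sum>i\<in>UNIV. (norm (adj (r *\<^sub>R T i) x))\<^sup>2) = r\<^sup>2 * (\<Sum>i\<in>UNIV. (norm (adj (T i) x))\<^sup>2)"
      by (simp add: adj_scaleR lin blinfun.scaleR_left power_mult_distrib sum_distrib_left)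
    also have "\<dots> \<le> r\<^sup>2 * (norm x)\<^sup>2"
      by (intro mult_left_mono sum_norm_adj_le_row_contraction lin less_imp_le[OF ball]) simp
    finally show "(\<Sum>i\<in>UNIV. (norm (adj (r *\<^sub>R T i) x))\<^sup>2) \<le> r\<^sup>2 * (norm x)\<^sup>2" .
  qed
  note pf = poisson_form_contraction[OF lin' this assms(2,3)]
  let ?w = "\<Sum>i<length ws. l2_single (ws ! i) (v i)"
  have "0 \<le> (1 - r) / (1 + r) * (norm ?w)\<^sup>2" using assms by simp
  also have "\<dots> \<le> poisson_form 1 (\<lambda>i. r *\<^sub>R T i) ?w" by (rule pf(2))
  also have "\<dots> = poly_form (length ws) (poisson_poly r ws) T v"
    using poisson_form_finite_support[OF lin pf(1) assms(1), of 1 v] by (simp add: harnack_form_def)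
  finally show "0 \<le> poly_form (length ws) (poisson_poly r ws) T v" .
qed

text \<open>The test polynomials give the inequality on finitely supported vectors; both forms are
  continuous, so truncations of \<open>w\<close> carry it over.\<close>

lemma harnack_dom_imp_poisson_form_le:
  fixes X Y :: "'n::finite \<Rightarrow> 'h::chilbert_space \<Rightarrow>\<^sub>L 'h"
  assumes linX: "\<And>i. clinear_op (X i)" and linY: "\<And>i. clinear_op (Y i)"
    and dom: "harnack_dom TYPE('k::chilbert_space) \<rho> c X Y" and r: "0 \<le> r" "r < 1"
    and invX: "invertible_op (id_blinfun - recon_op (\<lambda>i. r *\<^sub>R X i))"
    and invY: "invertible_op (id_blinfun - recon_op (\<lambda>i. r *\<^sub>R Y i))"
  shows "poisson_form \<rho> (\<lambda>i. r *\<^sub>R X i) w \<le> c\<^sup>2 * poisson_form \<rho> (\<lambda>i. r *\<^sub>R Y i) w"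
proof -
  let ?t = "\<lambda>F. \<Sum>\<alpha>\<in>F. l2_single \<alpha> (l2_nth w \<alpha>)"
  have fin: "poisson_form \<rho> (\<lambda>i. r *\<^sub>R X i) (?t F) \<le> c\<^sup>2 * poisson_form \<rho> (\<lambda>i. r *\<^sub>R Y i) (?t F)"
    if "finite F" for F
  proof -
    obtain ws where ws: "set ws = F" "distinct ws" using finite_distinct_list[OF \<open>finite F\<close>] by blast
    define v where "v i = l2_nth w (ws ! i)" for i
    have t: "(\<Sum>i<length ws. l2_single (ws ! i) (v i)) = ?t F"
      using sum.reindex_bij_betw[OF bij_betw_nth[OF ws(2) refl ws(1)[symmetric]],
          of "\<lambda>\<alpha>. l2_single \<alpha> (l2_nth w \<alpha>)"] by (simp add: v_def)
    have "harnack_form \<rho> (length ws) (poisson_poly r ws) X v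
        \<le> c\<^sup>2 * harnack_form \<rho> (length ws) (poisson_poly r ws) Y v"
      using dom nc_poly_poisson_poly Re_nonneg_on_ball_poisson_poly[OF ws(2) r]
      unfolding harnack_dom_iff[OF linX linY] by blast
    then show ?thesis
      unfolding poisson_form_finite_support[OF linX invX ws(2)]
        poisson_form_finite_support[OF linY invY ws(2)] t .
  qed
  have lim: "((\<lambda>F. poisson_form \<rho> Z (?t F)) \<longlongrightarrow> poisson_form \<rho> Z w) (finite_subsets_at_top UNIV)"
    for Z :: "'n \<Rightarrow> 'h \<Rightarrow>\<^sub>L 'h"
    unfolding poisson_form_def
    by (rule tendsto_add[OF tendsto_mult[OF tendsto_const
          tendsto_inner[OF blinfun.tendsto[OF tendsto_const l2_truncation_tendsto] l2_truncation_tendsto]]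
        tendsto_mult[OF tendsto_const tendsto_power[OF tendsto_norm[OF l2_truncation_tendsto]]]])
  show ?thesis
    by (rule tendsto_le[OF _ tendsto_mult[OF tendsto_const lim] lim])
      (auto intro!: eventually_finite_subsets_at_top_weakI fin)
qed

section \<open>Finite orthonormal families\<close>

definition orthonormal :: "nat \<Rightarrow> (nat \<Rightarrow> 'a::chilbert_space) \<Rightarrow> bool" where
  "orthonormal d e \<longleftrightarrow> (\<forall>k<d. \<forall>l<d. cinner (e k) (e l) = (if k = l then 1 else 0))"

text \<open>For an orthonormal family, \<open>expansion d e x = x\<close> says that \<open>x\<close>
  lies in its span.\<close>

definition expansion :: "nat \<Rightarrow> (nat \<Rightarrow> 'a::chilbert_space) \<Rightarrow> 'a \<Rightarrow> 'a" where
  "expansion d e x = (\<Sum>l<d. cinner x (e l) *\<^sub>C e l)"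

lemma cinner_expansion:
  assumes "orthonormal d e" "k < d"
  shows "cinner (expansion d e x) (e k) = cinner x (e k)"
proof -
  have "cinner (expansion d e x) (e k) = (\<Sum>l<d. if l = k then cinner x (e k) else 0)"
    unfolding expansion_def cinner_sum_left cinner_scaleC_left
    using assms by (intro sum.cong refl) (auto simp: orthonormal_def)
  then show ?thesis using assms(2) by (simp add: sum.delta)
qed

text \<open>One Gram-Schmidt step. The new vector is orthogonal to the old span, so vectors already
  captured stay captured.\<close>

lemma orthonormal_extend:
  fixes e :: "nat \<Rightarrow> 'a::chilbert_space"
  assumes on: "orthonormal d e" and ne: "expansion d e x \<noteq> x"
  obtains e' where "orthonormal (Suc d) e'" "expansion (Suc d) e' x = x"
    "\<And>b. expansion d e b = b \<Longrightarrow> expansion (Suc d) e' b = b"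
proof -
  define y where "y = x - expansion d e x"
  define e' where "e' = e(d := (1 / norm y) *\<^sub>R y)"
  have "y \<noteq> 0" using ne by (simp add: y_def)
  have ye: "cinner y (e k) = 0" if "k < d" for k
    using cinner_expansion[OF on that, of x] by (simp add: y_def cinner_diff_left)
  have ey: "cinner (e k) y = 0" if "k < d" for k
    using ye[OF that] by (subst cinner_commute) simp
  have yexp: "cinner (expansion d e b) y = 0" for b
    unfolding expansion_def cinner_sum_left cinner_scaleC_left by (intro sum.neutral) (simp add: ey)
  have exp: "expansion (Suc d) e' b = expansion d e b + (cinner b y / (norm y)\<^sup>2) *\<^sub>C y" for b
  proof -
    have "cinner b (e' d) *\<^sub>C e' d = (cinner b y / (norm y)\<^sup>2) *\<^sub>C y"
      by (simp add: e'_def cinner_scaleC_right scaleR_scaleC scaleC_scaleC power2_eq_square)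
    then show ?thesis by (simp add: expansion_def e'_def)
  qed
  have yy: "cinner y y = (norm y)\<^sup>2" by (simp add: cinner_self)
  show ?thesis
  proof (rule that[of e'])
    show "orthonormal (Suc d) e'"
      using on \<open>y \<noteq> 0\<close> unfolding orthonormal_def
      by (auto simp: e'_def less_Suc_eq cinner_scaleR_left cinner_scaleR_right ye ey yy power2_eq_square)
    have "cinner x y = cinner y y"
      using yexp[of x] by (simp add: y_def cinner_diff_left)
    then show "expansion (Suc d) e' x = x"
      using \<open>y \<noteq> 0\<close> by (simp add: exp yy scaleC_one) (simp add: y_def)
    show "expansion (Suc d) e' b = b" if "expansion d e b = b" for b
      using yexp[of b] by (simp add: exp that)
  qed
qed

lemma finite_orthonormal_basis:
  fixes B :: "'a::chilbert_space set"
  assumes "finite B"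
  obtains d e where "orthonormal d e" "\<And>b. b \<in> B \<Longrightarrow> expansion d e b = b"
proof -
  have "\<exists>d e. orthonormal d e \<and> (\<forall>b\<in>B. expansion d e b = b)"
    using assms
  proof (induction B rule: finite_induct)
    case empty
    show ?case by (rule exI[of _ 0]) (simp add: orthonormal_def)
  next
    case (insert x B)
    then obtain d e where de: "orthonormal d e" "\<forall>b\<in>B. expansion d e b = b" by blast
    show ?case
    proof (cases "expansion d e x = x")
      case True
      with de show ?thesis by blast
    next
      case False
      then show ?thesis using orthonormal_extend[OF de(1) False] de(2) by (metis insert_iff)
    qed
  qed
  then show ?thesis using that by blast
qed

text \<open>A finite family whose expansions reproduced every vector would span the space, so it can
  always be extended.\<close>

lemma infinite_dimensional_orthonormal:
  assumes "infinite_dimensional TYPE('k::chilbert_space)"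
  obtains f :: "nat \<Rightarrow> 'k::chilbert_space" where "orthonormal d f"
proof -
  interpret vector_space "scaleC :: complex \<Rightarrow> 'k \<Rightarrow> 'k" by (rule vector_space_scaleC)
  have "\<exists>f :: nat \<Rightarrow> 'k. orthonormal d f"
  proof (induction d)
    case (Suc d)
    then obtain f :: "nat \<Rightarrow> 'k" where f: "orthonormal d f" by blast
    have "\<exists>x. expansion d f x \<noteq> x"
    proof (rule ccontr)
      assume "\<nexists>x. expansion d f x \<noteq> x"
      moreover have "expansion d f x \<in> span (f ` {..<d})" for x
        unfolding expansion_def by (intro span_sum span_scale span_base) auto
      ultimately have "span (f ` {..<d}) = UNIV" by (metis UNIV_eq_I)
      then show False using assms unfolding infinite_dimensional_def by blast
    qed
    then show ?case using orthonormal_extend[OF f] by metis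
  qed (simp add: orthonormal_def)
  then show ?thesis using that by blast
qed

text \<open>For orthonormal families this is the partial isometry taking \<open>e l\<close> to
  \<open>f l\<close>; exchanging the families gives its adjoint.\<close>

definition transfer_op ::
  "nat \<Rightarrow> (nat \<Rightarrow> 'a::chilbert_space) \<Rightarrow> (nat \<Rightarrow> 'b::chilbert_space) \<Rightarrow> 'a \<Rightarrow>\<^sub>L 'b" where
  "transfer_op d e f = Blinfun (\<lambda>x. \<Sum>l<d. cinner x (e l) *\<^sub>C f l)"

lemma transfer_op_apply: "transfer_op d e f x = (\<Sum>l<d. cinner x (e l) *\<^sub>C f l)"
proof -
  have "bounded_linear (\<lambda>x. \<Sum>l<d. cinner x (e l) *\<^sub>C f l)"
  proof (rule bounded_linear_sum)
    fix l
    show "bounded_linear (\<lambda>x. cinner x (e l) *\<^sub>C f l)"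
    proof (rule bounded_linear_intro[of _ "norm (e l) * norm (f l)"])
      show "norm (cinner x (e l) *\<^sub>C f l) \<le> norm x * (norm (e l) * norm (f l))" for x
        using mult_right_mono[OF cmod_cinner_le[of x "e l"], of "norm (f l)"]
        by (simp add: norm_scaleC mult.assoc)
    qed (simp_all add: cinner_add_left scaleC_add_left cinner_scaleC_left scaleR_scaleC scaleC_scaleC)
  qed
  then show ?thesis unfolding transfer_op_def by (simp add: bounded_linear_Blinfun_apply)
qed

lemma clinear_op_transfer_op: "clinear_op (transfer_op d e f)"
  by (simp add: clinear_op_def transfer_op_apply cinner_scaleC_left scaleC_sum_right scaleC_scaleC)

lemma cinner_transfer_op: "cinner (transfer_op d e f x) y = cinner x (transfer_op d f e y)"
  unfolding transfer_op_apply cinner_sum_left cinner_sum_right cinner_scaleC_left cinner_scaleC_right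
  by (intro sum.cong refl) (simp add: mult.commute flip: cinner_commute)

lemma transfer_op_transfer_op:
  assumes "orthonormal d f"
  shows "transfer_op d f g (transfer_op d e f x) = transfer_op d e g x"
proof -
  have "cinner (\<Sum>k<d. cinner x (e k) *\<^sub>C f k) (f l) = cinner x (e l)" if "l < d" for l
  proof -
    have "cinner (\<Sum>k<d. cinner x (e k) *\<^sub>C f k) (f l) = (\<Sum>k<d. if k = l then cinner x (e l) else 0)"
      unfolding cinner_sum_left cinner_scaleC_left
      using assms that by (intro sum.cong refl) (auto simp: orthonormal_def)
    then show ?thesis using that by (simp add: sum.delta)
  qed
  then show ?thesis by (simp add: transfer_op_apply)
qed

text \<open>The adjoint times the operator is the projection \<open>?P\<close> onto the span of
  \<open>e\<close>, so the squared norm is \<open>inner ?P x\<close>.\<close>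

lemma norm_transfer_op_le:
  assumes e: "orthonormal d e" and f: "orthonormal d f"
  shows "norm (transfer_op d e f x) \<le> norm x"
proof -
  let ?P = "transfer_op d e e x"
  have "inner ?P ?P = inner ?P x"
    by (simp add: inner_cinner cinner_transfer_op transfer_op_transfer_op[OF e])
  also have "\<dots> \<le> norm ?P * norm x" by (rule norm_cauchy_schwarz)
  finally have "norm ?P * norm ?P \<le> norm ?P * norm x"
    by (simp add: dot_square_norm power2_eq_square)
  then have P: "norm ?P \<le> norm x"
    by (cases "norm ?P = 0") (auto simp: mult_le_cancel_left)
  have "(norm (transfer_op d e f x))\<^sup>2 = inner (transfer_op d f e (transfer_op d e f x)) x"
    unfolding power2_norm_eq_inner inner_cinner by (subst cinner_transfer_op[of d f e]) (rule refl)
  also have "\<dots> = inner ?P x" by (simp add: transfer_op_transfer_op[OF f])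
  also have "\<dots> \<le> norm ?P * norm x" by (rule norm_cauchy_schwarz)
  also have "\<dots> \<le> (norm x)\<^sup>2" using P by (simp add: power2_eq_square mult_right_mono)
  finally show ?thesis by (rule power2_le_imp_le) simp
qed

section \<open>Positivity on row isometries\<close>

text \<open>The row operator has norm at most s, hence so does its adjoint: the norm a of the
  adjoint at x satisfies a^2 \<le> s a |x|. Composing the two gives s^2.\<close>

lemma norm_row_product_le:
  fixes X :: "'n::finite \<Rightarrow> 'k::chilbert_space \<Rightarrow>\<^sub>L 'k"
  assumes lin: "\<And>i. clinear_op (X i)" and "0 \<le> s"
    and row: "\<And>y. norm (\<Sum>i\<in>UNIV. X i (y i)) \<le> s * sqrt (\<Sum>i\<in>UNIV. (norm (y i))\<^sup>2)"
  shows "norm (\<Sum>i\<in>UNIV. X i o\<^sub>L adj (X i)) \<le> s\<^sup>2"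
proof (rule norm_blinfun_bound)
  fix x
  define a where "a = sqrt (\<Sum>i\<in>UNIV. (norm (adj (X i) x))\<^sup>2)"
  define t where "t = (\<Sum>i\<in>UNIV. X i (adj (X i) x))"
  have "a \<ge> 0" by (simp add: a_def sum_nonneg)
  have t: "norm t \<le> s * a" unfolding t_def a_def by (rule row)
  have "a * a = inner t x"
    by (simp add: a_def t_def inner_sum_left inner_adj lin dot_square_norm sum_nonneg)
  also have "\<dots> \<le> norm t * norm x" by (rule norm_cauchy_schwarz)
  also have "\<dots> \<le> s * a * norm x" by (intro mult_right_mono t norm_ge_zero)
  finally have "a * a \<le> a * (s * norm x)" by (simp add: mult_ac)
  then have "a \<le> s * norm x" using \<open>a \<ge> 0\<close> \<open>0 \<le> s\<close> by (cases "a = 0") (auto simp: mult_le_cancel_left)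
  then have "s * a \<le> s * (s * norm x)" using \<open>0 \<le> s\<close> by (rule mult_left_mono)
  then show "norm ((\<Sum>i\<in>UNIV. X i o\<^sub>L adj (X i)) x) \<le> s\<^sup>2 * norm x"
    using t by (simp add: t_def blinfun.sum_left power2_eq_square mult.assoc)
qed simp

lemma poly_form_scale_tendsto:
  assumes "nc_poly m p"
  shows "((\<lambda>s. poly_form m p (\<lambda>i. s *\<^sub>R Z i) v) \<longlongrightarrow> poly_form m p Z v) (at_left 1)"
proof -
  let ?S = "{\<gamma>. p \<gamma> \<noteq> 0\<^sub>m m m}"
  have fin: "finite ?S" using assms by (simp add: nc_poly_def)
  define q where "q s = (\<Sum>i<m. \<Sum>j<m. \<Sum>\<gamma>\<in>?S. s ^ length \<gamma> * Re (p \<gamma> $$ (i, j) * cinner (word_op Z \<gamma> (v j)) (v i)))" for s :: real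
  have "poly_form m p (\<lambda>i. s *\<^sub>R Z i) v = q s" for s
    unfolding poly_form_eq[OF fin order_refl] Re_sum q_def
    by (simp add: word_op_scaleR blinfun.scaleR_left cinner_scaleR_left mult.left_commute[of _ "of_real _"]
        flip: of_real_power)
  moreover have "q 1 = poly_form m p Z v"
    unfolding poly_form_eq[OF fin order_refl] Re_sum q_def by simp
  moreover have "(q \<longlongrightarrow> q 1) (at_left 1)"
    unfolding q_def by (intro tendsto_sum tendsto_mult tendsto_power tendsto_ident_at tendsto_const)
  ultimately show ?thesis by simp
qed

text \<open>Only finitely many vectors V_\<gamma> v_j enter the form. Their span embeds
  isometrically into the space on which p is tested, the compression of sV to it lies in the open
  ball for s < 1, and s tends to 1 at the end.\<close>

lemma poly_form_row_isometry_nonneg: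
  fixes V :: "'n::finite \<Rightarrow> 'a::chilbert_space \<Rightarrow>\<^sub>L 'a"
  assumes inf: "infinite_dimensional TYPE('k::chilbert_space)"
    and lin: "\<And>i. clinear_op (V i)"
    and row: "\<And>i j x y. cinner (V i x) (V j y) = (if i = j then cinner x y else 0)"
    and p: "nc_poly m p" "Re_nonneg_on_ball TYPE('k) m p"
  shows "0 \<le> poly_form m p V v"
proof -
  let ?S = "{\<gamma>. p \<gamma> \<noteq> 0\<^sub>m m m}"
  have fin: "finite ?S" using p(1) by (simp add: nc_poly_def)
  then obtain N where N: "\<And>\<gamma>. \<gamma> \<in> ?S \<Longrightarrow> length \<gamma> \<le> N"
    using finite_nat_set_iff_bounded_le[of "length ` ?S"] by auto
  \<comment> \<open>All words up to length \<open>N\<close> are included, not only the support of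
    \<open>p\<close>: building V_\<gamma> v_j letter by letter passes through the suffixes of
    \<gamma>.\<close>
  define B where "B = (\<lambda>(\<gamma>, j). word_op V \<gamma> (v j)) ` ({\<gamma>. length \<gamma> \<le> N} \<times> {..<m})"
  have BI: "word_op V \<gamma> (v j) \<in> B" if "length \<gamma> \<le> N" "j < m" for \<gamma> j
    unfolding B_def using that by (intro image_eqI[of _ _ "(\<gamma>, j)"]) auto
  have "finite B"
    using finite_lists_length_le[of "UNIV :: 'n set" N] by (simp add: B_def)
  then obtain d and e :: "nat \<Rightarrow> 'a" where e: "orthonormal d e" "\<And>b. b \<in> B \<Longrightarrow> expansion d e b = b"
    using finite_orthonormal_basis by blast
  obtain f :: "nat \<Rightarrow> 'k" where f: "orthonormal d f"
    using infinite_dimensional_orthonormal[OF inf] by blast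
  let ?U = "transfer_op d e f" and ?U' = "transfer_op d f e"
  have UU: "?U' (?U b) = b" if "b \<in> B" for b
    using e(2)[OF that] by (simp add: transfer_op_transfer_op[OF f]) (simp add: transfer_op_apply expansion_def)
  have pos: "0 \<le> poly_form m p (\<lambda>i. s *\<^sub>R V i) v" if s: "0 \<le> s" "s < 1" for s
  proof -
    define X where "X = (\<lambda>i. s *\<^sub>R (?U o\<^sub>L V i o\<^sub>L ?U'))"
    have linX: "clinear_op (X i)" for i
      unfolding X_def by (intro clinear_op_scaleR clinear_op_compose clinear_op_transfer_op lin)
    have "norm (\<Sum>i\<in>UNIV. X i o\<^sub>L adj (X i)) \<le> s\<^sup>2"
    proof (rule norm_row_product_le[OF linX s(1)])
      fix y :: "'n \<Rightarrow> 'k"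
      let ?z = "\<Sum>i\<in>UNIV. V i (?U' (y i))"
      have "norm (\<Sum>i\<in>UNIV. X i (y i)) = s * norm (?U ?z)"
        using s by (simp add: X_def blinfun.scaleR_left blinfun.sum_right flip: scaleR_sum_right)
      also have "\<dots> \<le> s * norm ?z" by (intro mult_left_mono norm_transfer_op_le e f s)
      also have "norm ?z = sqrt (\<Sum>i\<in>UNIV. (norm (V i (?U' (y i))))\<^sup>2)"
      proof -
        have "(norm ?z)\<^sup>2 = (\<Sum>i\<in>UNIV. (norm (V i (?U' (y i))))\<^sup>2)"
          by (rule norm_sum_Pythagorean)
            (auto simp: pairwise_def real_inner_class.orthogonal_def inner_cinner row)
        then show ?thesis by (metis norm_ge_zero real_sqrt_unique)
      qed
      also have "\<dots> \<le> sqrt (\<Sum>i\<in>UNIV. (norm (y i))\<^sup>2)"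
      proof (intro real_sqrt_le_mono sum_mono power_mono norm_ge_zero)
        fix i
        have "(norm (V i (?U' (y i))))\<^sup>2 = (norm (?U' (y i)))\<^sup>2"
          by (simp add: power2_norm_eq_inner inner_cinner row)
        then have "norm (V i (?U' (y i))) = norm (?U' (y i))" by simp
        also have "\<dots> \<le> norm (y i)" by (rule norm_transfer_op_le[OF f e(1)])
        finally show "norm (V i (?U' (y i))) \<le> norm (y i)" .
      qed
      finally show "norm (\<Sum>i\<in>UNIV. X i (y i)) \<le> s * sqrt (\<Sum>i\<in>UNIV. (norm (y i))\<^sup>2)"
        using s(1) by (simp add: mult_left_mono)
    qed
    moreover have "s\<^sup>2 < 1" using s by (simp add: power_less_one_iff)
    ultimately have "0 \<le> poly_form m p X (\<lambda>j. ?U (v j))"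
      using Re_nonneg_on_ballD[OF p(2) linX] by force
    also have "\<dots> = poly_form m p (\<lambda>i. s *\<^sub>R V i) v"
      unfolding poly_form_eq[OF fin order_refl]
    proof (intro arg_cong[of _ _ Re] sum.cong refl arg_cong2[of _ _ _ _ "(*)"])
      fix i j \<gamma> assume ij: "i \<in> {..<m}" "j \<in> {..<m}" and \<gamma>: "\<gamma> \<in> ?S"
      \<comment> \<open>Each vector reached on the way lies in \<open>B\<close>, where
        \<open>?U'\<close> undoes \<open>?U\<close>; thus the compression is exact on these words,
        although it is not multiplicative in general.\<close>
      have "word_op X \<gamma> (?U (v j)) = s ^ length \<gamma> *\<^sub>R ?U (word_op V \<gamma> (v j))" if "length \<gamma> \<le> N" for \<gamma>
        using that
      proof (induction \<gamma>)
        case (Cons k \<gamma>)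
        then have "word_op V \<gamma> (v j) \<in> B" using ij by (intro BI) auto
        with Cons show ?case by (simp add: word_op_Cons X_def blinfun.bilinear_simps UU)
      qed simp
      then have "cinner (word_op X \<gamma> (?U (v j))) (?U (v i))
          = of_real (s ^ length \<gamma>) * cinner (word_op V \<gamma> (v j)) (?U' (?U (v i)))"
        using N[OF \<gamma>] by (simp add: cinner_scaleR_left cinner_transfer_op del: of_real_power)
      also have "?U' (?U (v i)) = v i" using BI[of "[]" i] ij by (intro UU) simp
      finally show "cinner (word_op X \<gamma> (?U (v j))) (?U (v i))
          = cinner (word_op (\<lambda>i. s *\<^sub>R V i) \<gamma> (v j)) (v i)"
        by (simp add: word_op_scaleR blinfun.scaleR_left cinner_scaleR_left)
    qed
    finally show ?thesis .
  qed
  have "eventually (\<lambda>s. 0 \<le> poly_form m p (\<lambda>i. s *\<^sub>R V i) v) (at_left 1)"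
    by (rule eventually_at_leftI[of 0]) (auto intro: pos)
  then show ?thesis
    by (intro tendsto_lowerbound[OF poly_form_scale_tendsto[OF p(1)]]) auto
qed

section \<open>The Poisson kernel as a multi-Toeplitz operator\<close>

definition poisson_kernel ::
  "real \<Rightarrow> ('n::finite \<Rightarrow> 'h::chilbert_space \<Rightarrow>\<^sub>L 'h) \<Rightarrow> ('n list, 'h) l2 \<Rightarrow>\<^sub>L ('n list, 'h) l2"
  where "poisson_kernel \<rho> Z = resolvent Z + adj (resolvent Z) + (\<rho> - 2) *\<^sub>R id_blinfun"

abbreviation left_creation :: "'n \<Rightarrow> ('n list, 'h::chilbert_space) l2 \<Rightarrow>\<^sub>L ('n list, 'h) l2"
  where "left_creation i \<equiv> l2_push (Cons i) id_blinfun"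

context
  fixes Z :: "'n::finite \<Rightarrow> 'h::chilbert_space \<Rightarrow>\<^sub>L 'h"
  assumes lin: "\<And>i. clinear_op (Z i)"
    and inv: "invertible_op (id_blinfun - recon_op Z)"
begin

lemma clinear_op_resolvent: "clinear_op (resolvent Z)"
  unfolding resolvent_def
  by (intro clinear_op_inv_op inv clinear_op_diff clinear_op_id clinear_op_recon_op lin)

lemma cinner_poisson_kernel:
  "cinner (poisson_kernel \<rho> Z v) w
    = cinner (resolvent Z v) w + cinner v (resolvent Z w) + of_real (\<rho> - 2) * cinner v w"
  by (simp add: poisson_kernel_def blinfun.bilinear_simps cinner_add_left cinner_diff_left
      cinner_scaleR_left cinner_adj'[OF clinear_op_resolvent] left_diff_distrib)

lemma clinear_op_poisson_kernel: "clinear_op (poisson_kernel \<rho> Z)"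
  unfolding poisson_kernel_def
  by (intro clinear_op_add clinear_op_scaleR clinear_op_adj clinear_op_id clinear_op_resolvent)

lemma poisson_kernel_selfadjoint:
  "cinner (poisson_kernel \<rho> Z v) w = cinner v (poisson_kernel \<rho> Z w)"
proof -
  have "cinner v (poisson_kernel \<rho> Z w) = cnj (cinner (poisson_kernel \<rho> Z w) v)"
    by (rule cinner_commute)
  also have "\<dots> = cinner v (resolvent Z w) + cinner (resolvent Z v) w + of_real (\<rho> - 2) * cinner v w"
    unfolding cinner_poisson_kernel by (simp flip: cinner_commute)
  finally show ?thesis by (simp add: cinner_poisson_kernel)
qed

lemma inner_poisson_kernel: "inner (poisson_kernel \<rho> Z w) w = poisson_form \<rho> Z w"
proof -
  have "inner (poisson_kernel \<rho> Z w) w = inner (resolvent Z w) w + inner w (resolvent Z w) + (\<rho> - 2) * inner w w"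
    unfolding inner_cinner cinner_poisson_kernel by simp
  then show ?thesis by (simp add: poisson_form_def inner_commute[of w] dot_square_norm)
qed

lemma prefix_sum_left_creation:
  "prefix_sum Z (left_creation i u) \<alpha> = (case \<alpha> of [] \<Rightarrow> 0 | j # \<beta> \<Rightarrow> if j = i then prefix_sum Z u \<beta> else 0)"
proof -
  have inj: "inj (Cons i)" by (simp add: inj_def)
  have nth: "l2_nth (left_creation i u) [] = 0"
    "l2_nth (left_creation i u) (j # \<beta>) = (if j = i then l2_nth u \<beta> else 0)" for j \<beta>
    using l2_nth_l2_push_image[OF inj, of id_blinfun u \<beta>]
    by (auto simp: l2_nth_l2_push[OF inj] image_iff)
  show ?thesis
  proof (cases \<alpha>)
    case Nil
    then show ?thesis by (simp add: prefix_sum_Nil nth)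
  next
    case (Cons j \<beta>)
    \<comment> \<open>The term k = 0 vanishes because a left creation operator leaves nothing at the
      empty word; the remaining indices shift by one.\<close>
    have "prefix_sum Z (left_creation i u) (j # \<beta>)
        = (\<Sum>k\<le>length \<beta>. adj (word_op Z (drop k \<beta>)) (if j = i then l2_nth u (take k \<beta>) else 0))"
      unfolding prefix_sum_def list.size add_0_right add_Suc_right
      by (subst sum.atMost_Suc_shift) (simp add: nth)
    then show ?thesis using Cons by (simp add: prefix_sum_def)
  qed
qed

text \<open>\<open>recon_op\<close> changes words only at their right end, left creation only at the
  left end.\<close>

lemma resolvent_left_creation: "resolvent Z (left_creation i u) = left_creation i (resolvent Z u)"
proof (rule l2_eqI)
  fix \<alpha>
  have inj: "inj (Cons i)" by (simp add: inj_def)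
  show "l2_nth (resolvent Z (left_creation i u)) \<alpha> = l2_nth (left_creation i (resolvent Z u)) \<alpha>"
    unfolding l2_nth_resolvent[OF lin inv] prefix_sum_left_creation
    using l2_nth_l2_push_image[OF inj, of id_blinfun "resolvent Z u"]
    by (cases \<alpha>) (auto simp: l2_nth_l2_push[OF inj] image_iff l2_nth_resolvent[OF lin inv])
qed

lemma cinner_left_creation:
  "cinner (left_creation i u) (left_creation j v) = (if i = j then cinner u v else 0)"
  for u v :: "('n list, 'h) l2"
proof (cases "i = j")
  case True
  then show ?thesis by (simp add: cinner_l2_push_id inj_def)
next
  case False
  then have "range (Cons i) \<inter> range (Cons j) = {}" by auto
  with False show ?thesis by (simp add: cinner_l2_push_disjoint inj_def)
qed

text \<open>The resolvent commutes with left creation, so the form of the kernel inherits the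
  relations between the creation operators. This is the multi-Toeplitz property.\<close>

lemma poisson_kernel_toeplitz:
  "cinner (poisson_kernel \<rho> Z (left_creation i u)) (left_creation j v)
    = (if i = j then cinner (poisson_kernel \<rho> Z u) v else 0)"
  by (simp add: cinner_poisson_kernel resolvent_left_creation cinner_left_creation)

text \<open>The entries against the vacuum are the only ones a polynomial sees. The zero tuple in
  the last term isolates the empty word, so that the right-hand side has the shape of
  \<open>harnack_form\<close>.\<close>

lemma poisson_kernel_entry:
  "cinner (poisson_kernel \<rho> Z (l2_single \<gamma> h)) (l2_single [] k)
    = cinner (word_op Z \<gamma> h) k + of_real (\<rho> - 1) * cinner (word_op (\<lambda>_. 0) \<gamma> h) k"
proof -
  have "cinner (resolvent Z (l2_single \<gamma> h)) (l2_single [] k) = (if \<gamma> = [] then cinner h k else 0)"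
    by (subst cinner_commute) (simp add: cinner_l2_single l2_nth_resolvent[OF lin inv] prefix_sum_single
        flip: cinner_commute)
  moreover have "cinner (l2_single \<gamma> h) (resolvent Z (l2_single [] k)) = cinner (word_op Z \<gamma> h) k"
    by (simp add: cinner_l2_single l2_nth_resolvent[OF lin inv] prefix_sum_single
        cinner_adj[OF clinear_op_word_op[OF lin]])
  moreover have "cinner (l2_single \<gamma> h) (l2_single [] k) = (if \<gamma> = [] then cinner h k else 0)"
    by (simp add: cinner_l2_single l2_single.rep_eq)
  moreover have "word_op (\<lambda>_. 0) \<gamma> h = (if \<gamma> = [] then h else 0)" for \<gamma> :: "'n list"
    by (cases \<gamma>) (simp_all add: word_op_Cons)
  ultimately show ?thesis by (simp add: cinner_poisson_kernel left_diff_distrib)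
qed

end

lemma word_op_left_creation: "word_op left_creation \<gamma> (l2_single [] h) = l2_single \<gamma> h"
proof (induction \<gamma>)
  case (Cons i \<gamma>)
  have inj: "inj (Cons i)" by (simp add: inj_def)
  have "left_creation i (l2_single \<gamma> h) = l2_single (i # \<gamma>) h"
    by (rule l2_eqI, rename_tac \<alpha>, case_tac \<alpha>)
      (auto simp: l2_nth_l2_push[OF inj] image_iff l2_single.rep_eq inv_into_f_f[OF inj])
  with Cons show ?case by (simp add: word_op_Cons)
qed simp

text \<open>If \<open>D = C K\<^sub>Y - K\<^sub>X\<close> is strictly positive, then \<open>D\<^sup>1\<^sup>/\<^sup>2 L\<^sub>i D\<^sup>-\<^sup>1\<^sup>/\<^sup>2\<close> are isometries with
  orthogonal ranges, because \<open>D\<close> is multi-Toeplitz.\<close>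

lemma harnack_form_le_perturbed:
  fixes X Y :: "'n::finite \<Rightarrow> 'h::chilbert_space \<Rightarrow>\<^sub>L 'h"
  assumes inf: "infinite_dimensional TYPE('k::chilbert_space)"
    and X: "\<And>i. clinear_op (X i)" "invertible_op (id_blinfun - recon_op X)"
    and Y: "\<And>i. clinear_op (Y i)" "invertible_op (id_blinfun - recon_op Y)"
    and "\<delta> > 0" and lower: "\<And>w. \<delta> * (norm w)\<^sup>2 \<le> C * poisson_form \<rho> Y w - poisson_form \<rho> X w"
    and p: "nc_poly m p" "Re_nonneg_on_ball TYPE('k) m p"
  shows "harnack_form \<rho> m p X v \<le> C * harnack_form \<rho> m p Y v"
proof -
  define D where "D = C *\<^sub>R poisson_kernel \<rho> Y - poisson_kernel \<rho> X"
  have linD: "clinear_op D"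
    unfolding D_def by (intro clinear_op_diff clinear_op_scaleR clinear_op_poisson_kernel X Y)
  have cD: "cinner (D u) w = of_real C * cinner (poisson_kernel \<rho> Y u) w - cinner (poisson_kernel \<rho> X u) w" for u w
    by (simp add: D_def blinfun.bilinear_simps cinner_diff_left cinner_scaleR_left)
  have saD: "adj D = D"
    by (rule adj_eqI[OF _ linD]) (simp add: D_def blinfun.bilinear_simps cinner_diff_left
        cinner_scaleR_left cinner_diff_right cinner_scaleR_right
        poisson_kernel_selfadjoint[OF X] poisson_kernel_selfadjoint[OF Y])
  have lowerD: "\<delta> * (norm w)\<^sup>2 \<le> inner (D w) w" for w
    using lower[of w] by (simp add: inner_cinner cD)
      (simp add: inner_poisson_kernel[OF X] inner_poisson_kernel[OF Y] flip: inner_cinner)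
  note sq = sqrt_op_strictly_positive[OF linD saD \<open>\<delta> > 0\<close> lowerD]
  define S where "S = sqrt_op D"
  have linS: "clinear_op S" and saS: "adj S = S"
    using sq(1) pos_op_selfadjoint unfolding S_def pos_op_def by auto
  have SS: "S (S x) = D x" for x
    using arg_cong[OF sq(2), of "\<lambda>T. blinfun_apply T x"] by (simp add: S_def)
  have cS: "cinner (S x) (S y) = cinner (D x) y" for x y
    using cinner_adj[OF linS, of "S x" y] by (simp add: saS SS)
  obtain N where N: "S o\<^sub>L N = id_blinfun" "N o\<^sub>L S = id_blinfun"
    using sq(3) unfolding S_def by blast
  have SN: "S (N x) = x" and NS: "N (S x) = x" for x
    using arg_cong[OF N(1), of "\<lambda>T. blinfun_apply T x"] arg_cong[OF N(2), of "\<lambda>T. blinfun_apply T x"]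
    by simp_all
  define V where "V i = S o\<^sub>L left_creation i o\<^sub>L N" for i
  have linV: "clinear_op (V i)" for i
    unfolding V_def by (intro clinear_op_compose linS clinear_op_inverse[OF linS N] clinear_op_l2_push)
      (simp_all add: inj_def)
  \<comment> \<open>The two factors \<open>S\<close> combine to \<open>D\<close>, the Toeplitz
    property removes the creation operators, and \<open>N\<close> then cancels the remaining
    roots.\<close>
  have row: "cinner (V i x) (V j y) = (if i = j then cinner x y else 0)" for i j x y
  proof -
    have "cinner (V i x) (V j y) = (if i = j then cinner (D (N x)) (N y) else 0)"
      by (simp add: V_def cS) (simp add: cD poisson_kernel_toeplitz[OF X] poisson_kernel_toeplitz[OF Y])
    then show ?thesis by (simp add: SN flip: cS)
  qed
  \<comment> \<open>\<open>S\<close> intertwines left creation with \<open>V\<close>, so on the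
    range of \<open>S\<close> words in \<open>V\<close> reduce to words in the creation
    operators.\<close>
  have word: "word_op V \<gamma> (S x) = S (word_op left_creation \<gamma> x)" for \<gamma> x
    by (induction \<gamma>) (simp_all add: word_op_Cons V_def NS)
  \<comment> \<open>Images of vacuum vectors under the root: at these the coefficients of V_\<gamma>
    are the entries of \<open>D\<close> between \<gamma> and the empty word.\<close>
  let ?v = "\<lambda>j. S (l2_single [] (v j))"
  let ?T = "{\<gamma>. p \<gamma> \<noteq> 0\<^sub>m m m}"
  have fin: "finite ?T" using p(1) by (simp add: nc_poly_def)
  have entry: "cinner (word_op V \<gamma> (?v j)) (?v i)
      = of_real C * (cinner (word_op Y \<gamma> (v j)) (v i) + of_real (\<rho> - 1) * cinner (word_op (\<lambda>_. 0) \<gamma> (v j)) (v i))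
        - (cinner (word_op X \<gamma> (v j)) (v i) + of_real (\<rho> - 1) * cinner (word_op (\<lambda>_. 0) \<gamma> (v j)) (v i))" for \<gamma> i j
    unfolding word cS word_op_left_creation cD poisson_kernel_entry[OF X] poisson_kernel_entry[OF Y] ..
  have "poly_form m p V ?v = C * harnack_form \<rho> m p Y v - harnack_form \<rho> m p X v"
  proof -
    define q where "q U = (\<Sum>i<m. \<Sum>j<m. \<Sum>\<gamma>\<in>?T. p \<gamma> $$ (i, j) * cinner (word_op U \<gamma> (v j)) (v i))"
      for U :: "'n \<Rightarrow> 'h \<Rightarrow>\<^sub>L 'h"
    have pf: "poly_form m p U v = Re (q U)" for U :: "'n \<Rightarrow> 'h \<Rightarrow>\<^sub>L 'h"
      unfolding q_def by (rule poly_form_eq[OF fin order_refl])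
    have "poly_form m p V ?v = Re (of_real C * (q Y + of_real (\<rho> - 1) * q (\<lambda>_. 0))
        - (q X + of_real (\<rho> - 1) * q (\<lambda>_. 0)))"
      unfolding poly_form_eq[OF fin order_refl] entry q_def sum_distrib_left sum.distrib[symmetric]
        sum_subtractf[symmetric]
      by (intro arg_cong[of _ _ Re] sum.cong refl) (simp add: algebra_simps)
    then show ?thesis by (simp add: harnack_form_def pf)
  qed
  then show ?thesis
    using poly_form_row_isometry_nonneg[OF inf linV row p, of ?v] by simp
qed

lemma harnack_form_scale_tendsto:
  assumes "nc_poly m p"
  shows "((\<lambda>r. harnack_form \<rho> m p (\<lambda>i. r *\<^sub>R Z i) v) \<longlongrightarrow> harnack_form \<rho> m p Z v) (at_left 1)"
  unfolding harnack_form_def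
  by (intro tendsto_add poly_form_scale_tendsto[OF assms] tendsto_const)

text \<open>With c^2 + \<epsilon> in place of c^2 the difference of the forms is bounded below by
  \<epsilon> \<open>\<delta> r\<close>. This gap may close as r tends to 1, so \<epsilon> tends to 0
  at fixed r first, and r tends to 1 afterwards.\<close>

lemma poisson_form_le_imp_harnack_dom:
  fixes X Y :: "'n::finite \<Rightarrow> 'h::chilbert_space \<Rightarrow>\<^sub>L 'h"
  assumes inf: "infinite_dimensional TYPE('k::chilbert_space)"
    and linX: "\<And>i. clinear_op (X i)" and linY: "\<And>i. clinear_op (Y i)"
    and invX: "\<And>r. 0 \<le> r \<Longrightarrow> r < 1 \<Longrightarrow> invertible_op (id_blinfun - recon_op (\<lambda>i. r *\<^sub>R X i))"
    and invY: "\<And>r. 0 \<le> r \<Longrightarrow> r < 1 \<Longrightarrow> invertible_op (id_blinfun - recon_op (\<lambda>i. r *\<^sub>R Y i))"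
    and pos: "\<And>r. 0 \<le> r \<Longrightarrow> r < 1 \<Longrightarrow> 0 < \<delta> r"
    and lower: "\<And>r w. 0 \<le> r \<Longrightarrow> r < 1 \<Longrightarrow> \<delta> r * (norm w)\<^sup>2 \<le> poisson_form \<rho> (\<lambda>i. r *\<^sub>R Y i) w"
    and le: "\<And>r w. 0 \<le> r \<Longrightarrow> r < 1 \<Longrightarrow>
      poisson_form \<rho> (\<lambda>i. r *\<^sub>R X i) w \<le> c\<^sup>2 * poisson_form \<rho> (\<lambda>i. r *\<^sub>R Y i) w"
  shows "harnack_dom TYPE('k) \<rho> c X Y"
  unfolding harnack_dom_iff[OF linX linY]
proof (intro allI impI)
  fix m and p :: "'n list \<Rightarrow> complex mat" and v :: "nat \<Rightarrow> 'h"
  assume p: "nc_poly m p \<and> Re_nonneg_on_ball TYPE('k) m p"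
  have perturbed: "harnack_form \<rho> m p (\<lambda>i. r *\<^sub>R X i) v \<le> (c\<^sup>2 + \<epsilon>) * harnack_form \<rho> m p (\<lambda>i. r *\<^sub>R Y i) v"
    if r: "0 \<le> r" "r < 1" and "\<epsilon> > 0" for r \<epsilon>
  proof (rule harnack_form_le_perturbed[OF inf])
    show "\<epsilon> * \<delta> r > 0" using pos[OF r] \<open>\<epsilon> > 0\<close> by simp
    show "\<epsilon> * \<delta> r * (norm w)\<^sup>2 \<le> (c\<^sup>2 + \<epsilon>) * poisson_form \<rho> (\<lambda>i. r *\<^sub>R Y i) w - poisson_form \<rho> (\<lambda>i. r *\<^sub>R X i) w"
      for w
      using le[OF r, of w] mult_left_mono[OF lower[OF r, of w] less_imp_le[OF \<open>\<epsilon> > 0\<close>]]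
      unfolding distrib_right mult.assoc by linarith
  qed (use p in \<open>auto intro: clinear_op_scaleR linX linY invX invY r\<close>)
  have "harnack_form \<rho> m p (\<lambda>i. r *\<^sub>R X i) v \<le> c\<^sup>2 * harnack_form \<rho> m p (\<lambda>i. r *\<^sub>R Y i) v"
    if r: "0 \<le> r" "r < 1" for r
  proof (rule tendsto_lowerbound)
    let ?h = "harnack_form \<rho> m p (\<lambda>i. r *\<^sub>R Y i) v"
    have "((\<lambda>\<epsilon>. (c\<^sup>2 + \<epsilon>) * ?h) \<longlongrightarrow> (c\<^sup>2 + 0) * ?h) (at_right 0)"
      by (intro tendsto_mult tendsto_add tendsto_const tendsto_ident_at)
    then show "((\<lambda>\<epsilon>. (c\<^sup>2 + \<epsilon>) * ?h) \<longlongrightarrow> c\<^sup>2 * ?h) (at_right 0)" by simp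
    show "\<forall>\<^sub>F \<epsilon> in at_right 0. harnack_form \<rho> m p (\<lambda>i. r *\<^sub>R X i) v \<le> (c\<^sup>2 + \<epsilon>) * ?h"
      by (rule eventually_at_rightI[of 0 1]) (auto intro: perturbed r)
  qed simp
  then have "\<forall>\<^sub>F r in at_left 1. harnack_form \<rho> m p (\<lambda>i. r *\<^sub>R X i) v \<le> c\<^sup>2 * harnack_form \<rho> m p (\<lambda>i. r *\<^sub>R Y i) v"
    by (intro eventually_at_leftI[of 0]) auto
  then show "harnack_form \<rho> m p X v \<le> c\<^sup>2 * harnack_form \<rho> m p Y v"
    using p by (intro tendsto_le[OF _ tendsto_mult[OF tendsto_const harnack_form_scale_tendsto]
          harnack_form_scale_tendsto]) auto
qed

section \<open>The hyperbolic metric\<close>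

lemma harnack_dom_iff_norm_le:
  fixes X Y :: "'n::finite \<Rightarrow> 'h::chilbert_space \<Rightarrow>\<^sub>L 'h"
  assumes inf: "infinite_dimensional TYPE('k::chilbert_space)" and "\<rho> > 0"
    and X: "class_C TYPE('g1::chilbert_space) \<rho> X" and Y: "class_C TYPE('g2::chilbert_space) \<rho> Y"
    and "0 \<le> c"
  shows "harnack_dom TYPE('k) \<rho> c X Y \<longleftrightarrow>
    (\<forall>r\<in>{0..<1}. norm (C_op \<rho> (\<lambda>i. r *\<^sub>R X i) o\<^sub>L inv_op (C_op \<rho> (\<lambda>i. r *\<^sub>R Y i))) \<le> c)"
proof -
  have linX: "clinear_op (X i)" and linY: "clinear_op (Y i)" for i
    using X Y by (auto simp: class_C_def)
  have pos: "0 < \<rho> * ((1 - r) / (1 + r))" if "0 \<le> r" "r < 1" for r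
    using that \<open>\<rho> > 0\<close> by simp
  note rX = class_C_resolvent[OF X _ _ \<open>\<rho> > 0\<close>] and rY = class_C_resolvent[OF Y _ _ \<open>\<rho> > 0\<close>]
  have CX: "(norm (C_op \<rho> (\<lambda>i. r *\<^sub>R X i) w))\<^sup>2 = poisson_form \<rho> (\<lambda>i. r *\<^sub>R X i) w"
    and CY: "(norm (C_op \<rho> (\<lambda>i. r *\<^sub>R Y i) w))\<^sup>2 = poisson_form \<rho> (\<lambda>i. r *\<^sub>R Y i) w"
    and invCY: "invertible_op (C_op \<rho> (\<lambda>i. r *\<^sub>R Y i))"
    if r: "0 \<le> r" "r < 1" for r w
    using C_op_norm[OF clinear_op_scaleR[OF linX] rX(1)[OF r] pos[OF r] rX(2)[OF r]]
      C_op_norm[OF clinear_op_scaleR[OF linY] rY(1)[OF r] pos[OF r] rY(2)[OF r]] by blast+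
  have iff: "norm (C_op \<rho> (\<lambda>i. r *\<^sub>R X i) o\<^sub>L inv_op (C_op \<rho> (\<lambda>i. r *\<^sub>R Y i))) \<le> c
      \<longleftrightarrow> (\<forall>w. poisson_form \<rho> (\<lambda>i. r *\<^sub>R X i) w \<le> c\<^sup>2 * poisson_form \<rho> (\<lambda>i. r *\<^sub>R Y i) w)"
    if r: "0 \<le> r" "r < 1" for r
    unfolding norm_compose_inv_op_le_iff[OF invCY[OF r] \<open>0 \<le> c\<close>] CX[OF r] CY[OF r] ..
  show ?thesis
  proof
    assume "harnack_dom TYPE('k) \<rho> c X Y"
    then show "\<forall>r\<in>{0..<1}. norm (C_op \<rho> (\<lambda>i. r *\<^sub>R X i) o\<^sub>L inv_op (C_op \<rho> (\<lambda>i. r *\<^sub>R Y i))) \<le> c"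
      using harnack_dom_imp_poisson_form_le[OF linX linY _ _ _ rX(1) rY(1)] by (auto simp: iff)
  next
    assume "\<forall>r\<in>{0..<1}. norm (C_op \<rho> (\<lambda>i. r *\<^sub>R X i) o\<^sub>L inv_op (C_op \<rho> (\<lambda>i. r *\<^sub>R Y i))) \<le> c"
    then show "harnack_dom TYPE('k) \<rho> c X Y"
      using iff by (intro poisson_form_le_imp_harnack_dom[OF inf linX linY rX(1) rY(1) pos rY(2)]) auto
  qed
qed

text \<open>At r = 0 both tuples vanish and the product is the identity. This forces the maximum of
  the suprema to be at least 1, in agreement with the constraint c > 1 in the metric.\<close>

lemma norm_C_op_ratio_at_0:
  fixes X Y :: "'n::finite \<Rightarrow> 'h::chilbert_space \<Rightarrow>\<^sub>L 'h"
  assumes "\<rho> > 0" and Y: "class_C TYPE('g::chilbert_space) \<rho> Y" and "(h::'h) \<noteq> 0"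
  shows "1 \<le> norm (C_op \<rho> (\<lambda>i. 0 *\<^sub>R X i) o\<^sub>L inv_op (C_op \<rho> (\<lambda>i. 0 *\<^sub>R Y i)))"
proof -
  have linY: "clinear_op (0 *\<^sub>R Y i)" for i by simp
  note r = class_C_resolvent[OF Y, of 0, simplified, OF \<open>\<rho> > 0\<close>]
  have C: "invertible_op (C_op \<rho> (\<lambda>i. 0 *\<^sub>R Y i))"
    by (rule C_op_norm(1)[where \<delta> = \<rho> and Z = "\<lambda>i. 0 *\<^sub>R Y i", OF linY])
      (use r \<open>\<rho> > 0\<close> in simp_all)
  have eq: "(\<lambda>i. 0 *\<^sub>R X i) = (\<lambda>i. 0 *\<^sub>R Y i)" by simp
  have "norm (l2_single ([] :: 'n list) h) \<noteq> 0"
    using \<open>h \<noteq> 0\<close> l2_single.rep_eq[of "[] :: 'n list" h] by (metis norm_eq_zero zero_l2.rep_eq)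
  then show ?thesis
    unfolding eq invertible_op_inv_op(1)[OF C]
    using norm_blinfun[of id_blinfun "l2_single ([] :: 'n list) h"] by simp
qed

text \<open>Boundedness is asserted along with the formula because a real \<open>SUP\<close> over an
  unbounded set would carry no information. The membership witnesses for X and Y may live in
  different spaces.\<close>

theorem theorem3p7:
  fixes X Y :: "'n::finite \<Rightarrow> 'h::chilbert_space \<Rightarrow>\<^sub>L 'h" and \<rho> :: real
  assumes "infinite_dimensional TYPE('k::chilbert_space)"
    and "\<rho> > 0"
    and "class_C TYPE('g1::chilbert_space) \<rho> X"
    and "class_C TYPE('g2::chilbert_space) \<rho> Y"
    and "harnack_equiv TYPE('k) \<rho> X Y"
  shows "bdd_above ((\<lambda>r. norm (C_op \<rho> (\<lambda>i. r *\<^sub>R X i) o\<^sub>L inv_op (C_op \<rho> (\<lambda>i. r *\<^sub>R Y i)))) ` {0..<1})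
    \<and> bdd_above ((\<lambda>r. norm (C_op \<rho> (\<lambda>i. r *\<^sub>R Y i) o\<^sub>L inv_op (C_op \<rho> (\<lambda>i. r *\<^sub>R X i)))) ` {0..<1})
    \<and> hyperbolic_dist TYPE('k) \<rho> X Y =
        ln (max
          (SUP r\<in>{0..<1}. norm (C_op \<rho> (\<lambda>i. r *\<^sub>R X i) o\<^sub>L inv_op (C_op \<rho> (\<lambda>i. r *\<^sub>R Y i))))
          (SUP r\<in>{0..<1}. norm (C_op \<rho> (\<lambda>i. r *\<^sub>R Y i) o\<^sub>L inv_op (C_op \<rho> (\<lambda>i. r *\<^sub>R X i)))))"
proof -
  define a where "a r = norm (C_op \<rho> (\<lambda>i. r *\<^sub>R X i) o\<^sub>L inv_op (C_op \<rho> (\<lambda>i. r *\<^sub>R Y i)))" for r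
  define b where "b r = norm (C_op \<rho> (\<lambda>i. r *\<^sub>R Y i) o\<^sub>L inv_op (C_op \<rho> (\<lambda>i. r *\<^sub>R X i)))" for r
  define M where "M = max (SUP r\<in>{0..<1}. a r) (SUP r\<in>{0..<1}. b r)"
  have equiv: "harnack_equiv_const TYPE('k) \<rho> c X Y \<longleftrightarrow> (\<forall>r\<in>{0..<1}. a r \<le> c) \<and> (\<forall>r\<in>{0..<1}. b r \<le> c)"
    if "0 \<le> c" for c
    unfolding harnack_equiv_const_def a_def b_def
    using harnack_dom_iff_norm_le[OF assms(1,2,3,4) that] harnack_dom_iff_norm_le[OF assms(1,2,4,3) that]
    by blast
  obtain c where "1 \<le> c" "harnack_equiv_const TYPE('k) \<rho> c X Y"
    using assms(5) by (auto simp: harnack_equiv_def)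
  then have c: "\<And>r. r \<in> {0..<1} \<Longrightarrow> a r \<le> c" "\<And>r. r \<in> {0..<1} \<Longrightarrow> b r \<le> c" using equiv by auto
  have bdd: "bdd_above (a ` {0..<1})" "bdd_above (b ` {0..<1})"
    by (rule bdd_aboveI2[of _ _ c], rule c, assumption)+
  have M: "(\<forall>r\<in>{0..<1}. a r \<le> c) \<and> (\<forall>r\<in>{0..<1}. b r \<le> c) \<longleftrightarrow> M \<le> c" for c
    unfolding M_def max.bounded_iff using cSUP_le_iff[OF _ bdd(1), of c] cSUP_le_iff[OF _ bdd(2), of c] by simp
  have set: "{c. c > 1 \<and> harnack_equiv_const TYPE('k) \<rho> c X Y} = {c. c > 1 \<and> M \<le> c}"
    using equiv M by auto
  have "ln (Inf {c. c > 1 \<and> M \<le> c}) = ln M"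
  proof (cases "\<exists>h::'h. h \<noteq> 0")
    case True
    then obtain h :: 'h where "h \<noteq> 0" by blast
    then have "1 \<le> a 0" unfolding a_def by (rule norm_C_op_ratio_at_0[OF assms(2,4)])
    moreover have "a 0 \<le> M" using M[of M] by simp
    ultimately have "1 \<le> M" by linarith
    have "Inf {c. c > 1 \<and> M \<le> c} = M"
    \<comment> \<open>The constraint c > 1 is strict: for M = 1 the set is an open ray whose infimum
      is not attained, for M > 1 it is a closed ray.\<close>
    proof (cases "M = 1")
      case True
      then have "{c. c > 1 \<and> M \<le> c} = {1<..}" by auto
      then show ?thesis using True by simp
    next
      case False
      then have "{c. c > 1 \<and> M \<le> c} = {M..}" using \<open>1 \<le> M\<close> by auto
      then show ?thesis by simp
    qed
    then show ?thesis by simp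
  next
    case False
    \<comment> \<open>On the zero space \<open>M = 0\<close>, and the claim rests on \<open>ln 0 = 0\<close>.\<close>
    then have "norm T = 0" for T :: "('n list, 'h) l2 \<Rightarrow>\<^sub>L ('n list, 'h) l2"
      by (auto intro!: blinfun_eqI l2_eqI) (metis (full_types))
    then have "a r = 0" "b r = 0" for r by (simp_all add: a_def b_def)
    then have "M = 0" by (simp add: M_def)
    then have "{c. c > 1 \<and> M \<le> c} = {1<..}" by auto
    then show ?thesis using \<open>M = 0\<close> by simp
  qed
  then show ?thesis
    using bdd unfolding hyperbolic_dist_def set M_def a_def b_def by blast
qed

end
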